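(* Let $k\geq3$ and let $A$ be a subset of $ER(\mathcal{N})$ that is downward closed under $\leq_c$ and contains every equivalence relation on $\mathcal{N}$ that has at most $k$ equivalence classes and belongs (as a subset of $\mathcal{N}\times\mathcal{N}$) to $BC({\bf\Sigma}^0_1(\mathcal{N}\times\mathcal{N}))$. Then the first-order theory of the quotient partial order of the preorder $(A;\leq_c)$ is undecidable.
   Context: $\mathcal{N}=\omega^\omega$ is the Baire space and $ER(\mathcal{N})$ the set of all equivalence relations on $\mathcal{N}$. For $E,F\in ER(\mathcal{N})$, $E\leq_cF$ iff there is a continuous $f:\mathcal{N}\to\mathcal{N}$ such that for all $x,y$, $(x,y)\in E\iff(f(x),f(y))\in F$. $BC({\bf\Sigma}^0_1(Y))$ denotes the class of finite Boolean combinations of open subsets of $Y$. *)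

theory Defs
  imports "HOL-Analysis.Function_Topology" "HOL-Library.Nat_Bijection"
begin

section \<open>Equivalence relations on the Baire space\<close>

text \<open>The type \<open>nat \<Rightarrow> nat\<close> carries the product topology of the discrete topology on \<open>nat\<close>
  (\<^theory>\<open>HOL-Analysis.Function_Topology\<close>), so as a topological space it is the Baire space.\<close>

type_synonym baire = "nat \<Rightarrow> nat"

definition ER :: "baire rel set" where
  "ER = {E. equiv UNIV E}"

definition cont_reducible :: "baire rel \<Rightarrow> baire rel \<Rightarrow> bool" (infix "\<le>\<^sub>c" 50) where
  "E \<le>\<^sub>c F \<longleftrightarrow>
    (\<exists>f :: baire \<Rightarrow> baire. continuous_on UNIV f \<and> (\<forall>x y. (x, y) \<in> E \<longleftrightarrow> (f x, f y) \<in> F))"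

inductive_set BC_open :: "'a::topological_space set set" where
  BC_open_open: "open U \<Longrightarrow> U \<in> BC_open"
| BC_open_Compl: "S \<in> BC_open \<Longrightarrow> - S \<in> BC_open"
| BC_open_Un: "S \<in> BC_open \<Longrightarrow> T \<in> BC_open \<Longrightarrow> S \<union> T \<in> BC_open"
| BC_open_Int: "S \<in> BC_open \<Longrightarrow> T \<in> BC_open \<Longrightarrow> S \<inter> T \<in> BC_open"

definition at_most_classes :: "nat \<Rightarrow> baire rel \<Rightarrow> bool" where
  "at_most_classes k E \<longleftrightarrow> finite (UNIV // E) \<and> card (UNIV // E) \<le> k"

section \<open>Quotient partial order of a preorder\<close>

definition preorder_equiv :: "'a set \<Rightarrow> ('a \<Rightarrow> 'a \<Rightarrow> bool) \<Rightarrow> 'a rel" where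
  "preorder_equiv A le = {(x, y). x \<in> A \<and> y \<in> A \<and> le x y \<and> le y x}"

definition quotient_carrier :: "'a set \<Rightarrow> ('a \<Rightarrow> 'a \<Rightarrow> bool) \<Rightarrow> 'a set set" where
  "quotient_carrier A le = A // preorder_equiv A le"

definition quotient_le :: "('a \<Rightarrow> 'a \<Rightarrow> bool) \<Rightarrow> 'a set \<Rightarrow> 'a set \<Rightarrow> bool" where
  "quotient_le le X Y \<longleftrightarrow> (\<exists>x\<in>X. \<exists>y\<in>Y. le x y)"

section \<open>First-order logic in the language of partial orders\<close>

text \<open>Formulas over one binary relation symbol, with equality. The omitted connectives and the
  universal quantifier are the usual abbreviations. Variables are named by natural numbers.\<close>

datatype fm =
    Le nat nat
  | Eq nat nat
  | Neg fm
  | Conj fm fm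
  | Ex nat fm

fun free_vars :: "fm \<Rightarrow> nat set" where
  "free_vars (Le i j) = {i, j}"
| "free_vars (Eq i j) = {i, j}"
| "free_vars (Neg p) = free_vars p"
| "free_vars (Conj p q) = free_vars p \<union> free_vars q"
| "free_vars (Ex i p) = free_vars p - {i}"

fun sat :: "'a set \<Rightarrow> ('a \<Rightarrow> 'a \<Rightarrow> bool) \<Rightarrow> (nat \<Rightarrow> 'a) \<Rightarrow> fm \<Rightarrow> bool" where
  "sat M le v (Le i j) \<longleftrightarrow> le (v i) (v j)"
| "sat M le v (Eq i j) \<longleftrightarrow> v i = v j"
| "sat M le v (Neg p) \<longleftrightarrow> \<not> sat M le v p"
| "sat M le v (Conj p q) \<longleftrightarrow> sat M le v p \<and> sat M le v q"
| "sat M le v (Ex i p) \<longleftrightarrow> (\<exists>a\<in>M. sat M le (v(i := a)) p)"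

definition fo_theory :: "'a set \<Rightarrow> ('a \<Rightarrow> 'a \<Rightarrow> bool) \<Rightarrow> fm set" where
  "fo_theory M le = {p. free_vars p = {} \<and> (\<forall>v. range v \<subseteq> M \<longrightarrow> sat M le v p)}"

lemma sat_cong:
  "(\<And>i. i \<in> free_vars p \<Longrightarrow> v i = w i) \<Longrightarrow> sat M le v p \<longleftrightarrow> sat M le w p"
proof (induction p arbitrary: v w)
  case (Ex i p)
  have "sat M le (v(i := a)) p \<longleftrightarrow> sat M le (w(i := a)) p" for a
    by (rule Ex.IH) (use Ex.prems in auto)
  then show ?case by simp
next
  case (Neg p)
  have "sat M le v p \<longleftrightarrow> sat M le w p"
    by (rule Neg.IH) (use Neg.prems in auto)
  then show ?case by simp
next
  case (Conj p q)
  have "sat M le v p \<longleftrightarrow> sat M le w p"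
    by (rule Conj.IH(1)) (use Conj.prems in auto)
  moreover have "sat M le v q \<longleftrightarrow> sat M le w q"
    by (rule Conj.IH(2)) (use Conj.prems in auto)
  ultimately show ?case by simp
qed simp_all

fun fm_code :: "fm \<Rightarrow> nat" where
  "fm_code (Le i j) = 5 * prod_encode (i, j)"
| "fm_code (Eq i j) = 5 * prod_encode (i, j) + 1"
| "fm_code (Neg p) = 5 * fm_code p + 2"
| "fm_code (Conj p q) = 5 * prod_encode (fm_code p, fm_code q) + 3"
| "fm_code (Ex i p) = 5 * prod_encode (i, fm_code p) + 4"

lemma inj_fm_code: "inj fm_code"
proof (rule injI)
  have md: "fm_code p mod 5 = (case p of Le _ _ \<Rightarrow> 0 | Eq _ _ \<Rightarrow> 1 | Neg _ \<Rightarrow> 2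
      | Conj _ _ \<Rightarrow> 3 | Ex _ _ \<Rightarrow> 4)" for p
    by (cases p) (simp_all, presburger?)
  have dv: "fm_code p div 5 = (case p of Le i j \<Rightarrow> prod_encode (i, j)
      | Eq i j \<Rightarrow> prod_encode (i, j) | Neg p \<Rightarrow> fm_code p
      | Conj p q \<Rightarrow> prod_encode (fm_code p, fm_code q)
      | Ex i p \<Rightarrow> prod_encode (i, fm_code p))" for p
    by (cases p) simp_all
  fix p q show "fm_code p = fm_code q \<Longrightarrow> p = q"
  proof (induction p arbitrary: q)
    case (Le i j)
    from arg_cong[OF Le, of "\<lambda>n. n mod 5"] arg_cong[OF Le, of "\<lambda>n. n div 5"]
    show ?case unfolding md dv by (cases q) auto
  next
    case (Eq i j)
    from arg_cong[OF Eq, of "\<lambda>n. n mod 5"] arg_cong[OF Eq, of "\<lambda>n. n div 5"]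
    show ?case unfolding md dv by (cases q) auto
  next
    case (Neg p)
    from arg_cong[OF Neg.prems, of "\<lambda>n. n mod 5"] arg_cong[OF Neg.prems, of "\<lambda>n. n div 5"]
    show ?case unfolding md dv by (cases q) (auto intro: Neg.IH)
  next
    case (Conj p p')
    from arg_cong[OF Conj.prems, of "\<lambda>n. n mod 5"] arg_cong[OF Conj.prems, of "\<lambda>n. n div 5"]
    show ?case unfolding md dv by (cases q) (auto intro: Conj.IH)
  next
    case (Ex i p)
    from arg_cong[OF Ex.prems, of "\<lambda>n. n mod 5"] arg_cong[OF Ex.prems, of "\<lambda>n. n div 5"]
    show ?case unfolding md dv by (cases q) (auto intro: Ex.IH)
  qed
qed

section \<open>Decidability\<close>

text \<open>Kleene's partial recursive functions, given as programs with a big-step evaluation relation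
  on argument lists. Arities are not recorded in the syntax: a program has no value on an argument
  list that fits none of the rules, and none where an unbounded search does not succeed.\<close>

datatype recf =
    Zero
  | Succ
  | Proj nat
  | Comp recf "recf list"
  | PrimRec recf recf
  | Mu recf

inductive evals :: "recf \<Rightarrow> nat list \<Rightarrow> nat \<Rightarrow> bool" where
  evals_Zero: "evals Zero xs 0"
| evals_Succ: "evals Succ [x] (Suc x)"
| evals_Proj: "i < length xs \<Longrightarrow> evals (Proj i) xs (xs ! i)"
| evals_Comp: "list_all2 (\<lambda>g y. evals g xs y) gs ys \<Longrightarrow> evals f ys z \<Longrightarrow> evals (Comp f gs) xs z"
| evals_PrimRec_0: "evals f xs z \<Longrightarrow> evals (PrimRec f g) (0 # xs) z"
| evals_PrimRec_Suc: "evals (PrimRec f g) (n # xs) y \<Longrightarrow> evals g (y # n # xs) z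
    \<Longrightarrow> evals (PrimRec f g) (Suc n # xs) z"
| evals_Mu: "evals f (n # xs) 0 \<Longrightarrow> (\<forall>m<n. \<exists>y. evals f (m # xs) (Suc y))
    \<Longrightarrow> evals (Mu f) xs n"
  monos list.rel_mono_strong

lemma evals_deterministic: "evals f xs y \<Longrightarrow> evals f xs z \<Longrightarrow> y = z"
proof (induction f xs y arbitrary: z rule: evals.induct)
  case (evals_Comp xs gs ys f z z')
  from evals_Comp.prems obtain ys' where
    ys': "list_all2 (\<lambda>g y. evals g xs y) gs ys'" and z': "evals f ys' z'"
    by (cases rule: evals.cases) auto
  have "ys = ys'"
    using evals_Comp.IH(1) ys' by (auto simp: list_all2_conv_all_nth intro!: nth_equalityI)
  with z' evals_Comp.IH(2) show ?case by simp
next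
  case (evals_PrimRec_Suc f g n xs y w)
  from evals_PrimRec_Suc.prems obtain y' where
    "evals (PrimRec f g) (n # xs) y'" "evals g (y' # n # xs) z"
    by (cases rule: evals.cases) auto
  with evals_PrimRec_Suc.IH show ?case by blast
next
  case (evals_Mu f n xs)
  from evals_Mu.prems have z: "evals f (z # xs) 0" "\<forall>m<z. \<exists>y. evals f (m # xs) (Suc y)"
    by (cases rule: evals.cases; auto)+
  show ?case
  proof (cases n z rule: linorder_cases)
    case less
    then show ?thesis using z evals_Mu.IH by blast
  next
    case greater
    then show ?thesis using z evals_Mu.IH by blast
  qed
next
  case (evals_PrimRec_0 f xs z g w)
  from evals_PrimRec_0.prems have "evals f xs w"
    by (cases rule: evals.cases) auto
  with evals_PrimRec_0.IH show ?case by blast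
qed (erule evals.cases; simp)+

definition decidable_set :: "nat set \<Rightarrow> bool" where
  "decidable_set S \<longleftrightarrow> (\<exists>f. \<forall>n. evals f [n] (if n \<in> S then 1 else 0))"

definition decidable_theory :: "fm set \<Rightarrow> bool" where
  "decidable_theory T \<longleftrightarrow> decidable_set (fm_code ` T)"

end

theory Submission
  imports Defs
begin

text \<open>Labelled trees give finite Boolean combinations of open sets: the colour of \<open>x\<close> is found by
  walking down the tree, each nonzero entry of \<open>x\<close> choosing a child. Label-preserving continuous
  reducibility of these colourings is the homomorphism order on trees. Among trees with labels
  \<open>0, 1, 2\<close> there is a tree \<open>core\<close> that is so asymmetric that every reduction of it to the trees used
  here preserves labels, and relative to it the join irreducible relations are first-order
  definable and are, below a finite join of trees, those below one of the trees. Arbitrarily large antichains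
  of vertex trees above \<open>core\<close>, together with trees lying above exactly two given vertices, then make every finite
  graph first-order definable with parameters.

  Finite graphs suffice to code the finite set of facts that justify a halting computation of a
  recursive function. A sentence saying that no parameters code a sound set of facts containing
  \<open>h(m) = 1\<close> is false if \<open>h(m) = 1\<close> and true if \<open>h(m) = 0\<close>; diagonalising against a decision procedure
  yields the theorem. Unintended parameters do no harm, since soundness of the coded facts
  is all that the argument needs.\<close>

section \<open>The Baire space and colourings\<close>

text \<open>A reduction of equivalence relations may permute classes, so labels, and with them
  unions of pieces, have no invariant meaning. Working above \<open>core\<close> restores them: a
  reduction composed with a copy of \<open>core\<close> realises an injective relabelling of
  \<open>core\<close> in the target. The coding trees admit only the identity because no path from
  their roots meets 0 after 2. Three labels are enough for this, whence k \<ge> 3.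

  On the topological side everything rests on self-similarity: each neighbourhood of the zero
  sequence contains a full copy of a tree colouring. A reduction may thus be restricted until its
  image lies in one clopen piece of the target. Both the combinatorial description of the order and
  join irreducibility follow.

  On the logical side neither arithmetic nor finiteness is defined. A halting computation needs only
  a finite model to be witnessed. Conversely, induction along the true computation forces any
  locally justified claim about the same numerals to give the same value, even in a nonstandard
  order with circular claims.\<close>

definition agree :: "nat \<Rightarrow> baire \<Rightarrow> baire \<Rightarrow> bool" where
  "agree n x y \<longleftrightarrow> (\<forall>i<n. y i = x i)"

lemma agree_refl [simp]: "agree n x x"
  by (simp add: agree_def)

lemma agree_mono: "agree n x y \<Longrightarrow> m \<le> n \<Longrightarrow> agree m x y"
  by (auto simp: agree_def)

lemma open_cylinder: "open {y. agree n x y}"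
proof -
  have "{y. agree n x y} = (\<Inter>i\<in>{..<n}. (\<lambda>y. y i) -` {x i})"
    by (auto simp: agree_def)
  also have "open \<dots>"
    by (intro open_INT ballI open_vimage) (auto intro: continuous_on_product_coordinates open_discrete)
  finally show ?thesis .
qed

lemma open_baire_iff: "open (U :: baire set) \<longleftrightarrow> (\<forall>x\<in>U. \<exists>n. \<forall>y. agree n x y \<longrightarrow> y \<in> U)"
proof
  assume U: "open U"
  show "\<forall>x\<in>U. \<exists>n. \<forall>y. agree n x y \<longrightarrow> y \<in> U"
  proof
    fix x assume x: "x \<in> U"
    from U have "openin (product_topology (\<lambda>i. euclidean) UNIV) U"
      by (simp add: open_fun_def)
    from product_topology_open_contains_basis[OF this x] obtain X where
      X: "x \<in> Pi\<^sub>E UNIV X" "finite {i. X i \<noteq> topspace euclidean}" "Pi\<^sub>E UNIV X \<subseteq> U" by blast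
    from X(2) obtain n where n: "\<forall>i\<in>{i. X i \<noteq> UNIV}. i < n"
      using finite_nat_set_iff_bounded by auto
    have "y \<in> U" if "agree n x y" for y
    proof -
      have "y i \<in> X i" for i
      proof (cases "X i = UNIV")
        case False
        then have "i < n" using n by auto
        then have "y i = x i" using that by (auto simp: agree_def)
        then show ?thesis using X(1) by (auto simp: PiE_iff)
      qed auto
      then show ?thesis using X(3) by (auto simp: PiE_iff)
    qed
    then show "\<exists>n. \<forall>y. agree n x y \<longrightarrow> y \<in> U" by blast
  qed
next
  assume *: "\<forall>x\<in>U. \<exists>n. \<forall>y. agree n x y \<longrightarrow> y \<in> U"
  show "open U"
  proof (subst open_subopen, intro ballI)
    fix x assume "x \<in> U"
    with * obtain n where "\<forall>y. agree n x y \<longrightarrow> y \<in> U" by blast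
    then show "\<exists>T. open T \<and> x \<in> T \<and> T \<subseteq> U"
      by (intro exI[of _ "{y. agree n x y}"]) (auto simp: open_cylinder)
  qed
qed

abbreviation cont :: "(baire \<Rightarrow> baire) \<Rightarrow> bool" where
  "cont \<equiv> continuous_on UNIV"

lemma cont_iff: "cont f \<longleftrightarrow> (\<forall>x n. \<exists>m. \<forall>y. agree m x y \<longrightarrow> agree n (f x) (f y))"
proof
  assume f: "cont f"
  show "\<forall>x n. \<exists>m. \<forall>y. agree m x y \<longrightarrow> agree n (f x) (f y)"
  proof (intro allI)
    fix x n
    have "open (f -` {y. agree n (f x) y})"
      using f open_cylinder by (rule open_vimage[rotated])
    then show "\<exists>m. \<forall>y. agree m x y \<longrightarrow> agree n (f x) (f y)"
      unfolding open_baire_iff by auto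
  qed
next
  assume *: "\<forall>x n. \<exists>m. \<forall>y. agree m x y \<longrightarrow> agree n (f x) (f y)"
  have "open (f -` U)" if "open U" for U
    unfolding open_baire_iff
  proof
    fix x assume "x \<in> f -` U"
    with that obtain n where "\<forall>y. agree n (f x) y \<longrightarrow> y \<in> U"
      unfolding open_baire_iff by auto
    with * show "\<exists>n. \<forall>y. agree n x y \<longrightarrow> y \<in> f -` U" by (metis vimageI)
  qed
  then show "cont f" by (simp add: continuous_on_open_vimage)
qed

lemma cont_comp: "cont f \<Longrightarrow> cont g \<Longrightarrow> cont (\<lambda>x. f (g x))"
  using continuous_on_compose2[of UNIV f UNIV g] by simp

lemma cont_id: "cont (\<lambda>x. x)"
  by (rule continuous_on_id)

section \<open>Locally constant functions and gluing of continuous maps\<close>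

definition loc_const :: "(baire \<Rightarrow> 'a) \<Rightarrow> bool" where
  "loc_const j \<longleftrightarrow> (\<forall>x. \<exists>m. \<forall>y. agree m x y \<longrightarrow> j y = j x)"

lemma loc_const_nth: "loc_const (\<lambda>x. x n)"
  unfolding loc_const_def by (intro allI exI[of _ "Suc n"]) (auto simp: agree_def)

lemma loc_const_comp: "loc_const j \<Longrightarrow> cont f \<Longrightarrow> loc_const (\<lambda>x. j (f x))"
  unfolding loc_const_def cont_iff by meson

lemma loc_const_app: "loc_const j \<Longrightarrow> loc_const (\<lambda>x. h (j x))"
  unfolding loc_const_def by metis

lemma loc_const_app2:
  assumes "loc_const j" "loc_const k" shows "loc_const (\<lambda>x. h (j x) (k x))"
  unfolding loc_const_def
proof
  fix x
  obtain m n where "\<forall>y. agree m x y \<longrightarrow> j y = j x" "\<forall>y. agree n x y \<longrightarrow> k y = k x"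
    using assms unfolding loc_const_def by blast
  then show "\<exists>m. \<forall>y. agree m x y \<longrightarrow> h (j y) (k y) = h (j x) (k x)"
    by (intro exI[of _ "max m n"]) (metis agree_mono max.cobounded1 max.cobounded2)
qed

lemma cont_glue:
  assumes "loc_const j" "\<And>a. cont (h a)" shows "cont (\<lambda>x. h (j x) x)"
  unfolding cont_iff
proof (intro allI)
  fix x n
  obtain m where m: "\<forall>y. agree m x y \<longrightarrow> j y = j x"
    using assms(1) unfolding loc_const_def by blast
  obtain m' where m': "\<forall>y. agree m' x y \<longrightarrow> agree n (h (j x) x) (h (j x) y)"
    using assms(2) unfolding cont_iff by blast
  show "\<exists>m. \<forall>y. agree m x y \<longrightarrow> agree n (h (j x) x) (h (j y) y)"
    using m m' by (intro exI[of _ "max m m'"]) (metis agree_mono max.cobounded1 max.cobounded2)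
qed

lemma cont_if:
  assumes "loc_const P" "cont f" "cont g" shows "cont (\<lambda>x. if P x then f x else g x)"
proof -
  have "cont (if b then f else g)" for b using assms(2,3) by simp
  from cont_glue[OF assms(1) this] show ?thesis by (simp add: if_distribR)
qed

definition tail :: "baire \<Rightarrow> baire" where "tail x = (\<lambda>i. x (Suc i))"
definition cons :: "nat \<Rightarrow> baire \<Rightarrow> baire" where "cons a x = case_nat a x"
definition drp :: "nat \<Rightarrow> baire \<Rightarrow> baire" where "drp n x = (\<lambda>i. x (n + i))"
definition pad :: "nat \<Rightarrow> baire \<Rightarrow> baire" where "pad n x = (\<lambda>i. if i < n then 0 else x (i - n))"
abbreviation zro :: baire where "zro \<equiv> (\<lambda>_. 0)"

lemma tail_cons [simp]: "tail (cons a x) = x"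
  by (simp add: tail_def cons_def)

lemma cons_0 [simp]: "cons a x 0 = a"
  by (simp add: cons_def)

lemma cont_tail: "cont tail"
  unfolding cont_iff tail_def by (intro allI, rule_tac x="Suc n" in exI) (auto simp: agree_def)

lemma cont_drp: "cont (drp k)"
  unfolding cont_iff drp_def by (intro allI, rule_tac x="k + n" in exI) (auto simp: agree_def)

lemma cont_cons: "cont (cons a)"
  unfolding cont_iff cons_def by (intro allI, rule_tac x="n" in exI) (auto simp: agree_def split: nat.splits)

lemma cont_pad: "cont (pad k)"
  unfolding cont_iff pad_def by (intro allI, rule_tac x="n" in exI) (auto simp: agree_def)

lemma agree_pad: "agree n zro (pad n x)"
  by (simp add: agree_def pad_def)

lemmas cont_intros = cont_tail cont_drp cont_cons cont_pad cont_id

section \<open>Colourings, their equivalence relations and label-preserving reductions\<close>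

type_synonym color = "baire \<Rightarrow> nat"

definition eqc :: "color \<Rightarrow> baire rel" where "eqc c = {(x, y). c x = c y}"

lemma eqc_iff [simp]: "(x, y) \<in> eqc c \<longleftrightarrow> c x = c y"
  by (simp add: eqc_def)

lemma eqc_ER: "eqc c \<in> ER"
  unfolding ER_def eqc_def by (auto intro!: equivI refl_onI symI transI)

definition wle :: "color \<Rightarrow> color \<Rightarrow> bool" (infix "\<sqsubseteq>" 50) where
  "c \<sqsubseteq> d \<longleftrightarrow> (\<exists>f. cont f \<and> (\<forall>x. c x = d (f x)))"

lemma wleI: "cont f \<Longrightarrow> (\<And>x. c x = d (f x)) \<Longrightarrow> c \<sqsubseteq> d"
  by (auto simp: wle_def)

lemma wle_trans: "c \<sqsubseteq> d \<Longrightarrow> d \<sqsubseteq> e \<Longrightarrow> c \<sqsubseteq> e"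
proof -
  assume "c \<sqsubseteq> d" "d \<sqsubseteq> e"
  then obtain f g where "cont f" "\<forall>x. c x = d (f x)" "cont g" "\<forall>x. d x = e (g x)"
    unfolding wle_def by blast
  then show ?thesis by (intro wleI[of "\<lambda>x. g (f x)"]) (simp_all add: cont_comp)
qed

lemma wle_imp_reducible: "c \<sqsubseteq> d \<Longrightarrow> eqc c \<le>\<^sub>c eqc d"
  unfolding wle_def cont_reducible_def by auto

lemma cont_reducible_refl: "E \<le>\<^sub>c E"
  unfolding cont_reducible_def by (intro exI[of _ "\<lambda>x. x"]) (auto intro: cont_id)

lemma cont_reducible_trans: "E \<le>\<^sub>c F \<Longrightarrow> F \<le>\<^sub>c G \<Longrightarrow> E \<le>\<^sub>c G"
proof -
  assume "E \<le>\<^sub>c F" "F \<le>\<^sub>c G"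
  then obtain f g where "cont f" "\<forall>x y. (x, y) \<in> E \<longleftrightarrow> (f x, f y) \<in> F"
    "cont g" "\<forall>x y. (x, y) \<in> F \<longleftrightarrow> (g x, g y) \<in> G"
    unfolding cont_reducible_def by blast
  then show ?thesis unfolding cont_reducible_def
    by (intro exI[of _ "\<lambda>x. g (f x)"]) (simp add: cont_comp)
qed

text \<open>Pulling the colouring back along the reduction shows that everything below a colouring
  is again given by a colouring. Arbitrary relations below a tree or a forest can therefore be
  treated through labels.\<close>

lemma reducible_eqcE:
  assumes "E \<le>\<^sub>c eqc d" obtains f where "cont f" "E = eqc (\<lambda>x. d (f x))"
proof -
  from assms obtain f where f: "cont f" "\<forall>x y. (x, y) \<in> E \<longleftrightarrow> d (f x) = d (f y)"
    unfolding cont_reducible_def by auto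
  then have "E = eqc (\<lambda>x. d (f x))" by (auto simp: eqc_def)
  with f that show ?thesis by blast
qed

text \<open>The disjoint union over the first coordinate. With labels kept fixed it is the supremum
  of a countable family for \<open>\<sqsubseteq>\<close>.\<close>

definition color_sum :: "(nat \<Rightarrow> color) \<Rightarrow> color" where
  "color_sum cs x = cs (x 0) (tail x)"

lemma color_sum_cons [simp]: "color_sum cs (cons i x) = cs i x"
  by (simp add: color_sum_def)

lemma wle_color_sum: "cs i \<sqsubseteq> color_sum cs"
  by (rule wleI[of "cons i"]) (auto intro: cont_intros)

lemma color_sum_wle:
  assumes "\<And>i. cs i \<sqsubseteq> d" shows "color_sum cs \<sqsubseteq> d"
proof -
  from assms have "\<forall>i. \<exists>f. cont f \<and> (\<forall>x. cs i x = d (f x))" by (auto simp: wle_def)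
  then obtain f where f: "\<And>i. cont (f i)" "\<And>i x. cs i x = d (f i x)" by metis
  have "cont (\<lambda>x. f (x 0) (tail x))"
    by (rule cont_glue[OF loc_const_nth, of "\<lambda>i x. f i (tail x)"]) (rule cont_comp[OF f(1) cont_tail])
  then show ?thesis by (rule wleI) (simp add: color_sum_def f(2))
qed

section \<open>Colourings from labelled trees\<close>

definition first_nonzero :: "baire \<Rightarrow> nat" where "first_nonzero x = (LEAST n. x n \<noteq> 0)"

text \<open>The zero sequence is the root, and it is a limit of copies of every child: the first nonzero
  entry \<open>k + 1\<close> selects child \<open>k\<close>, read modulo the number of children to make the choice total.\<close>

definition node_col :: "nat \<Rightarrow> color list \<Rightarrow> color" where
  "node_col a cs x = (if cs = [] \<or> x = zro then a
     else (cs ! ((x (first_nonzero x) - 1) mod length cs)) (drp (Suc (first_nonzero x)) x))"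

lemma first_nonzero_eqI: "x n \<noteq> 0 \<Longrightarrow> (\<And>i. i < n \<Longrightarrow> x i = 0) \<Longrightarrow> first_nonzero x = n"
  unfolding first_nonzero_def by (rule Least_equality) (auto intro: leI)

lemma nth_first_nonzero: "x \<noteq> zro \<Longrightarrow> x (first_nonzero x) \<noteq> 0"
  unfolding first_nonzero_def by (rule LeastI_ex) auto

lemma nth_less_first_nonzero: "i < first_nonzero x \<Longrightarrow> x i = 0"
  unfolding first_nonzero_def using not_less_Least by blast

lemma first_nonzero_agree: "x \<noteq> zro \<Longrightarrow> agree (Suc (first_nonzero x)) x y \<Longrightarrow> first_nonzero y = first_nonzero x"
  by (rule first_nonzero_eqI) (auto simp: agree_def nth_less_first_nonzero nth_first_nonzero)

lemma node_col_zro [simp]: "node_col a cs zro = a"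
  by (simp add: node_col_def)

lemma node_col_Nil [simp]: "node_col a [] x = a"
  by (simp add: node_col_def)

lemma node_col_child: "k < length cs \<Longrightarrow> node_col a cs (cons (Suc k) x) = (cs ! k) x"
proof -
  have 1: "first_nonzero (cons (Suc k) x) = 0" by (rule first_nonzero_eqI) auto
  have 2: "cons (Suc k) x \<noteq> zro" by (metis cons_0 nat.distinct(1))
  have 3: "drp (Suc 0) (cons (Suc k) x) = x" by (simp add: drp_def cons_def)
  show "k < length cs \<Longrightarrow> node_col a cs (cons (Suc k) x) = (cs ! k) x"
    using 2 by (auto simp: node_col_def 1 3)
qed

text \<open>Leading zeros change neither the selected child nor what the child reads. Hence every
  neighbourhood of \<open>zro\<close> contains a copy of the whole colouring.\<close>

lemma node_col_pad [simp]: "node_col a cs (pad n x) = node_col a cs x"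
proof (cases "x = zro")
  case True
  then have "pad n x = zro" by (auto simp: pad_def)
  with True show ?thesis by simp
next
  case False
  then have f: "x (first_nonzero x) \<noteq> 0" by (rule nth_first_nonzero)
  have 1: "first_nonzero (pad n x) = n + first_nonzero x"
    by (rule first_nonzero_eqI) (auto simp: pad_def f nth_less_first_nonzero)
  have 2: "pad n x \<noteq> zro"
    using f by (auto simp: pad_def fun_eq_iff intro!: exI[of _ "n + first_nonzero x"])
  have 3: "drp (Suc (n + first_nonzero x)) (pad n x) = drp (Suc (first_nonzero x)) x"
    by (auto simp: drp_def pad_def)
  have 4: "pad n x (n + first_nonzero x) = x (first_nonzero x)" by (simp add: pad_def)
  show ?thesis using False 2 by (simp add: node_col_def 1 3 4)
qed

text \<open>Off \<open>zro\<close> a finite prefix already contains the first nonzero entry, so all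
  nearby points continue in the same child.\<close>

lemma node_col_local:
  assumes "cs \<noteq> []" "x \<noteq> zro"
  shows "\<exists>n k. k < length cs \<and> (\<forall>y. agree n x y \<longrightarrow> node_col a cs y = (cs ! k) (drp n y))"
proof (intro exI conjI allI impI)
  show "(x (first_nonzero x) - 1) mod length cs < length cs" using assms by simp
  fix y assume y: "agree (Suc (first_nonzero x)) x y"
  then have "y (first_nonzero x) = x (first_nonzero x)" by (auto simp: agree_def)
  moreover from this have "y \<noteq> zro" using nth_first_nonzero[OF assms(2)] by auto
  ultimately show "node_col a cs y = (cs ! ((x (first_nonzero x) - 1) mod length cs)) (drp (Suc (first_nonzero x)) y)"
    using assms by (simp add: node_col_def first_nonzero_agree[OF assms(2) y])
qed

section \<open>Labelled trees and their homomorphism preorder\<close>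

datatype tree = Node (root: nat) (children: "tree list")

primrec lab :: "tree \<Rightarrow> color" where
  "lab (Node a ts) = node_col a (map lab ts)"

lemma lab_pad [simp]: "lab t (pad n x) = lab t x"
  by (cases t) simp

lemma lab_zro [simp]: "lab t zro = root t"
  by (cases t) simp

lemma lab_child_wle: "t \<in> set ts \<Longrightarrow> lab t \<sqsubseteq> lab (Node a ts)"
proof -
  assume "t \<in> set ts"
  then obtain k where "k < length ts" "t = ts ! k" by (auto simp: in_set_conv_nth)
  then show ?thesis
    by (intro wleI[of "cons (Suc k)"]) (auto simp: cont_intros node_col_child)
qed

text \<open>The homomorphism preorder: a monotone label-preserving map sends the root either to the
  root, and then the children anywhere, or into the subtree of some child.\<close>

fun hle :: "tree \<Rightarrow> tree \<Rightarrow> bool" where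
  "hle (Node a ss) (Node b ts) \<longleftrightarrow>
     (a = b \<and> (\<forall>s\<in>set ss. hle s (Node b ts))) \<or> (\<exists>t\<in>set ts. hle (Node a ss) t)"

text \<open>If the root labels differ, \<open>f zro\<close> is not \<open>zro\<close>, so the target
  looks like a single child near \<open>f zro\<close>; a padded copy of the source is mapped there.
  If they agree, each child of the source is treated separately.\<close>

lemma wle_imp_hle: "lab s \<sqsubseteq> lab t \<Longrightarrow> hle s t"
proof (induction s t rule: hle.induct)
  case (1 a ss b ts)
  from 1(3) obtain f where f: "cont f" "\<And>x. lab (Node a ss) x = lab (Node b ts) (f x)"
    unfolding wle_def by auto
  show ?case
  proof (cases "a = b")
    case True
    have "hle s (Node b ts)" if "s \<in> set ss" for s
      using 1(1)[OF that] lab_child_wle[OF that] 1(3) True wle_trans by blast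
    with True show ?thesis by simp
  next
    case False
    have ne: "f zro \<noteq> zro" using f(2)[of zro] False by auto
    have "ts \<noteq> []" using f(2)[of zro] False by auto
    then have "\<exists>n k. k < length ts \<and> (\<forall>y. agree n (f zro) y \<longrightarrow> lab (Node b ts) y = lab (ts ! k) (drp n y))"
      using node_col_local[OF _ ne, of "map lab ts" b] by fastforce
    then obtain n k where nk: "k < length ts"
      "\<And>y. agree n (f zro) y \<Longrightarrow> lab (Node b ts) y = lab (ts ! k) (drp n y)"
      by blast
    obtain m where m: "\<And>y. agree m zro y \<Longrightarrow> agree n (f zro) (f y)"
      using f(1) unfolding cont_iff by blast
    have "lab (Node a ss) \<sqsubseteq> lab (ts ! k)"
    proof (rule wleI)
      show "cont (\<lambda>x. drp n (f (pad m x)))"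
        by (rule cont_comp[OF cont_drp cont_comp[OF f(1) cont_pad]])
      fix x
      have "lab (Node a ss) x = lab (Node a ss) (pad m x)" by (simp only: lab_pad)
      also have "\<dots> = lab (ts ! k) (drp n (f (pad m x)))"
        unfolding f(2) by (rule nk(2), rule m, rule agree_pad)
      finally show "lab (Node a ss) x = lab (ts ! k) (drp n (f (pad m x)))" .
    qed
    then have "hle (Node a ss) (ts ! k)" using 1(2) nk(1) nth_mem by blast
    with nk(1) show ?thesis by auto
  qed
qed

text \<open>Keep the leading zeros and apply to the rest the reduction belonging to the selected
  child. The preserved zeros give continuity at \<open>zro\<close>, and padding does not change the
  label in the target.\<close>

lemma node_col_wle:
  assumes "\<And>c. c \<in> set cs \<Longrightarrow> c \<sqsubseteq> lab (Node a ts)"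
  shows "node_col a cs \<sqsubseteq> lab (Node a ts)"
proof (cases "cs = []")
  case True
  show ?thesis using True by (intro wleI[of "\<lambda>_. zro"]) (auto simp: continuous_on_const)
next
  case False
  let ?L = "length cs"
  have "\<forall>k. \<exists>f. k < ?L \<longrightarrow> cont f \<and> (\<forall>x. (cs ! k) x = lab (Node a ts) (f x))"
    using assms unfolding wle_def by (metis nth_mem)
  then obtain f where f: "\<And>k. k < ?L \<Longrightarrow> cont (f k)"
    "\<And>k x. k < ?L \<Longrightarrow> (cs ! k) x = lab (Node a ts) (f k x)" by metis
  define F where "F x = (if x = zro then zro
    else pad (first_nonzero x) (f ((x (first_nonzero x) - 1) mod ?L) (drp (Suc (first_nonzero x)) x)))" for x
  have "cont F" unfolding cont_iff
  proof (intro allI)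
    fix x n
    show "\<exists>m. \<forall>y. agree m x y \<longrightarrow> agree n (F x) (F y)"
    proof (cases "x = zro")
      case True
      have "agree n (F x) (F y)" if "agree n x y" for y
      proof (cases "y = zro")
        case False
        have "n \<le> first_nonzero y"
        proof (rule ccontr)
          assume "\<not> n \<le> first_nonzero y"
          then have "y (first_nonzero y) = x (first_nonzero y)" using that by (simp add: agree_def)
          with True nth_first_nonzero[OF False] show False by simp
        qed
        then show ?thesis using True False by (auto simp: agree_def F_def pad_def)
      qed (use True in \<open>simp add: F_def\<close>)
      then show ?thesis by blast
    next
      case False
      define h where "h y = pad (first_nonzero x) (f ((x (first_nonzero x) - 1) mod ?L) (drp (Suc (first_nonzero x)) y))" for y
      have "cont h" unfolding h_def
        using cont_comp[OF cont_pad cont_comp[OF f(1) cont_drp]] \<open>cs \<noteq> []\<close> by simp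
      then obtain m where m: "\<forall>y. agree m x y \<longrightarrow> agree n (h x) (h y)"
        unfolding cont_iff by blast
      have "agree n (F x) (F y)" if y: "agree (max m (Suc (first_nonzero x))) x y" for y
      proof -
        have y1: "agree m x y" "agree (Suc (first_nonzero x)) x y" using y by (auto intro: agree_mono)
        have e: "first_nonzero y = first_nonzero x" using False y1(2) by (rule first_nonzero_agree)
        have "y (first_nonzero x) = x (first_nonzero x)" using y1(2) by (auto simp: agree_def)
        moreover from this have "y \<noteq> zro" using nth_first_nonzero[OF False] by auto
        ultimately have "F y = h y" by (simp add: F_def h_def e)
        moreover have "F x = h x" using False by (simp add: F_def h_def)
        ultimately show ?thesis using m y1 by simp
      qed
      then show ?thesis by blast
    qed
  qed
  moreover have "node_col a cs x = lab (Node a ts) (F x)" for x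
  proof (cases "x = zro")
    case False
    then have "node_col a cs x = (cs ! ((x (first_nonzero x) - 1) mod ?L)) (drp (Suc (first_nonzero x)) x)"
      using \<open>cs \<noteq> []\<close> by (simp add: node_col_def)
    also have "\<dots> = lab (Node a ts) (F x)"
      using False \<open>cs \<noteq> []\<close> by (simp add: F_def f(2) del: lab.simps)
    finally show ?thesis .
  qed (simp add: F_def)
  ultimately show ?thesis unfolding wle_def by blast
qed

lemma hle_imp_wle: "hle s t \<Longrightarrow> lab s \<sqsubseteq> lab t"
proof (induction s t rule: hle.induct)
  case (1 a ss b ts)
  from 1(3) consider "a = b" "\<forall>s\<in>set ss. hle s (Node b ts)" | t where "t \<in> set ts" "hle (Node a ss) t"
    by auto
  then show ?case
  proof cases
    case 1
    have "node_col b (map lab ss) \<sqsubseteq> lab (Node b ts)"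
      by (rule node_col_wle) (use 1 "1.IH"(1) in \<open>auto simp del: lab.simps\<close>)
    with 1 show ?thesis by simp
  next
    case (2 t)
    then show ?thesis using "1.IH"(2) lab_child_wle wle_trans by blast
  qed
qed

lemma hle_iff: "hle s t \<longleftrightarrow> lab s \<sqsubseteq> lab t"
  using hle_imp_wle wle_imp_hle by blast

lemma hle_trans: "hle s t \<Longrightarrow> hle t u \<Longrightarrow> hle s u"
  unfolding hle_iff by (rule wle_trans)

lemma hle_child: "hle s t \<Longrightarrow> t \<in> set ts \<Longrightarrow> hle s (Node a ts)"
  unfolding hle_iff using lab_child_wle wle_trans by blast

lemma hle_refl: "hle t t"
  unfolding hle_iff by (auto intro: wleI[OF cont_id])

section \<open>Relabelling, disjoint sums and forests\<close>

lemma node_col_map: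
  "node_col (\<sigma> a) (map (\<lambda>c x. \<sigma> (c x)) cs) = (\<lambda>x. \<sigma> (node_col a cs x))"
  by (auto simp: node_col_def fun_eq_iff)

primrec relabel :: "(nat \<Rightarrow> nat) \<Rightarrow> tree \<Rightarrow> tree" where
  "relabel \<sigma> (Node a ts) = Node (\<sigma> a) (map (relabel \<sigma>) ts)"

lemma lab_relabel: "lab (relabel \<sigma> t) = (\<lambda>x. \<sigma> (lab t x))"
proof (induction t)
  case (Node a ts)
  then have "map lab (map (relabel \<sigma>) ts) = map (\<lambda>c x. \<sigma> (c x)) (map lab ts)"
    by simp
  then show ?case by (simp only: relabel.simps lab.simps node_col_map)
qed

text \<open>Near \<open>zro\<close> the image stays in one summand, because the first coordinate is
  locally constant, and a padded copy of the whole tree fits into that neighbourhood.\<close>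

lemma lab_irreducible:
  assumes "eqc (lab s) \<le>\<^sub>c eqc (color_sum cs)"
  shows "\<exists>i. eqc (lab s) \<le>\<^sub>c eqc (cs i)"
proof -
  obtain f where f: "cont f" "\<And>x y. lab s x = lab s y \<longleftrightarrow> color_sum cs (f x) = color_sum cs (f y)"
    using assms unfolding cont_reducible_def by auto
  obtain m where m: "\<And>y. agree m zro y \<Longrightarrow> agree 1 (f zro) (f y)"
    using f(1) unfolding cont_iff by blast
  have *: "f (pad m x) 0 = f zro 0" for x
    using m[OF agree_pad] by (simp add: agree_def)
  have "eqc (lab s) \<le>\<^sub>c eqc (cs (f zro 0))"
    unfolding cont_reducible_def
  proof (intro exI conjI allI)
    show "cont (\<lambda>x. tail (f (pad m x)))"
      by (rule cont_comp[OF cont_tail cont_comp[OF f(1) cont_pad]])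
    fix x y
    show "(x, y) \<in> eqc (lab s) \<longleftrightarrow>
       (tail (f (pad m x)), tail (f (pad m y))) \<in> eqc (cs (f zro 0))"
      using f(2)[of "pad m x" "pad m y"] by (simp add: color_sum_def *)
  qed
  then show ?thesis ..
qed

lemma lab_irreducible_wle:
  assumes "lab s \<sqsubseteq> color_sum cs"
  shows "\<exists>i. lab s \<sqsubseteq> cs i"
proof -
  obtain f where f: "cont f" "\<And>x. lab s x = color_sum cs (f x)"
    using assms unfolding wle_def by auto
  obtain m where m: "\<And>y. agree m zro y \<Longrightarrow> agree 1 (f zro) (f y)"
    using f(1) unfolding cont_iff by blast
  have *: "f (pad m x) 0 = f zro 0" for x
    using m[OF agree_pad] by (simp add: agree_def)
  have "lab s \<sqsubseteq> cs (f zro 0)"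
  proof (rule wleI)
    show "cont (\<lambda>x. tail (f (pad m x)))"
      by (rule cont_comp[OF cont_tail cont_comp[OF f(1) cont_pad]])
    show "lab s x = cs (f zro 0) (tail (f (pad m x)))" for x
      using f(2)[of "pad m x"] by (simp add: color_sum_def *)
  qed
  then show ?thesis ..
qed

text \<open>Every first coordinate has to name a tree, so indices are read modulo the length. This
  is meaningful for nonempty lists.\<close>

definition forest_lab :: "tree list \<Rightarrow> color" where
  "forest_lab ts = color_sum (\<lambda>i. lab (ts ! (i mod length ts)))"

lemma lab_wle_forest: "t \<in> set ts \<Longrightarrow> lab t \<sqsubseteq> forest_lab ts"
proof -
  assume "t \<in> set ts"
  then obtain k where "k < length ts" "t = ts ! k" by (auto simp: in_set_conv_nth)
  then show ?thesis unfolding forest_lab_def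
    using wle_color_sum[of "\<lambda>i. lab (ts ! (i mod length ts))" k] by simp
qed

lemma wle_forestD: "lab s \<sqsubseteq> forest_lab ts \<Longrightarrow> ts \<noteq> [] \<Longrightarrow> \<exists>t\<in>set ts. hle s t"
  unfolding forest_lab_def hle_iff using lab_irreducible_wle
  by (metis (mono_tags, lifting) length_greater_0_conv mod_less_divisor nth_mem)

lemma forest_wle_Node: "ts \<noteq> [] \<Longrightarrow> forest_lab ts \<sqsubseteq> lab (Node a ts)"
  unfolding forest_lab_def by (rule color_sum_wle) (auto intro!: lab_child_wle simp del: lab.simps)

primrec labels :: "tree \<Rightarrow> nat set" where
  "labels (Node a ts) = insert a (\<Union>(set (map labels ts)))"

lemma range_node_col: "range (node_col a cs) = insert a (\<Union>c\<in>set cs. range c)"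
proof (intro equalityI subsetI)
  fix l assume "l \<in> range (node_col a cs)"
  then obtain x where x: "l = node_col a cs x" by blast
  show "l \<in> insert a (\<Union>c\<in>set cs. range c)"
  proof (cases "cs = [] \<or> x = zro")
    case False
    then have k: "cs ! ((x (first_nonzero x) - 1) mod length cs) \<in> set cs" (is "?c \<in> _") by simp
    have "l = ?c (drp (Suc (first_nonzero x)) x)" using False by (simp add: x node_col_def)
    then have "l \<in> range ?c" by blast
    with k show ?thesis by blast
  qed (auto simp: x node_col_def)
next
  fix l assume "l \<in> insert a (\<Union>c\<in>set cs. range c)"
  then consider "l = a" | c x where "c \<in> set cs" "l = c x" by auto
  then show "l \<in> range (node_col a cs)"
  proof cases
    case 1
    then have "l = node_col a cs zro" by simp
    then show ?thesis by blast
  next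
    case 2
    then obtain k where k: "k < length cs" "c = cs ! k" by (auto simp: in_set_conv_nth)
    have "l = node_col a cs (cons (Suc k) x)" using k 2 by (simp add: node_col_child)
    then show ?thesis by blast
  qed
qed

lemma range_lab: "range (lab t) = labels t"
  by (induction t) (simp add: range_node_col)

lemma finite_labels [simp]: "finite (labels t)"
  by (induction t) auto

lemma hle_labels: "hle s t \<Longrightarrow> labels s \<subseteq> labels t"
proof -
  assume "hle s t"
  then have "range (lab s) \<subseteq> range (lab t)" unfolding hle_iff wle_def by auto
  then show ?thesis by (simp add: range_lab)
qed

section \<open>A rigid tree and the coding trees\<close>

primrec alt :: "nat \<Rightarrow> nat \<Rightarrow> nat \<Rightarrow> tree" where
  "alt a b 0 = Node a []"
| "alt a b (Suc n) = Node a [alt b a n]"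

lemma root_alt [simp]: "root (alt a b n) = a"
  by (cases n) auto

lemma labels_alt: "labels (alt a b n) = (if n = 0 then {a} else {a, b})"
  by (induction n arbitrary: a b) auto

lemma relabel_alt: "relabel \<sigma> (alt a b n) = alt (\<sigma> a) (\<sigma> b) n"
  by (induction n arbitrary: a b) auto

lemma hle_neq_root: "root s \<noteq> a \<Longrightarrow> hle s (Node a ts) \<longleftrightarrow> (\<exists>t\<in>set ts. hle s t)"
  by (cases s) auto

lemma hle_alt_Suc_same: "a \<noteq> b \<Longrightarrow> hle (alt a b (Suc m)) (alt a b (Suc n)) \<longleftrightarrow>
    hle (alt b a m) (alt b a n) \<or> hle (alt a b (Suc m)) (alt b a n)"
  by (auto simp: hle_neq_root)

text \<open>Removing a root exchanges the two labels, so the bound for equal roots and the strict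
  bound for exchanged roots feed each other and are proved together.\<close>

lemma hle_alt_le:
  "a \<noteq> b \<Longrightarrow> (hle (alt a b m) (alt a b n) \<longrightarrow> m \<le> n) \<and> (hle (alt a b m) (alt b a n) \<longrightarrow> m < n)"
proof (induction n arbitrary: a b m)
  case 0
  then show ?case by (cases m) (auto simp: hle_neq_root)
next
  case (Suc n)
  have IH: "hle (alt a b k) (alt a b n) \<Longrightarrow> k \<le> n" "hle (alt b a k) (alt b a n) \<Longrightarrow> k \<le> n"
    "hle (alt a b k) (alt b a n) \<Longrightarrow> k < n" for k
    using Suc.IH[of a b k] Suc.IH[of b a k] Suc.prems by auto
  have "hle (alt a b m) (alt b a (Suc n)) \<Longrightarrow> m < Suc n"
    using Suc.prems IH(1)[of m] by (auto simp: hle_neq_root)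
  moreover have "hle (alt a b m) (alt a b (Suc n)) \<Longrightarrow> m \<le> Suc n"
  proof (cases m)
    case (Suc k)
    show "hle (alt a b m) (alt a b (Suc n)) \<Longrightarrow> m \<le> Suc n"
      unfolding Suc hle_alt_Suc_same[OF Suc.prems] using IH(2)[of k] IH(3)[of "Suc k"] by auto
  qed simp
  ultimately show ?case by blast
qed

lemma hle_alt_mono: "m \<le> n \<Longrightarrow> hle (alt a b m) (alt a b n)"
proof (induction m arbitrary: a b n)
  case 0
  then show ?case by (cases n) auto
next
  case (Suc m)
  then obtain k where k: "n = Suc k" "m \<le> k" by (cases n) auto
  have "hle (alt b a m) (Node a [alt b a k])"
    by (rule hle_child[OF Suc.IH[OF k(2)]]) simp
  with k show ?case by simp
qed

text \<open>Antichains come from trading the first parameter against the second. The last branch, \<open>0\<close> below \<open>2\<close>, is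
  the only asymmetry between the labels \<open>0\<close> and \<open>2\<close>.\<close>

definition vert :: "nat \<Rightarrow> nat \<Rightarrow> tree" where
  "vert i j = Node 1 [alt 2 1 i, alt 0 1 j, alt 0 2 1]"

abbreviation core :: tree where "core \<equiv> vert 3 3"

lemma relabel_core: "relabel \<sigma> core = Node (\<sigma> 1) [alt (\<sigma> 2) (\<sigma> 1) 3, alt (\<sigma> 0) (\<sigma> 1) 3, alt (\<sigma> 0) (\<sigma> 2) 1]"
  by (simp add: vert_def relabel_alt del: alt.simps)

lemma labels_vert: "labels (vert i j) = {0, 1, 2}"
  by (auto simp: vert_def labels_alt split: if_splits)

lemma not_hle_labels: "\<not> labels s \<subseteq> labels t \<Longrightarrow> \<not> hle s t"
  using hle_labels by blast

text \<open>The root 2 cannot go to the root 1, so the path fits into one branch, and only the first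
  branch carries both 1 and 2. For i = 0 the single node 2 would also fit into the last
  branch.\<close>

lemma hle_alt_vert2: "i > 0 \<Longrightarrow> hle (alt 2 1 i) (vert i' j') \<Longrightarrow> i \<le> i'"
proof -
  assume i: "i > 0" "hle (alt 2 1 i) (vert i' j')"
  have "\<not> hle (alt 2 1 i) (alt 0 1 j')" "\<not> hle (alt 2 1 i) (alt 0 2 1)"
    using i(1) by (auto intro!: not_hle_labels simp: labels_alt simp del: alt.simps split: if_splits)
  then have "hle (alt 2 1 i) (alt 2 1 i')" using i(2) by (simp add: vert_def hle_neq_root)
  then show ?thesis using hle_alt_le[of 2 1 i i'] by simp
qed

lemma hle_alt_vert0: "j > 0 \<Longrightarrow> hle (alt 0 1 j) (vert i' j') \<Longrightarrow> j \<le> j'"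
proof -
  assume i: "j > 0" "hle (alt 0 1 j) (vert i' j')"
  have "\<not> hle (alt 0 1 j) (alt 2 1 i')" "\<not> hle (alt 0 1 j) (alt 0 2 1)"
    using i(1) by (auto intro!: not_hle_labels simp: labels_alt simp del: alt.simps split: if_splits)
  then have "hle (alt 0 1 j) (alt 0 1 j')" using i(2) by (simp add: vert_def hle_neq_root)
  then show ?thesis using hle_alt_le[of 0 1 j j'] by simp
qed

lemma hle_subtree: "hle (Node a ss) t \<Longrightarrow> s \<in> set ss \<Longrightarrow> hle s t"
  using hle_trans[OF hle_child[OF hle_refl]] by blast

lemma hle_vert_iff:
  assumes "i > 0" "j > 0"
  shows "hle (vert i j) (vert i' j') \<longleftrightarrow> i \<le> i' \<and> j \<le> j'"
proof
  assume *: "hle (vert i j) (vert i' j')"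
  have "hle (alt 2 1 i) (vert i' j')" "hle (alt 0 1 j) (vert i' j')"
    using * unfolding vert_def by (rule hle_subtree; simp)+
  then show "i \<le> i' \<and> j \<le> j'" using assms hle_alt_vert2 hle_alt_vert0 by blast
next
  assume *: "i \<le> i' \<and> j \<le> j'"
  have "hle s (vert i' j')" if "s \<in> set [alt 2 1 i, alt 0 1 j, alt 0 2 1]" for s
  proof -
    from that consider "s = alt 2 1 i" | "s = alt 0 1 j" | "s = alt 0 2 1" by auto
    then show ?thesis
    proof cases
      case 1
      then show ?thesis unfolding vert_def using *
        by (intro hle_child[of _ "alt 2 1 i'"]) (simp_all add: hle_alt_mono del: alt.simps)
    next
      case 2
      then show ?thesis unfolding vert_def using *
        by (intro hle_child[of _ "alt 0 1 j'"]) (simp_all add: hle_alt_mono del: alt.simps)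
    next
      case 3
      then show ?thesis unfolding vert_def
        by (intro hle_child[of _ "alt 0 2 1"]) (simp_all add: hle_refl del: alt.simps)
    qed
  qed
  then show "hle (vert i j) (vert i' j')" unfolding vert_def by simp
qed

text \<open>The root is labelled 0, so the root of a vertex tree, labelled 1, cannot be sent to it.
  A vertex tree is below an edge tree only by being below one of the listed vertices.\<close>

definition edge :: "(nat \<times> nat) list \<Rightarrow> tree" where
  "edge ps = Node 0 (map (\<lambda>(i, j). vert i j) ps)"

lemma hle_vert_edge: "hle (vert i j) (edge ps) \<longleftrightarrow> (\<exists>(i', j')\<in>set ps. hle (vert i j) (vert i' j'))"
proof -
  have "root (vert i j) \<noteq> 0" by (simp add: vert_def)
  then show ?thesis unfolding edge_def by (simp add: hle_neq_root case_prod_unfold)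
qed

text \<open>Reductions between equivalence relations induce injective relabellings of
  \<open>core\<close>. Rigidity says that \<open>t\<close> realises none but the identity.\<close>

definition rigid :: "tree \<Rightarrow> bool" where
  "rigid t \<longleftrightarrow> labels t = {0, 1, 2} \<and> hle core t \<and>
    (\<forall>\<sigma>. \<sigma> ` {0, 1, 2} \<subseteq> {0, 1, 2} \<longrightarrow> inj_on \<sigma> {0, 1, 2} \<longrightarrow> hle (relabel \<sigma> core) t \<longrightarrow>
      \<sigma> 0 = 0 \<and> \<sigma> 1 = 1 \<and> \<sigma> 2 = 2)"

text \<open>A tree with a root other than 1 must fit into a single branch, and the last one alone
  carries both 0 and 2.\<close>

lemma hle_vertD:
  assumes "hle s (vert i j)" "root s \<noteq> 1" "{0, 2} \<subseteq> labels s"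
  shows "hle s (alt 0 2 1)"
proof -
  have "\<not> hle s (alt 2 1 i)" "\<not> hle s (alt 0 1 j)"
    using assms(3) by (auto intro!: not_hle_labels simp: labels_alt split: if_splits)
  with assms(1,2) show ?thesis unfolding vert_def by (simp add: hle_neq_root del: alt.simps)
qed

text \<open>On no path from the root of a vertex or edge tree does 0 come after 2. This and the next
  three lemmas exclude the patterns in which a nontrivial relabelling of \<open>core\<close> would
  show itself.\<close>

lemma not_hle_vert_202: "\<not> hle (alt 2 0 2) (vert i j)"
proof
  assume "hle (alt 2 0 2) (vert i j)"
  then have "hle (alt 2 0 2) (alt 0 2 1)" by (rule hle_vertD) (auto simp: labels_alt)
  then show False by (simp add: numeral_2_eq_2)
qed

lemma not_hle_2020: "\<not> hle (alt 2 0 3) (vert i j)" "\<not> hle (alt 2 0 3) (edge ps)"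
proof -
  show *: "\<not> hle (alt 2 0 3) (vert i j)" for i j
  proof
    assume "hle (alt 2 0 3) (vert i j)"
    then have "hle (alt 2 0 3) (alt 0 2 1)" by (rule hle_vertD) (auto simp: labels_alt)
    then show False by (simp add: numeral_3_eq_3)
  qed
  show "\<not> hle (alt 2 0 3) (edge ps)"
    using * unfolding edge_def by (subst hle_neq_root) auto
qed

lemma not_hle_0202: "\<not> hle (alt 0 2 3) (vert i j)" "\<not> hle (alt 0 2 3) (edge ps)"
proof -
  show *: "\<not> hle (alt 0 2 3) (vert i j)" for i j
  proof
    assume "hle (alt 0 2 3) (vert i j)"
    then have "hle (alt 0 2 3) (alt 0 2 1)" by (rule hle_vertD) (auto simp: labels_alt)
    then show False by (simp add: numeral_3_eq_3)
  qed
  have "alt 0 2 3 = Node 0 [alt 2 0 2]" by (simp add: numeral_3_eq_3 numeral_2_eq_2)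
  moreover have "\<not> hle (alt 2 0 2) (edge ps)"
    using not_hle_vert_202 unfolding edge_def by (subst hle_neq_root) auto
  ultimately show "\<not> hle (alt 0 2 3) (edge ps)"
    using * by (auto simp: edge_def)
qed

lemma not_hle_120: "\<not> hle (Node 1 [alt 2 0 1]) (vert i j)" "\<not> hle (Node 1 [alt 2 0 1]) (edge ps)"
proof -
  have 1: "\<not> hle (alt 2 0 1) (vert i j)" for i j
  proof
    assume "hle (alt 2 0 1) (vert i j)"
    then have "hle (alt 2 0 1) (alt 0 2 1)" by (rule hle_vertD) (auto simp: labels_alt)
    then show False by simp
  qed
  have 2: "\<not> hle (Node 1 [alt 2 0 1]) (alt 2 1 i)" "\<not> hle (Node 1 [alt 2 0 1]) (alt 0 1 j)"
    "\<not> hle (Node 1 [alt 2 0 1]) (alt 0 2 1)" for i j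
    by (auto intro!: not_hle_labels simp: labels_alt simp del: alt.simps split: if_splits)
  show *: "\<not> hle (Node 1 [alt 2 0 1]) (vert i j)" for i j
    using 1[of i j] 2 unfolding vert_def by (simp del: alt.simps)
  show "\<not> hle (Node 1 [alt 2 0 1]) (edge ps)"
    using * unfolding edge_def by (subst hle_neq_root) (auto simp del: alt.simps)
qed

text \<open>If \<open>\<sigma> 1\<close> is 0, one of the two long branches of \<open>core\<close>
  becomes 2-0-2-0; if it is 2, one becomes 0-2-0-2. If it is 1, the only other possibility exchanges
  0 and 2, and the short branch then yields 1-2-0.\<close>

lemma rigidI:
  assumes "labels t = {0, 1, 2}" "hle core t" "\<not> hle (alt 2 0 3) t" "\<not> hle (alt 0 2 3) t"
    "\<not> hle (Node 1 [alt 2 0 1]) t"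
  shows "rigid t"
  unfolding rigid_def
proof (intro conjI[OF assms(1)] conjI[OF assms(2)] allI impI)
  fix \<sigma> :: "nat \<Rightarrow> nat"
  assume im: "\<sigma> ` {0, 1, 2} \<subseteq> {0, 1, 2}" and inj: "inj_on \<sigma> {0, 1, 2}" and h: "hle (relabel \<sigma> core) t"
  have h1: "hle (alt (\<sigma> 2) (\<sigma> 1) 3) t" "hle (alt (\<sigma> 0) (\<sigma> 1) 3) t"
    using h unfolding relabel_core by (rule hle_subtree; simp)+
  have "hle (Node (\<sigma> 1) [alt (\<sigma> 0) (\<sigma> 2) 1]) (relabel \<sigma> core)"
    unfolding relabel_core by (simp add: hle_child[OF hle_refl] del: alt.simps)
  then have h2: "hle (Node (\<sigma> 1) [alt (\<sigma> 0) (\<sigma> 2) 1]) t" using h by (rule hle_trans)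
  have ne: "\<sigma> 0 \<noteq> \<sigma> 1" "\<sigma> 0 \<noteq> \<sigma> 2" "\<sigma> 1 \<noteq> \<sigma> 2" using inj by (auto simp: inj_on_def)
  have ra: "\<sigma> 0 \<in> {0, 1, 2}" "\<sigma> 1 \<in> {0, 1, 2}" "\<sigma> 2 \<in> {0, 1, 2}" using im by auto
  have n0: "\<sigma> 1 \<noteq> 0"
  proof
    assume "\<sigma> 1 = 0"
    with ne ra have "\<sigma> 2 = 2 \<or> \<sigma> 0 = 2" by auto
    with h1 \<open>\<sigma> 1 = 0\<close> assms(3) show False by auto
  qed
  have n2: "\<sigma> 1 \<noteq> 2"
  proof
    assume "\<sigma> 1 = 2"
    with ne ra have "\<sigma> 2 = 0 \<or> \<sigma> 0 = 0" by auto
    with h1 \<open>\<sigma> 1 = 2\<close> assms(4) show False by auto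
  qed
  from n0 n2 ra have 1: "\<sigma> 1 = 1" by auto
  have "\<not> (\<sigma> 0 = 2 \<and> \<sigma> 2 = 0)" using h2 1 assms(5) by metis
  with 1 ne ra show "\<sigma> 0 = 0 \<and> \<sigma> 1 = 1 \<and> \<sigma> 2 = 2" by auto
qed

lemma rigid_vert: "i \<ge> 3 \<Longrightarrow> j \<ge> 3 \<Longrightarrow> rigid (vert i j)"
  by (rule rigidI) (auto simp: labels_vert hle_vert_iff not_hle_2020 not_hle_0202 not_hle_120[simplified One_nat_def]
      simp del: alt.simps)

lemma rigid_edge:
  assumes "ps \<noteq> []" "\<forall>(i, j)\<in>set ps. i \<ge> 3 \<and> j \<ge> 3"
  shows "rigid (edge ps)"
proof (rule rigidI)
  obtain i j where ij: "(i, j) \<in> set ps" using assms(1) by (metis list.set_intros(1) neq_Nil_conv surj_pair)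
  show "hle core (edge ps)"
    unfolding hle_vert_edge using ij assms(2) by (auto simp: hle_vert_iff)
  show "labels (edge ps) = {0, 1, 2}"
    using ij by (auto simp: edge_def labels_vert)
qed (auto simp: not_hle_2020 not_hle_0202 not_hle_120[simplified One_nat_def] simp del: alt.simps)

section \<open>Join irreducible equivalence relations\<close>

text \<open>In the interval above \<open>q\<close>, \<open>z\<close> cannot be covered by two elements strictly below it. Upper bounds replace
  joins, which need not exist: two equivalence relations have one disjoint sum for each
  identification of their classes. A rigid \<open>q\<close> removes this ambiguity.\<close>

definition tree_like :: "'a set \<Rightarrow> ('a \<Rightarrow> 'a \<Rightarrow> bool) \<Rightarrow> 'a \<Rightarrow> 'a \<Rightarrow> bool" where
  "tree_like M le q z \<longleftrightarrow> le q z \<and>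
    (\<forall>u\<in>M. \<forall>v\<in>M. le q u \<and> le u z \<and> \<not> le z u \<and> le q v \<and> le v z \<and> \<not> le z v \<longrightarrow>
      (\<exists>y\<in>M. le u y \<and> le v y \<and> le y z \<and> \<not> le z y))"

definition node_like :: "'a set \<Rightarrow> ('a \<Rightarrow> 'a \<Rightarrow> bool) \<Rightarrow> 'a \<Rightarrow> 'a \<Rightarrow> 'a \<Rightarrow> bool" where
  "node_like M le q a x \<longleftrightarrow> tree_like M le q x \<and> le x a \<and>
    (\<forall>y\<in>M. tree_like M le q y \<and> le y a \<and> le x y \<longrightarrow> le y x)"

definition linked :: "'a set \<Rightarrow> ('a \<Rightarrow> 'a \<Rightarrow> bool) \<Rightarrow> 'a \<Rightarrow> 'a \<Rightarrow> 'a \<Rightarrow> 'a \<Rightarrow> bool" where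
  "linked M le q d x y \<longleftrightarrow> (\<exists>w\<in>M. tree_like M le q w \<and> le w d \<and> le x w \<and> le y w)"

section \<open>Topological complexity of tree colourings and number of classes\<close>

lemma BC_vimage_on:
  assumes g: "\<And>W. open W \<Longrightarrow> open (U \<inter> g -` W)"
  shows "S \<in> BC_open \<Longrightarrow> U \<inter> g -` S \<in> BC_open"
proof (induction rule: BC_open.induct)
  case (BC_open_open W)
  then show ?case by (intro BC_open.BC_open_open g)
next
  case (BC_open_Compl S)
  have "U \<inter> g -` (- S) = U \<inter> - (U \<inter> g -` S)" by auto
  moreover have "U \<in> BC_open" using g[of UNIV] by (auto intro: BC_open.BC_open_open)
  ultimately show ?case using BC_open_Compl.IH BC_open.intros(2-4) by metis
next
  case (BC_open_Un S T)
  have "U \<inter> g -` (S \<union> T) = (U \<inter> g -` S) \<union> (U \<inter> g -` T)" by auto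
  then show ?case using BC_open_Un.IH BC_open.intros(2-4) by metis
next
  case (BC_open_Int S T)
  have "U \<inter> g -` (S \<inter> T) = (U \<inter> g -` S) \<inter> (U \<inter> g -` T)" by auto
  then show ?case using BC_open_Int.IH BC_open.intros(2-4) by metis
qed

lemma BC_vimage: "continuous_on UNIV g \<Longrightarrow> S \<in> BC_open \<Longrightarrow> g -` S \<in> BC_open"
  using BC_vimage_on[of UNIV g S] by (auto simp: continuous_on_open_vimage)

lemma BC_empty: "{} \<in> BC_open"
  by (rule BC_open_open) simp

lemma BC_Union: "finite I \<Longrightarrow> (\<And>i. i \<in> I \<Longrightarrow> S i \<in> BC_open) \<Longrightarrow> (\<Union>i\<in>I. S i) \<in> BC_open"
  by (induction I rule: finite_induct) (auto intro: BC_empty BC_open.intros)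

lemma BC_zro: "{zro} \<in> BC_open"
proof -
  have "open (- {zro})" unfolding open_baire_iff
  proof
    fix x assume "x \<in> - {zro}"
    then have "x (first_nonzero x) \<noteq> 0" by (intro nth_first_nonzero) auto
    then have "y \<in> - {zro}" if "agree (Suc (first_nonzero x)) x y" for y
      using that by (auto simp: agree_def)
    then show "\<exists>n. \<forall>y. agree n x y \<longrightarrow> y \<in> - {zro}" by blast
  qed
  from BC_open_Compl[OF BC_open_open[OF this]] show ?thesis by simp
qed

lemma BC_node_col:
  assumes "\<And>c l. c \<in> set cs \<Longrightarrow> {x. c x = l} \<in> BC_open"
  shows "{x. node_col a cs x = l} \<in> BC_open"
proof (cases "cs = []")
  case True
  then show ?thesis by (auto intro: BC_open_open)
next
  case False
  let ?L = "length cs"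
  \<comment> \<open>\<open>U k\<close> holds the nonzero points that select child \<open>k\<close>.
    The map \<open>g\<close>, which strips the prefix already read, is controlled only off
    \<open>zro\<close>; hence preimages are taken relative to the open sets \<open>U k\<close>, and
    \<open>zro\<close> is added separately.\<close>
  define U where "U k = {x. x \<noteq> zro \<and> (x (first_nonzero x) - 1) mod ?L = k}" for k
  define g where "g x = drp (Suc (first_nonzero x)) x" for x
  have op: "open (U k \<inter> g -` W)" if W: "open W" for W k
    unfolding open_baire_iff
  proof
    fix x assume x: "x \<in> U k \<inter> g -` W"
    then have nz: "x \<noteq> zro" and "g x \<in> W" by (auto simp: U_def)
    then have "drp (Suc (first_nonzero x)) x \<in> W" by (simp add: g_def)
    moreover have "open (drp (Suc (first_nonzero x)) -` W)"
      using W cont_drp by (rule open_vimage)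
    ultimately obtain n where n: "\<forall>y. agree n x y \<longrightarrow> drp (Suc (first_nonzero x)) y \<in> W"
      unfolding open_baire_iff by auto
    have "y \<in> U k \<inter> g -` W" if y: "agree (max n (Suc (first_nonzero x))) x y" for y
    proof -
      have y1: "agree n x y" "agree (Suc (first_nonzero x)) x y" using y by (auto intro: agree_mono)
      have e: "first_nonzero y = first_nonzero x" using nz y1(2) by (rule first_nonzero_agree)
      have e2: "y (first_nonzero x) = x (first_nonzero x)" using y1(2) by (auto simp: agree_def)
      moreover from this have "y \<noteq> zro" using nth_first_nonzero[OF nz] by auto
      ultimately show ?thesis using x n y1 by (simp add: U_def g_def e)
    qed
    then show "\<exists>n. \<forall>y. agree n x y \<longrightarrow> y \<in> U k \<inter> g -` W" by blast
  qed
  have "node_col a cs x = l \<longleftrightarrow> (x = zro \<and> l = a) \<or>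
      (\<exists>k<?L. x \<in> U k \<inter> g -` {x. (cs ! k) x = l})" for x
  proof (cases "x = zro")
    case nz: False
    have "(x (first_nonzero x) - 1) mod ?L < ?L" using False by simp
    then show ?thesis using nz False by (auto simp: node_col_def U_def g_def)
  qed (auto simp: U_def)
  then have "{x. node_col a cs x = l} = (if l = a then {zro} else {}) \<union>
      (\<Union>k\<in>{..<?L}. U k \<inter> g -` {x. (cs ! k) x = l})" by auto
  also have "\<dots> \<in> BC_open"
  proof (rule BC_open_Un)
    have "U k \<inter> g -` {x. (cs ! k) x = l} \<in> BC_open" if "k < ?L" for k
      by (rule BC_vimage_on[OF op assms]) (use that in simp_all)
    then show "(\<Union>k\<in>{..<?L}. U k \<inter> g -` {x. (cs ! k) x = l}) \<in> BC_open"
      by (intro BC_Union) simp_all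
  qed (auto simp: BC_empty BC_zro)
  finally show ?thesis .
qed

lemma BC_lab: "{x. lab t x = l} \<in> BC_open"
proof (induction t arbitrary: l)
  case (Node a ts)
  show ?case unfolding lab.simps by (rule BC_node_col) (use Node in auto)
qed

lemma eqc_lab_BC: "eqc (lab t) \<in> BC_open"
proof -
  have "eqc (lab t) = (\<Union>l\<in>labels t. fst -` {x. lab t x = l} \<inter> snd -` {x. lab t x = l})"
    by (auto simp: range_lab[symmetric])
  also have "\<dots> \<in> BC_open"
    by (intro BC_Union BC_open_Int BC_vimage BC_lab finite_labels continuous_intros)
  finally show ?thesis .
qed

lemma eqc_lab_classes: "at_most_classes (card (labels t)) (eqc (lab t))"
proof -
  have "UNIV // eqc (lab t) \<subseteq> (\<lambda>l. {y. l = lab t y}) ` labels t"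
    by (auto simp: quotient_def Image_def range_lab[symmetric])
  from finite_surj[OF finite_labels this] surj_card_le[OF finite_labels this]
  show ?thesis unfolding at_most_classes_def ..
qed

section \<open>Rigidity for colourings\<close>

lemma wle_refl: "c \<sqsubseteq> c"
  unfolding wle_def by (rule exI[of _ "\<lambda>x. x"]) (simp add: cont_id)

text \<open>Rigidity is restated for colourings because it will also be applied to forests, whose
  colourings are sums and not given as trees.\<close>

definition rigid_color :: "color \<Rightarrow> bool" where
  "rigid_color C \<longleftrightarrow> range C \<subseteq> {0, 1, 2} \<and>
    (\<forall>\<sigma>. \<sigma> ` {0, 1, 2} \<subseteq> {0, 1, 2} \<longrightarrow> inj_on \<sigma> {0, 1, 2} \<longrightarrow> lab (relabel \<sigma> core) \<sqsubseteq> C \<longrightarrow>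
      \<sigma> 0 = 0 \<and> \<sigma> 1 = 1 \<and> \<sigma> 2 = 2)"

lemma rigid_color_perm:
  "rigid_color C \<Longrightarrow> \<sigma> ` {0, 1, 2} \<subseteq> {0, 1, 2} \<Longrightarrow> inj_on \<sigma> {0, 1, 2} \<Longrightarrow>
    lab (relabel \<sigma> core) \<sqsubseteq> C \<Longrightarrow> \<sigma> 0 = 0 \<and> \<sigma> 1 = 1 \<and> \<sigma> 2 = 2"
  unfolding rigid_color_def by iprover

lemma rigid_color_lab: "rigid t \<Longrightarrow> rigid_color (lab t)"
  unfolding rigid_def rigid_color_def range_lab hle_iff by blast

lemma rigid_color_forest:
  assumes "ts \<noteq> []" "\<forall>t\<in>set ts. rigid t" shows "rigid_color (forest_lab ts)"
  unfolding rigid_color_def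
proof (intro conjI allI impI)
  show "range (forest_lab ts) \<subseteq> {0, 1, 2}"
  proof
    fix l assume "l \<in> range (forest_lab ts)"
    then obtain x where x: "l = lab (ts ! (x 0 mod length ts)) (tail x)"
      by (auto simp: forest_lab_def color_sum_def)
    then have "l \<in> labels (ts ! (x 0 mod length ts))" unfolding range_lab[symmetric] by simp
    moreover have "rigid (ts ! (x 0 mod length ts))" using assms by simp
    ultimately show "l \<in> {0, 1, 2}" unfolding rigid_def by metis
  qed
  fix \<sigma> :: "nat \<Rightarrow> nat"
  assume s: "\<sigma> ` {0, 1, 2} \<subseteq> {0, 1, 2}" "inj_on \<sigma> {0, 1, 2}" "lab (relabel \<sigma> core) \<sqsubseteq> forest_lab ts"
  from wle_forestD[OF s(3) assms(1)] obtain t where "t \<in> set ts" "hle (relabel \<sigma> core) t" by blast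
  with assms(2) s(1,2) show "\<sigma> 0 = 0" "\<sigma> 1 = 1" "\<sigma> 2 = 2" unfolding rigid_def by blast+
qed

text \<open>On the copy of \<open>core\<close> inside \<open>c\<close> the reduction acts on labels
  by an injection \<open>\<sigma>\<close>, so \<open>core\<close> relabelled by
  \<open>\<sigma>\<close> lies below \<open>C\<close> and rigidity makes \<open>\<sigma>\<close> the
  identity. Every label of \<open>c\<close> occurs in that copy, so the conclusion extends to all
  points.\<close>

lemma rigid_colorD:
  assumes C: "rigid_color C" and c: "lab core \<sqsubseteq> c" "range c \<subseteq> {0, 1, 2}"
    and f: "cont f" "\<And>x y. c x = c y \<longleftrightarrow> C (f x) = C (f y)"
  shows "C (f w) = c w"
proof -
  obtain r where r: "cont r" "\<And>x. lab core x = c (r x)" using c(1) unfolding wle_def by blast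
  have rC: "range C \<subseteq> {0, 1, 2}" using C by (simp add: rigid_color_def)
  have rl: "range (lab core) = {0, 1, 2}" by (simp add: range_lab labels_vert)
  define s where "s l = (SOME x. lab core x = l)" for l
  have s: "lab core (s l) = l" if l: "l \<in> {0, 1, 2}" for l
  proof -
    have "l \<in> range (lab core)" using l unfolding rl .
    then have "\<exists>x. lab core x = l" by auto
    then show ?thesis unfolding s_def by (rule someI_ex)
  qed
  define \<sigma> where "\<sigma> l = C (f (r (s l)))" for l
  have eq: "C (f (r x)) = \<sigma> (lab core x)" for x
  proof -
    have "lab core x \<in> {0, 1, 2}" using rl by blast
    then have "lab core (s (lab core x)) = lab core x" by (rule s)
    then show ?thesis unfolding \<sigma>_def f(2)[symmetric] r(2)[symmetric] by simp
  qed
  have "inj_on \<sigma> {0, 1, 2}"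
  proof (rule inj_onI)
    fix l l' assume l: "l \<in> {0, 1, 2}" "l' \<in> {0, 1, 2}" "\<sigma> l = \<sigma> l'"
    from l(3) have "lab core (s l) = lab core (s l')" unfolding \<sigma>_def f(2)[symmetric] r(2)[symmetric] .
    with s l show "l = l'" by simp
  qed
  moreover have "\<sigma> ` {0, 1, 2} \<subseteq> {0, 1, 2}"
    using rangeI[of C] rC unfolding \<sigma>_def by (intro image_subsetI) (rule subsetD)
  moreover have "lab (relabel \<sigma> core) \<sqsubseteq> C"
    by (rule wleI[OF cont_comp[OF f(1) r(1)]]) (simp add: lab_relabel eq)
  ultimately have "\<sigma> 0 = 0 \<and> \<sigma> 1 = 1 \<and> \<sigma> 2 = 2"
    by (intro rigid_color_perm[OF C])
  then have \<sigma>: "\<sigma> 0 = 0" "\<sigma> 1 = 1" "\<sigma> 2 = 2" by simp_all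
  have w: "c w \<in> {0, 1, 2}" using c(2) by blast
  have "c (r (s (c w))) = c w" using s[OF w] r(2) by simp
  then have "C (f w) = C (f (r (s (c w))))" using f(2) by metis
  also have "\<dots> = \<sigma> (c w)" by (simp add: \<sigma>_def)
  also have "\<dots> = c w" using w \<sigma> by auto
  finally show ?thesis .
qed

lemma rigid_reduce:
  assumes "rigid t" "rigid s" "eqc (lab s) \<le>\<^sub>c eqc (lab t)" shows "hle s t"
proof -
  obtain f where f: "cont f" "\<And>x y. lab s x = lab s y \<longleftrightarrow> lab t (f x) = lab t (f y)"
    using assms(3) unfolding cont_reducible_def by auto
  have "lab t (f w) = lab s w" for w
    by (rule rigid_colorD[where C = "lab t" and c = "lab s" and f = f, OF rigid_color_lab[OF assms(1)] _ _ f])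
       (use assms(2) in \<open>auto simp: rigid_def hle_iff range_lab\<close>)
  then show ?thesis unfolding hle_iff by (intro wleI[OF f(1)]) simp
qed

section \<open>Join irreducible elements of a downward closed family\<close>

locale er_family =
  fixes A :: "baire rel set"
  assumes A_ER: "A \<subseteq> ER"
    and down: "\<And>E F. F \<in> A \<Longrightarrow> E \<in> ER \<Longrightarrow> E \<le>\<^sub>c F \<Longrightarrow> E \<in> A"
    and lab_in: "\<And>t. labels t \<subseteq> {0, 1, 2} \<Longrightarrow> eqc (lab t) \<in> A"
begin

abbreviation "tlike \<equiv> tree_like A (\<le>\<^sub>c) (eqc (lab core))"

lemma color_down: "eqc d \<in> A \<Longrightarrow> c \<sqsubseteq> d \<Longrightarrow> eqc c \<in> A"
  using down eqc_ER wle_imp_reducible by blast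

lemma forest_in:
  assumes "ts \<noteq> []" "\<forall>t\<in>set ts. rigid t" shows "eqc (forest_lab ts) \<in> A"
proof (rule color_down[OF lab_in forest_wle_Node])
  show "labels (Node 0 ts) \<subseteq> {0, 1, 2}" using assms by (auto simp: rigid_def)
qed (rule assms)

text \<open>Both u and v are pulled back from \<open>lab t\<close>, which aligns their labels; so
  their disjoint sum is still below \<open>lab t\<close>. By irreducibility the tree reduces to that
  sum only if it reduces to u or v.\<close>

lemma tree_like_lab:
  assumes "labels t \<subseteq> {0, 1, 2}" "hle core t"
  shows "tlike (eqc (lab t))"
  unfolding tree_like_def
proof (intro conjI ballI impI)
  show "eqc (lab core) \<le>\<^sub>c eqc (lab t)" using assms(2) by (auto simp: hle_iff intro: wle_imp_reducible)
  fix u v assume uv: "eqc (lab core) \<le>\<^sub>c u \<and> u \<le>\<^sub>c eqc (lab t) \<and> \<not> eqc (lab t) \<le>\<^sub>c u \<and>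
    eqc (lab core) \<le>\<^sub>c v \<and> v \<le>\<^sub>c eqc (lab t) \<and> \<not> eqc (lab t) \<le>\<^sub>c v"
  then have "u \<le>\<^sub>c eqc (lab t)" "v \<le>\<^sub>c eqc (lab t)" by blast+
  from reducible_eqcE[OF this(1)] obtain f where f: "cont f" "u = eqc (\<lambda>x. lab t (f x))" .
  from reducible_eqcE[OF \<open>v \<le>\<^sub>c eqc (lab t)\<close>] obtain g where g: "cont g" "v = eqc (\<lambda>x. lab t (g x))" .
  define cs where "cs i = (if i = (0::nat) then (\<lambda>x. lab t (f x)) else (\<lambda>x. lab t (g x)))" for i
  have cs: "cs i \<sqsubseteq> lab t" for i unfolding cs_def using f(1) g(1) by (auto intro: wleI)
  have u: "u = eqc (cs 0)" and v: "v = eqc (cs 1)" using f(2) g(2) by (simp_all add: cs_def)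
  show "\<exists>y\<in>A. u \<le>\<^sub>c y \<and> v \<le>\<^sub>c y \<and> y \<le>\<^sub>c eqc (lab t) \<and> \<not> eqc (lab t) \<le>\<^sub>c y"
  proof (intro bexI[of _ "eqc (color_sum cs)"] conjI)
    show "eqc (color_sum cs) \<in> A" by (rule color_down[OF lab_in[OF assms(1)] color_sum_wle[OF cs]])
    show "u \<le>\<^sub>c eqc (color_sum cs)" "v \<le>\<^sub>c eqc (color_sum cs)" unfolding u v by (rule wle_imp_reducible[OF wle_color_sum])+
    show "eqc (color_sum cs) \<le>\<^sub>c eqc (lab t)" by (rule wle_imp_reducible[OF color_sum_wle[OF cs]])
    show "\<not> eqc (lab t) \<le>\<^sub>c eqc (color_sum cs)"
    proof
      assume "eqc (lab t) \<le>\<^sub>c eqc (color_sum cs)"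
      then obtain i where "eqc (lab t) \<le>\<^sub>c eqc (cs i)" using lab_irreducible by blast
      with uv u v show False by (cases "i = 0") (auto simp: cs_def)
    qed
  qed
qed

text \<open>Elements are absorbed one at a time. Each intermediate bound is again above
  \<open>core\<close> and strictly below \<open>z\<close>, as the next application of the
  two-element property requires.\<close>

lemma tree_like_join:
  fixes n :: nat
  assumes z: "tlike z" and cs: "\<And>j. j < n \<Longrightarrow> cs j \<in> A" "\<And>j. j < n \<Longrightarrow> eqc (lab core) \<le>\<^sub>c cs j"
    "\<And>j. j < n \<Longrightarrow> cs j \<le>\<^sub>c z" "\<And>j. j < n \<Longrightarrow> \<not> z \<le>\<^sub>c cs j" and n: "n > 0"
  shows "\<exists>y\<in>A. (\<forall>j<n. cs j \<le>\<^sub>c y) \<and> y \<le>\<^sub>c z \<and> \<not> z \<le>\<^sub>c y"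
  using n cs
proof (induction n rule: nat_induct_non_zero)
  case 1
  then show ?case by (intro bexI[of _ "cs 0"]) (auto intro: cont_reducible_refl)
next
  case (Suc n)
  from Suc obtain y where y: "y \<in> A" "\<forall>j<n. cs j \<le>\<^sub>c y" "y \<le>\<^sub>c z" "\<not> z \<le>\<^sub>c y" by auto
  have "eqc (lab core) \<le>\<^sub>c cs 0" "cs 0 \<le>\<^sub>c y" using Suc.prems Suc.hyps y(2) by auto
  then have "eqc (lab core) \<le>\<^sub>c y" by (rule cont_reducible_trans)
  then obtain y' where y': "y' \<in> A" "y \<le>\<^sub>c y'" "cs n \<le>\<^sub>c y'" "y' \<le>\<^sub>c z" "\<not> z \<le>\<^sub>c y'"
    using z y Suc.prems unfolding tree_like_def by (metis lessI)
  have "\<forall>j<Suc n. cs j \<le>\<^sub>c y'" using y(2) y' cont_reducible_trans less_Suc_eq by metis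
  with y' show ?case by blast
qed

text \<open>Cut \<open>z\<close> along the trees of the forest and add a copy of \<open>core\<close> to each piece. If all pieces were strictly
  below \<open>z\<close>, so would be a common upper bound; by rigidity the reductions of the pieces to it
  preserve labels and can be glued to a reduction of \<open>z\<close>.\<close>

lemma tree_like_below_forest:
  assumes ts: "ts \<noteq> []" "\<forall>t\<in>set ts. rigid t" and z: "z \<in> A" "tlike z" "z \<le>\<^sub>c eqc (forest_lab ts)"
  shows "\<exists>t\<in>set ts. z \<le>\<^sub>c eqc (lab t)"
proof (rule ccontr)
  assume neg: "\<not> ?thesis"
  let ?C = "forest_lab ts" and ?L = "length ts"
  have C: "rigid_color ?C" using ts by (rule rigid_color_forest)
  then have rC: "range ?C \<subseteq> {0, 1, 2}" by (simp add: rigid_color_def)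
  obtain f where f: "cont f" "z = eqc (\<lambda>x. ?C (f x))" using z(3) by (rule reducible_eqcE)
  let ?D = "\<lambda>x. ?C (f x)"
  have rq: "range (lab core) \<subseteq> {0, 1, 2}" by (simp add: range_lab labels_vert)
  have "eqc (lab core) \<le>\<^sub>c z" using z(2) by (simp add: tree_like_def)
  then obtain g where g: "cont g" "\<And>x y. lab core x = lab core y \<longleftrightarrow> ?D (g x) = ?D (g y)"
    unfolding f(2) cont_reducible_def by auto
  have g': "?D (g x) = lab core x" for x
    using rigid_colorD[where C = ?C and c = "lab core" and f = "\<lambda>x. f (g x)",
        OF C wle_refl rq cont_comp[OF f(1) g(1)] g(2)] .
  \<comment> \<open>The first entry is a switch: 0 forces the copy of \<open>core\<close> given by
    \<open>g\<close>, a nonzero entry shows the point \<open>tail x\<close> if it belongs to piece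
    \<open>j\<close>. Points of other pieces also fall back on the copy of
    \<open>core\<close>.\<close>
  define k where "k j x = (if x 0 \<noteq> 0 \<and> f (tail x) 0 mod ?L = j then tail x else g (tail x))" for j x
  have lc: "loc_const (\<lambda>x. f x 0 mod ?L)"
    by (rule loc_const_app[OF loc_const_comp[OF loc_const_nth f(1)]])
  have lc': "loc_const (\<lambda>x. x 0 \<noteq> 0 \<and> f (tail x) 0 mod ?L = j)" for j
    using loc_const_app2[OF loc_const_nth[of 0] loc_const_comp[OF lc cont_tail],
      of "\<lambda>a b. a \<noteq> 0 \<and> b = j"] .
  have k: "cont (k j)" for j
    unfolding k_def by (rule cont_if[OF lc' cont_tail cont_comp[OF g(1) cont_tail]])
  define \<zeta> where "\<zeta> j x = ?D (k j x)" for j x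
  have \<zeta>D: "\<zeta> j \<sqsubseteq> ?D" for j by (rule wleI[OF k]) (simp add: \<zeta>_def)
  have q\<zeta>: "lab core \<sqsubseteq> \<zeta> j" for j
    by (rule wleI[OF cont_cons[of 0]]) (simp add: \<zeta>_def k_def g')
  have \<zeta>A: "eqc (\<zeta> j) \<in> A" for j using \<zeta>D z(1) color_down unfolding f(2) by blast
  have \<zeta>t: "\<zeta> j \<sqsubseteq> lab (ts ! j)" if j: "j < ?L" for j
  proof -
    have "lab core \<sqsubseteq> lab (ts ! j)" using ts j by (auto simp: rigid_def hle_iff)
    then obtain r where r: "cont r" "\<And>x. lab core x = lab (ts ! j) (r x)" unfolding wle_def by blast
    have "\<zeta> j x = lab (ts ! j) (if x 0 \<noteq> 0 \<and> f (tail x) 0 mod ?L = j then tail (f (tail x)) else r (tail x))" for x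
    proof (cases "x 0 \<noteq> 0 \<and> f (tail x) 0 mod ?L = j")
      case True
      then show ?thesis by (simp add: \<zeta>_def k_def forest_lab_def color_sum_def)
    next
      case False
      then have "\<zeta> j x = ?D (g (tail x))" by (auto simp: \<zeta>_def k_def)
      then show ?thesis using False g' r(2) by auto
    qed
    then show ?thesis
      by (intro wleI[OF cont_if[OF lc' cont_comp[OF cont_tail cont_comp[OF f(1) cont_tail]] cont_comp[OF r(1) cont_tail]]])
  qed
  have nz: "\<not> z \<le>\<^sub>c eqc (\<zeta> j)" if j: "j < ?L" for j
    using neg wle_imp_reducible[OF \<zeta>t[OF j]] nth_mem[OF j] cont_reducible_trans by blast
  have "\<exists>y\<in>A. (\<forall>j<?L. eqc (\<zeta> j) \<le>\<^sub>c y) \<and> y \<le>\<^sub>c z \<and> \<not> z \<le>\<^sub>c y"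
    by (rule tree_like_join[OF z(2)])
       (use ts(1) \<zeta>A nz wle_imp_reducible[OF q\<zeta>] wle_imp_reducible[OF \<zeta>D] f(2) in auto)
  then obtain y where y: "y \<in> A" "\<forall>j<?L. eqc (\<zeta> j) \<le>\<^sub>c y" "y \<le>\<^sub>c z" "\<not> z \<le>\<^sub>c y" by blast
  from y(3) obtain p where p: "cont p" "y = eqc (\<lambda>x. ?D (p x))" unfolding f(2) by (rule reducible_eqcE)
  have "\<exists>h. cont h \<and> (\<forall>x. ?D (p (h x)) = \<zeta> j x)" if j: "j < ?L" for j
  proof -
    from y(2) j obtain h where h: "cont h" "\<And>x x'. \<zeta> j x = \<zeta> j x' \<longleftrightarrow> ?D (p (h x)) = ?D (p (h x'))"
      unfolding p(2) cont_reducible_def by auto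
    have r\<zeta>: "range (\<zeta> j) \<subseteq> {0, 1, 2}"
      by (intro image_subsetI, unfold \<zeta>_def) (rule subsetD[OF rC rangeI])
    have "?D (p (h x)) = \<zeta> j x" for x
      using rigid_colorD[where C = ?C and c = "\<zeta> j" and f = "\<lambda>x. f (p (h x))",
          OF C q\<zeta> r\<zeta> cont_comp[OF f(1) cont_comp[OF p(1) h(1)]] h(2)] .
    with h(1) show ?thesis by blast
  qed
  then obtain h where h: "\<And>j. j < ?L \<Longrightarrow> cont (h j)" "\<And>j x. j < ?L \<Longrightarrow> ?D (p (h j x)) = \<zeta> j x" by metis
  \<comment> \<open>The entry 1 turns the switch to the original point; applied with the index of
    the piece containing \<open>x\<close>, this recovers the colour of \<open>x\<close>.\<close>
  define h' where "h' j x = (if j < ?L then h j (cons 1 x) else x)" for j x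
  have "cont (h' j)" for j
    unfolding h'_def using cont_comp[OF h(1) cont_cons] cont_id by (cases "j < ?L") auto
  then have ch: "cont (\<lambda>x. h' (f x 0 mod ?L) x)" by (rule cont_glue[OF lc])
  have "?D x = ?D (p (h' (f x 0 mod ?L) x))" for x
  proof -
    have "f x 0 mod ?L < ?L" using ts by simp
    then have "?D (p (h' (f x 0 mod ?L) x)) = \<zeta> (f x 0 mod ?L) (cons 1 x)"
      by (simp add: h'_def h(2))
    also have "\<dots> = ?D x" by (simp add: \<zeta>_def k_def)
    finally show ?thesis by simp
  qed
  then have "?D \<sqsubseteq> (\<lambda>x. ?D (p x))" by (intro wleI[OF ch])
  then have "z \<le>\<^sub>c y" unfolding f(2) p(2) by (rule wle_imp_reducible)
  with y(4) show False ..
qed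

section \<open>Vertex trees, edge trees and the graphs they code\<close>

definition vertex :: "nat \<Rightarrow> nat \<Rightarrow> tree" where "vertex n i = vert (3 + i) (3 + (n - i))"
definition edge_tree :: "nat \<Rightarrow> nat \<times> nat \<Rightarrow> tree" where
  "edge_tree n = (\<lambda>(i, j). edge [(3 + i, 3 + (n - i)), (3 + j, 3 + (n - j))])"

lemma rigid_vertex: "rigid (vertex n i)"
  unfolding vertex_def by (rule rigid_vert) auto

lemma rigid_edge_tree: "rigid (edge_tree n p)"
  unfolding edge_tree_def by (cases p) (auto intro!: rigid_edge)

text \<open>The parameters of \<open>vertex n i\<close> move in opposite directions, and their
  offset 3 keeps the tree above \<open>core\<close>. Vertices will have indices below
  \<open>n\<close>, so the index \<open>n\<close>, also covered here, is left as a spare.\<close>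

lemma hle_vertex: "i \<le> n \<Longrightarrow> j \<le> n \<Longrightarrow> hle (vertex n i) (vertex n j) \<longleftrightarrow> i = j"
  unfolding vertex_def by (subst hle_vert_iff) auto

lemma hle_vertex_edge_tree: "i \<le> n \<Longrightarrow> k \<le> n \<Longrightarrow> l \<le> n \<Longrightarrow> hle (vertex n i) (edge_tree n (k, l)) \<longleftrightarrow> i = k \<or> i = l"
proof -
  have "hle (vertex n i) (edge_tree n (k, l)) \<longleftrightarrow> hle (vertex n i) (vertex n k) \<or> hle (vertex n i) (vertex n l)"
    unfolding edge_tree_def prod.case vertex_def hle_vert_edge by simp
  then show "i \<le> n \<Longrightarrow> k \<le> n \<Longrightarrow> l \<le> n \<Longrightarrow> ?thesis" by (simp add: hle_vertex)
qed

lemma tlike_rigid: "rigid t \<Longrightarrow> tlike (eqc (lab t))"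
  by (rule tree_like_lab) (auto simp: rigid_def)

lemma rigid_in: "rigid t \<Longrightarrow> eqc (lab t) \<in> A"
  by (rule lab_in) (auto simp: rigid_def)

lemma rigid_reduce_iff: "rigid s \<Longrightarrow> rigid t \<Longrightarrow> eqc (lab s) \<le>\<^sub>c eqc (lab t) \<longleftrightarrow> hle s t"
  using rigid_reduce wle_imp_reducible hle_iff by blast

lemma below_vertices:
  assumes "n > 0" "z \<in> A" "tlike z" "z \<le>\<^sub>c eqc (forest_lab (map (vertex n) [0..<n]))"
  shows "\<exists>i<n. z \<le>\<^sub>c eqc (lab (vertex n i))"
  using tree_like_below_forest[OF _ _ assms(2-4)] assms(1) by (auto simp: rigid_vertex)

text \<open>A tree-like element below the forest is below a single vertex tree; if it is also above
  vertex \<open>i\<close>, the antichain property identifies that vertex as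
  \<open>i\<close>.\<close>

lemma node_like_vertex:
  assumes i: "i < n"
  shows "node_like A (\<le>\<^sub>c) (eqc (lab core)) (eqc (forest_lab (map (vertex n) [0..<n]))) (eqc (lab (vertex n i)))"
  unfolding node_like_def
proof (intro conjI ballI impI)
  show "tlike (eqc (lab (vertex n i)))" by (rule tlike_rigid[OF rigid_vertex])
  show "eqc (lab (vertex n i)) \<le>\<^sub>c eqc (forest_lab (map (vertex n) [0..<n]))"
    using i by (intro wle_imp_reducible lab_wle_forest) auto
  fix y assume y: "y \<in> A" "tlike y \<and> y \<le>\<^sub>c eqc (forest_lab (map (vertex n) [0..<n])) \<and> eqc (lab (vertex n i)) \<le>\<^sub>c y"
  then obtain j where j: "j < n" "y \<le>\<^sub>c eqc (lab (vertex n j))" using i below_vertices[of n y] by auto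
  with y have "eqc (lab (vertex n i)) \<le>\<^sub>c eqc (lab (vertex n j))" using cont_reducible_trans by blast
  then have "i = j" using i j hle_vertex by (simp add: rigid_reduce_iff rigid_vertex)
  with j show "y \<le>\<^sub>c eqc (lab (vertex n i))" by simp
qed

lemma node_like_is_vertex:
  assumes n: "n > 0" and x: "x \<in> A"
    and N: "node_like A (\<le>\<^sub>c) (eqc (lab core)) (eqc (forest_lab (map (vertex n) [0..<n]))) x"
  shows "\<exists>i<n. x \<le>\<^sub>c eqc (lab (vertex n i)) \<and> eqc (lab (vertex n i)) \<le>\<^sub>c x"
proof -
  obtain j where j: "j < n" "x \<le>\<^sub>c eqc (lab (vertex n j))"
    using below_vertices[OF n x] N unfolding node_like_def by blast
  moreover have "eqc (lab (vertex n j)) \<le>\<^sub>c x"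
    using N node_like_vertex[OF j(1)] j rigid_in[OF rigid_vertex] unfolding node_like_def by blast
  ultimately show ?thesis by blast
qed

text \<open>The tree for \<open>(n, n)\<close> keeps the forest nonempty and is above no vertex with
  index below \<open>n\<close>. An edge also links each of its ends to itself, which is why the
  right-hand side is an inclusion of sets.\<close>

lemma linked_iff:
  assumes ps: "\<forall>(k, l)\<in>set ps. k < n \<and> l < n" and ij: "i < n" "j < n"
  shows "linked A (\<le>\<^sub>c) (eqc (lab core)) (eqc (forest_lab (map (edge_tree n) ((n, n) # ps))))
      (eqc (lab (vertex n i))) (eqc (lab (vertex n j))) \<longleftrightarrow> (\<exists>(k, l)\<in>set ps. {i, j} \<subseteq> {k, l})"
proof -
  let ?ts = "map (edge_tree n) ((n, n) # ps)"
  have ts: "?ts \<noteq> []" "\<forall>t\<in>set ?ts. rigid t" by (auto simp: rigid_edge_tree)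
  have h: "eqc (lab (vertex n i)) \<le>\<^sub>c eqc (lab (edge_tree n p)) \<longleftrightarrow> i = fst p \<or> i = snd p"
    if "i < n" "p = (n, n) \<or> p \<in> set ps" for i p
    using that ps hle_vertex_edge_tree[of i n "fst p" "snd p"] by (auto simp: rigid_reduce_iff rigid_vertex rigid_edge_tree)
  show ?thesis
  proof
    assume "linked A (\<le>\<^sub>c) (eqc (lab core)) (eqc (forest_lab ?ts)) (eqc (lab (vertex n i))) (eqc (lab (vertex n j)))"
    then obtain w where w: "w \<in> A" "tlike w" "w \<le>\<^sub>c eqc (forest_lab ?ts)"
      "eqc (lab (vertex n i)) \<le>\<^sub>c w" "eqc (lab (vertex n j)) \<le>\<^sub>c w" unfolding linked_def by blast
    from tree_like_below_forest[OF ts w(1-3)] obtain p where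
      p: "p = (n, n) \<or> p \<in> set ps" "w \<le>\<^sub>c eqc (lab (edge_tree n p))" by auto
    have *: "i = fst p \<or> i = snd p" "j = fst p \<or> j = snd p"
      using h[OF ij(1) p(1)] h[OF ij(2) p(1)] cont_reducible_trans w(4,5) p(2) by blast+
    with ij p have "p \<in> set ps" by auto
    with * show "\<exists>(k, l)\<in>set ps. {i, j} \<subseteq> {k, l}" by (intro bexI[of _ p]) (auto simp: case_prod_unfold)
  next
    assume "\<exists>(k, l)\<in>set ps. {i, j} \<subseteq> {k, l}"
    then obtain p where p: "p \<in> set ps" "i = fst p \<or> i = snd p" "j = fst p \<or> j = snd p" by auto
    show "linked A (\<le>\<^sub>c) (eqc (lab core)) (eqc (forest_lab ?ts)) (eqc (lab (vertex n i))) (eqc (lab (vertex n j)))"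
      unfolding linked_def
    proof (intro bexI[of _ "eqc (lab (edge_tree n p))"] conjI)
      show "eqc (lab (edge_tree n p)) \<le>\<^sub>c eqc (forest_lab ?ts)" using p(1) by (intro wle_imp_reducible lab_wle_forest) auto
    qed (use h p ij in \<open>auto intro: tlike_rigid rigid_in rigid_edge_tree\<close>)
  qed
qed

end

section \<open>Definable predicates\<close>

lemma finite_free_vars [simp]: "finite (free_vars p)"
  by (induction p) auto

fun rename :: "(nat \<Rightarrow> nat) \<Rightarrow> fm \<Rightarrow> fm" where
  "rename \<rho> (Le i j) = Le (\<rho> i) (\<rho> j)"
| "rename \<rho> (Eq i j) = Eq (\<rho> i) (\<rho> j)"
| "rename \<rho> (Neg p) = Neg (rename \<rho> p)"
| "rename \<rho> (Conj p q) = Conj (rename \<rho> p) (rename \<rho> q)"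
| "rename \<rho> (Ex i p) = (let k = Suc (Max (insert 0 (\<rho> ` free_vars p))) in Ex k (rename (\<rho>(i := k)) p))"

lemma sat_rename: "sat M le v (rename \<rho> p) \<longleftrightarrow> sat M le (\<lambda>i. v (\<rho> i)) p"
proof (induction p arbitrary: v \<rho>)
  case (Ex i p)
  define k where "k = Suc (Max (insert 0 (\<rho> ` free_vars p)))"
  have k: "\<rho> j \<noteq> k" if "j \<in> free_vars p" for j
  proof -
    have "\<rho> j \<le> Max (insert 0 (\<rho> ` free_vars p))" using that by (intro Max_ge) auto
    then show ?thesis by (simp add: k_def)
  qed
  have "sat M le (\<lambda>j. (v(k := a)) ((\<rho>(i := k)) j)) p \<longleftrightarrow> sat M le ((\<lambda>j. v (\<rho> j))(i := a)) p" for a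
    by (rule sat_cong) (use k in auto)
  then show ?case using Ex by (simp add: Let_def k_def[symmetric])
qed auto

section \<open>Definability and its closure under logical operations\<close>

definition definable :: "'a set \<Rightarrow> ('a \<Rightarrow> 'a \<Rightarrow> bool) \<Rightarrow> ((nat \<Rightarrow> 'a) \<Rightarrow> bool) \<Rightarrow> bool" where
  "definable M le Q \<longleftrightarrow> (\<exists>p. \<forall>v. range v \<subseteq> M \<longrightarrow> (sat M le v p \<longleftrightarrow> Q v))"

lemma definable_le: "definable M le (\<lambda>v. le (v i) (v j))"
  unfolding definable_def by (intro exI[of _ "Le i j"]) simp

lemma definable_eq: "definable M le (\<lambda>v. v i = v j)"
  unfolding definable_def by (intro exI[of _ "Eq i j"]) simp

lemma definable_not: "definable M le P \<Longrightarrow> definable M le (\<lambda>v. \<not> P v)"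
  unfolding definable_def by (metis sat.simps(3))

lemma definable_conj: "definable M le P \<Longrightarrow> definable M le Q \<Longrightarrow> definable M le (\<lambda>v. P v \<and> Q v)"
  unfolding definable_def by (metis sat.simps(4))

lemma definable_disj: "definable M le P \<Longrightarrow> definable M le Q \<Longrightarrow> definable M le (\<lambda>v. P v \<or> Q v)"
  using definable_not[OF definable_conj[OF definable_not definable_not], of M le P Q] by simp

lemma definable_imp: "definable M le P \<Longrightarrow> definable M le Q \<Longrightarrow> definable M le (\<lambda>v. P v \<longrightarrow> Q v)"
  using definable_not[OF definable_conj[OF _ definable_not], of M le P Q] by simp

lemma definable_const: "definable M le (\<lambda>v. b)"
  unfolding definable_def
  by (cases b) (auto intro: exI[of _ "Eq 0 0"] exI[of _ "Neg (Eq 0 0)"])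

lemma definable_Ball:
  assumes "finite I" "\<And>i. i \<in> I \<Longrightarrow> definable M le (Q i)"
  shows "definable M le (\<lambda>v. \<forall>i\<in>I. Q i v)"
  using assms
proof (induction I rule: finite_induct)
  case empty
  show ?case using definable_const[of M le True] by simp
next
  case (insert i I)
  then show ?case using definable_conj[of M le "Q i" "\<lambda>v. \<forall>i\<in>I. Q i v"] by auto
qed

lemma definable_all_less:
  fixes n :: nat
  assumes "\<And>i. i < n \<Longrightarrow> definable M le (Q i)"
  shows "definable M le (\<lambda>v. \<forall>i<n. Q i v)"
proof -
  have "definable M le (\<lambda>v. \<forall>i\<in>{..<n}. Q i v)"
    by (rule definable_Ball) (use assms in auto)
  then show ?thesis by (simp add: Ball_def)
qed

lemma definable_subst: "definable M le Q \<Longrightarrow> definable M le (\<lambda>v. Q (\<lambda>i. v (\<rho> i)))"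
proof -
  assume "definable M le Q"
  then obtain p where p: "\<And>v. range v \<subseteq> M \<Longrightarrow> sat M le v p \<longleftrightarrow> Q v" unfolding definable_def by blast
  have "sat M le v (rename \<rho> p) \<longleftrightarrow> Q (\<lambda>i. v (\<rho> i))" if "range v \<subseteq> M" for v
    unfolding sat_rename by (rule p) (use that in auto)
  then show ?thesis unfolding definable_def by blast
qed

text \<open>The quantified variable is number \<open>0\<close> and the others are shifted, as for de Bruijn indices.\<close>

lemma definable_ex:
  assumes "definable M le (\<lambda>v. Q (v 0) (\<lambda>i. v (Suc i)))"
  shows "definable M le (\<lambda>v. \<exists>a\<in>M. Q a v)"
proof -
  from assms obtain p where
    p: "\<And>v. range v \<subseteq> M \<Longrightarrow> sat M le v p \<longleftrightarrow> Q (v 0) (\<lambda>i. v (Suc i))"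
    unfolding definable_def by blast
  define k where "k = Suc (Max (insert 0 (free_vars p)))"
  have k: "j < k" if "j \<in> free_vars p" for j
    unfolding k_def using that by (intro le_imp_less_Suc Max_ge) auto
  let ?p = "Ex k (rename (case_nat k (\<lambda>i. i)) p)"
  have "sat M le v ?p \<longleftrightarrow> (\<exists>a\<in>M. Q a v)" if v: "range v \<subseteq> M" for v
  proof -
    have "sat M le (\<lambda>i. (v(k := a)) (case_nat k (\<lambda>i. i) i)) p \<longleftrightarrow> sat M le (case_nat a v) p" for a
      by (rule sat_cong) (use k in \<open>fastforce split: nat.splits\<close>)
    moreover have "sat M le (case_nat a v) p \<longleftrightarrow> Q a v" if "a \<in> M" for a
      using that v by (subst p) (auto simp: image_subset_iff split: nat.splits)
    ultimately show ?thesis by (simp add: sat_rename)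
  qed
  then show ?thesis unfolding definable_def by blast
qed

lemma definable_all:
  assumes "definable M le (\<lambda>v. Q (v 0) (\<lambda>i. v (Suc i)))"
  shows "definable M le (\<lambda>v. \<forall>a\<in>M. Q a v)"
proof -
  have "definable M le (\<lambda>v. \<not> (\<exists>a\<in>M. \<not> Q a v))"
    by (intro definable_not definable_ex assms)
  then show ?thesis by simp
qed

lemma definable_ex_list:
  assumes "definable M le (\<lambda>v. Q (map v [0..<n]) (\<lambda>i. v (i + n)))"
  shows "definable M le (\<lambda>v. \<exists>xs. length xs = n \<and> set xs \<subseteq> M \<and> Q xs v)"
  using assms
proof (induction n arbitrary: Q)
  case 0
  then show ?case by simp
next
  case (Suc n)
  \<comment> \<open>The head of the list is quantified outermost, so behind the \<open>n\<close>
    inner quantifiers it is variable number \<open>n\<close>; \<open>\<rho>\<close> puts it in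
    front.\<close>
  define \<rho> where "\<rho> i = (if i = 0 then n else if i \<le> n then i - 1 else i)" for i
  have \<rho>: "map (\<lambda>i. v (\<rho> i)) [0..<Suc n] = v n # map v [0..<n]" for v :: "nat \<Rightarrow> 'a"
    by (rule nth_equalityI) (auto simp: \<rho>_def nth_Cons' simp del: upt_Suc)
  have "definable M le (\<lambda>v. Q (map (\<lambda>i. v (\<rho> i)) [0..<Suc n]) (\<lambda>i. v (\<rho> (i + Suc n))))"
    using definable_subst[OF Suc.prems, of \<rho>] .
  then have "definable M le (\<lambda>v. Q (v n # map v [0..<n]) (\<lambda>i. v (Suc (i + n))))"
    unfolding \<rho> by (simp add: \<rho>_def)
  then have "definable M le (\<lambda>v. \<exists>xs. length xs = n \<and> set xs \<subseteq> M \<and> Q (v 0 # xs) (\<lambda>i. v (Suc i)))"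
    by (intro Suc.IH) simp
  then have "definable M le (\<lambda>v. \<exists>x\<in>M. \<exists>xs. length xs = n \<and> set xs \<subseteq> M \<and> Q (x # xs) v)"
    by (rule definable_ex)
  moreover have "(\<exists>x\<in>M. \<exists>xs. length xs = n \<and> set xs \<subseteq> M \<and> Q (x # xs) v) \<longleftrightarrow>
      (\<exists>xs. length xs = Suc n \<and> set xs \<subseteq> M \<and> Q xs v)" for v
  proof
    assume "\<exists>x\<in>M. \<exists>xs. length xs = n \<and> set xs \<subseteq> M \<and> Q (x # xs) v"
    then obtain x xs where "x \<in> M" "length xs = n" "set xs \<subseteq> M" "Q (x # xs) v" by blast
    then show "\<exists>xs. length xs = Suc n \<and> set xs \<subseteq> M \<and> Q xs v" by (intro exI[of _ "x # xs"]) simp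
  next
    assume "\<exists>xs. length xs = Suc n \<and> set xs \<subseteq> M \<and> Q xs v"
    then obtain x xs where "length xs = n" "set (x # xs) \<subseteq> M" "Q (x # xs) v"
      by (metis length_Suc_conv)
    then show "\<exists>x\<in>M. \<exists>xs. length xs = n \<and> set xs \<subseteq> M \<and> Q (x # xs) v" by auto
  qed
  ultimately show ?case by simp
qed

lemma definable_all_list:
  assumes "definable M le (\<lambda>v. Q (map v [0..<n]) (\<lambda>i. v (i + n)))"
  shows "definable M le (\<lambda>v. \<forall>xs. length xs = n \<longrightarrow> set xs \<subseteq> M \<longrightarrow> Q xs v)"
proof -
  have "definable M le (\<lambda>v. \<not> (\<exists>xs. length xs = n \<and> set xs \<subseteq> M \<and> \<not> Q xs v))"
    by (intro definable_not definable_ex_list assms)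
  moreover have "\<not> (\<exists>xs. length xs = n \<and> set xs \<subseteq> M \<and> \<not> Q xs v) \<longleftrightarrow>
    (\<forall>xs. length xs = n \<longrightarrow> set xs \<subseteq> M \<longrightarrow> Q xs v)" for v by blast
  ultimately show ?thesis by simp
qed

section \<open>Discrete linear orders and their numerals\<close>

definition zero_in :: "'a set \<Rightarrow> ('a \<Rightarrow> 'a \<Rightarrow> bool) \<Rightarrow> 'a \<Rightarrow> bool" where
  "zero_in N lt x \<longleftrightarrow> x \<in> N \<and> (\<forall>y\<in>N. \<not> lt y x)"

definition succ_in :: "'a set \<Rightarrow> ('a \<Rightarrow> 'a \<Rightarrow> bool) \<Rightarrow> 'a \<Rightarrow> 'a \<Rightarrow> bool" where
  "succ_in N lt x y \<longleftrightarrow> x \<in> N \<and> y \<in> N \<and> lt x y \<and> (\<forall>z\<in>N. \<not> (lt x z \<and> lt z y))"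

definition numbers :: "'a set \<Rightarrow> ('a \<Rightarrow> 'a \<Rightarrow> bool) \<Rightarrow> bool" where
  "numbers N lt \<longleftrightarrow> (\<forall>x\<in>N. \<not> lt x x) \<and> (\<forall>x\<in>N. \<forall>y\<in>N. \<forall>z\<in>N. lt x y \<and> lt y z \<longrightarrow> lt x z) \<and>
    (\<forall>x\<in>N. \<forall>y\<in>N. lt x y \<or> x = y \<or> lt y x) \<and> (\<exists>x\<in>N. zero_in N lt x) \<and>
    (\<forall>x\<in>N. \<forall>y\<in>N. lt x y \<longrightarrow> (\<exists>z\<in>N. succ_in N lt x z))"

primrec numeral_in :: "'a set \<Rightarrow> ('a \<Rightarrow> 'a \<Rightarrow> bool) \<Rightarrow> nat \<Rightarrow> 'a \<Rightarrow> bool" where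
  "numeral_in N lt 0 x \<longleftrightarrow> zero_in N lt x"
| "numeral_in N lt (Suc n) x \<longleftrightarrow> (\<exists>y\<in>N. succ_in N lt y x \<and> numeral_in N lt n y)"

lemma numeral_in_mem: "numeral_in N lt n x \<Longrightarrow> x \<in> N"
  by (cases n) (auto simp: zero_in_def succ_in_def)

context
  fixes N :: "'a set" and lt :: "'a \<Rightarrow> 'a \<Rightarrow> bool"
  assumes num: "numbers N lt"
begin

lemma numbers_irrefl: "x \<in> N \<Longrightarrow> \<not> lt x x"
  and numbers_trans: "x \<in> N \<Longrightarrow> y \<in> N \<Longrightarrow> z \<in> N \<Longrightarrow> lt x y \<Longrightarrow> lt y z \<Longrightarrow> lt x z"
  and numbers_total: "x \<in> N \<Longrightarrow> y \<in> N \<Longrightarrow> lt x y \<or> x = y \<or> lt y x"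
  and numbers_zero: "\<exists>x. zero_in N lt x"
  and numbers_succ: "x \<in> N \<Longrightarrow> y \<in> N \<Longrightarrow> lt x y \<Longrightarrow> \<exists>z. succ_in N lt x z"
  using num unfolding numbers_def by blast+

lemma numeral_in_unique: "numeral_in N lt n x \<Longrightarrow> numeral_in N lt n y \<Longrightarrow> x = y"
proof (induction n arbitrary: x y)
  case 0
  then show ?case using numbers_total[of x y] by (auto simp: zero_in_def)
next
  case (Suc n)
  then obtain z where z: "succ_in N lt z x" "succ_in N lt z y" by auto
  then show ?case using numbers_total[of x y] by (auto simp: succ_in_def)
qed

text \<open>This serves minimisation, where a claimed value need not be a numeral. In the step, an
  element beyond the n-th numeral gives it a successor, and by discreteness the element is not below
  that successor.\<close>

lemma numeral_in_dichotomy: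
  "y \<in> N \<Longrightarrow> (\<exists>m\<le>n. numeral_in N lt m y) \<or> (\<exists>x. numeral_in N lt n x \<and> lt x y)"
proof (induction n)
  case 0
  obtain x where x: "zero_in N lt x" using numbers_zero by blast
  then have "x \<in> N" by (simp add: zero_in_def)
  with x show ?case using numbers_total[OF \<open>x \<in> N\<close> 0] 0 by (auto simp: zero_in_def)
next
  case (Suc n)
  from Suc.IH[OF Suc.prems] show ?case
  proof
    assume "\<exists>m\<le>n. numeral_in N lt m y"
    then show ?thesis using le_SucI by blast
  next
    assume "\<exists>x. numeral_in N lt n x \<and> lt x y"
    then obtain x where x: "numeral_in N lt n x" "lt x y" by blast
    have xN: "x \<in> N" using x(1) by (rule numeral_in_mem)
    then obtain z where z: "succ_in N lt x z" using numbers_succ[OF _ Suc.prems x(2)] by blast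
    then have zN: "z \<in> N" by (simp add: succ_in_def)
    have nz: "numeral_in N lt (Suc n) z" using x z xN by auto
    have "\<not> lt y z" using z x(2) Suc.prems by (auto simp: succ_in_def)
    with numbers_total[OF zN Suc.prems] nz show ?thesis by blast
  qed
qed

lemma numeral_in_less: "numeral_in N lt m x \<Longrightarrow> numeral_in N lt n y \<Longrightarrow> m < n \<Longrightarrow> lt x y"
proof (induction n arbitrary: y)
  case (Suc n)
  then obtain z where z: "succ_in N lt z y" "numeral_in N lt n z" by auto
  then have mem: "z \<in> N" "y \<in> N" "lt z y" "x \<in> N"
    using Suc.prems numeral_in_mem[of N lt m x] by (auto simp: succ_in_def)
  show ?case
  proof (cases "m = n")
    case True
    then show ?thesis using numeral_in_unique z mem Suc.prems by metis
  next
    case False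
    then have "lt x z" using Suc z by auto
    then show ?thesis using numbers_trans mem by blast
  qed
qed simp

lemma numeral_in_inj: "numeral_in N lt m x \<Longrightarrow> numeral_in N lt n x \<Longrightarrow> m = n"
  using numeral_in_less numbers_irrefl numeral_in_mem by (metis linorder_neqE_nat)

lemma succ_in_unique: "succ_in N lt x z \<Longrightarrow> succ_in N lt y z \<Longrightarrow> x = y"
  using numbers_total[of x y] unfolding succ_in_def by blast

lemma numeral_in_pred: "numeral_in N lt (Suc n) x \<Longrightarrow> succ_in N lt y x \<Longrightarrow> numeral_in N lt n y"
  using succ_in_unique by auto

lemma zero_not_succ: "zero_in N lt x \<Longrightarrow> \<not> succ_in N lt y x"
  by (auto simp: zero_in_def succ_in_def)

end

section \<open>Local justification of facts about evaluations\<close>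

primrec justified :: "'a set \<Rightarrow> ('a \<Rightarrow> 'a \<Rightarrow> bool) \<Rightarrow> (recf \<Rightarrow> 'a list \<Rightarrow> 'a \<Rightarrow> bool) \<Rightarrow>
    recf \<Rightarrow> 'a list \<Rightarrow> 'a \<Rightarrow> bool" where
  "justified N lt F Zero xs y \<longleftrightarrow> zero_in N lt y"
| "justified N lt F Succ xs y \<longleftrightarrow> length xs = 1 \<and> succ_in N lt (xs ! 0) y"
| "justified N lt F (Proj i) xs y \<longleftrightarrow> i < length xs \<and> y = xs ! i"
| "justified N lt F (Comp f gs) xs y \<longleftrightarrow> (\<exists>ys. length ys = length gs \<and> set ys \<subseteq> N \<and>
     (\<forall>i<length gs. F (gs ! i) xs (ys ! i)) \<and> F f ys y)"
| "justified N lt F (PrimRec f g) xs y \<longleftrightarrow> xs \<noteq> [] \<and> (zero_in N lt (hd xs) \<and> F f (tl xs) y \<or>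
     (\<exists>m\<in>N. succ_in N lt m (hd xs) \<and> (\<exists>w\<in>N. F (PrimRec f g) (m # tl xs) w \<and> F g (w # m # tl xs) y)))"
| "justified N lt F (Mu f) xs y \<longleftrightarrow> (\<exists>z\<in>N. zero_in N lt z \<and> F f (y # xs) z) \<and>
     (\<forall>m\<in>N. lt m y \<longrightarrow> (\<exists>w\<in>N. \<exists>w'\<in>N. succ_in N lt w w' \<and> F f (m # xs) w'))"

text \<open>An evaluation of \<open>h\<close> meets only finitely many pairs of program and argument
  count, so soundness for them can be a single formula. \<open>PrimRec\<close> passes one argument
  less to \<open>f\<close> and one more to \<open>g\<close>.\<close>

fun subprograms :: "recf \<Rightarrow> nat \<Rightarrow> (recf \<times> nat) set" where
  "subprograms (Comp f gs) l =
     insert (Comp f gs, l) ((\<Union>g\<in>set gs. subprograms g l) \<union> subprograms f (length gs))"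
| "subprograms (PrimRec f g) l =
     insert (PrimRec f g, l) (subprograms f (l - 1) \<union> subprograms g (l + 1))"
| "subprograms (Mu f) l = insert (Mu f, l) (subprograms f (l + 1))"
| "subprograms h l = {(h, l)}"

lemma finite_subprograms: "finite (subprograms h l)"
  by (induction h l rule: subprograms.induct) auto

lemma self_subprogram: "(h, l) \<in> subprograms h l"
  by (cases h) auto

text \<open>Each fact must follow from other facts by one evaluation rule read backwards. Facts that
  support each other in a circle are allowed.\<close>

definition sound :: "'a set \<Rightarrow> ('a \<Rightarrow> 'a \<Rightarrow> bool) \<Rightarrow> (recf \<Rightarrow> 'a list \<Rightarrow> 'a \<Rightarrow> bool) \<Rightarrow> (recf \<times> nat) set \<Rightarrow> bool" where
  "sound N lt F H \<longleftrightarrow> (\<forall>(h, l)\<in>H. \<forall>xs. length xs = l \<longrightarrow> set xs \<subseteq> N \<longrightarrow>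
     (\<forall>y\<in>N. F h xs y \<longrightarrow> justified N lt F h xs y))"

lemma sound_mono: "sound N lt F H \<Longrightarrow> H' \<subseteq> H \<Longrightarrow> sound N lt F H'"
  unfolding sound_def by blast

text \<open>The induction follows the true evaluation instead of the facts, so circular or
  nonstandard facts do no harm: the justification of a claim leads to claims about numerals that the
  true evaluation also visits.\<close>

lemma evals_sound:
  assumes num: "numbers N lt"
  shows "evals h ms n \<Longrightarrow> sound N lt F (subprograms h (length ms)) \<Longrightarrow>
    list_all2 (numeral_in N lt) ms xs \<Longrightarrow> y \<in> N \<Longrightarrow> F h xs y \<Longrightarrow> numeral_in N lt n y"
proof (induction h ms n arbitrary: xs y rule: evals.induct)
  have J: "justified N lt F h xs y" if "sound N lt F (subprograms h (length ms))"
    "list_all2 (numeral_in N lt) ms xs" "y \<in> N" "F h xs y" for h ms xs y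
  proof -
    have "set xs \<subseteq> N" using that(2) numeral_in_mem by (fastforce simp: list_all2_conv_all_nth in_set_conv_nth)
    moreover have "length xs = length ms" using that(2) by (simp add: list_all2_lengthD)
    ultimately show ?thesis using that self_subprogram[of h "length ms"] unfolding sound_def by blast
  qed
  {
    case (evals_Zero ms)
    from J[OF evals_Zero] show ?case by simp
  next
    case (evals_Succ x)
    from J[of Succ "[x]", OF _ evals_Succ(2-)] evals_Succ show ?case
      by (auto simp: list_all2_Cons1 intro: numeral_in_mem)
  next
    case (evals_Proj i ms)
    from J[OF evals_Proj(2-)] evals_Proj show ?case by (auto simp: list_all2_conv_all_nth)
  next
    case (evals_Comp ms gs ns f n)
    from J[OF evals_Comp.prems] obtain ys where ys: "length ys = length gs" "set ys \<subseteq> N"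
      "\<And>i. i < length gs \<Longrightarrow> F (gs ! i) xs (ys ! i)" "F f ys y" by auto
    have len: "length ns = length gs" using evals_Comp.IH(1) by (simp add: list_all2_lengthD)
    have "list_all2 (numeral_in N lt) ns ys"
    proof (rule list_all2_all_nthI)
      fix i assume i: "i < length ns"
      have "sound N lt F (subprograms (gs ! i) (length ms))"
        by (rule sound_mono[OF evals_Comp.prems(1)]) (use i len in auto)
      moreover have "ys ! i \<in> N" using ys(1,2) i len by (metis nth_mem subsetD)
      ultimately show "numeral_in N lt (ns ! i) (ys ! i)"
        using evals_Comp.IH(1) i len ys(3)[of i] evals_Comp.prems(2)
        by (auto simp: list_all2_conv_all_nth)
    qed (simp add: len ys)
    moreover have "sound N lt F (subprograms f (length ns))"
      by (rule sound_mono[OF evals_Comp.prems(1)]) (auto simp: len)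
    ultimately show ?case using evals_Comp.IH(2) ys(4) evals_Comp.prems(3) by blast
  next
    case (evals_PrimRec_0 f ms n g)
    from evals_PrimRec_0.prems(2) obtain x xs' where xs: "xs = x # xs'" "numeral_in N lt 0 x"
      "list_all2 (numeral_in N lt) ms xs'" by (auto simp: list_all2_Cons1)
    have "\<not> succ_in N lt m x" for m using xs(2) zero_not_succ[OF num] by simp
    then have "F f xs' y" using J[OF evals_PrimRec_0.prems] xs(1) by auto
    moreover have "sound N lt F (subprograms f (length ms))"
      by (rule sound_mono[OF evals_PrimRec_0.prems(1)]) auto
    ultimately show ?case using evals_PrimRec_0.IH xs(3) evals_PrimRec_0.prems(3) by blast
  next
    case (evals_PrimRec_Suc f g n ms w z)
    from evals_PrimRec_Suc.prems(2) obtain x xs' where xs: "xs = x # xs'" "numeral_in N lt (Suc n) x"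
      "list_all2 (numeral_in N lt) ms xs'" by (auto simp: list_all2_Cons1 simp del: numeral_in.simps)
    have "\<not> zero_in N lt x" using xs(2) zero_not_succ[OF num] by auto
    then obtain m w' where m: "succ_in N lt m x" "F (PrimRec f g) (m # xs') w'"
      "F g (w' # m # xs') y" "w' \<in> N" using J[OF evals_PrimRec_Suc.prems] xs(1) by auto
    have nm: "numeral_in N lt n m" using numeral_in_pred[OF num xs(2) m(1)] .
    have 1: "numeral_in N lt w w'"
      by (rule evals_PrimRec_Suc.IH(1)[OF _ _ m(4) m(2)]) (use evals_PrimRec_Suc.prems(1) nm xs(3) in auto)
    have "sound N lt F (subprograms g (length (w # n # ms)))"
      by (rule sound_mono[OF evals_PrimRec_Suc.prems(1)]) auto
    then show ?case
      by (rule evals_PrimRec_Suc.IH(2)[OF _ _ evals_PrimRec_Suc.prems(3) m(3)]) (use 1 nm xs(3) in auto)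
  next
    case (evals_Mu f n ms)
    have s: "sound N lt F (subprograms f (length (m # ms)))" for m
      by (rule sound_mono[OF evals_Mu.prems(1)]) auto
    from J[OF evals_Mu.prems] obtain z where z: "zero_in N lt z" "F f (y # xs) z" "z \<in> N"
      and sm: "\<And>m. m \<in> N \<Longrightarrow> lt m y \<Longrightarrow> \<exists>w\<in>N. \<exists>w'\<in>N. succ_in N lt w w' \<and> F f (m # xs) w'" by auto
    \<comment> \<open>A value claimed below the true minimum contradicts the positive value computed
      there. One claimed beyond it needs a positive value at the true minimum, where the computed
      value is 0.\<close>
    from numeral_in_dichotomy[OF num evals_Mu.prems(3), of n]
    consider m where "m < n" "numeral_in N lt m y" | "numeral_in N lt n y"
      | x where "numeral_in N lt n x" "lt x y" by (metis le_neq_implies_less)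
    then show ?case
    proof cases
      case (1 m)
      with evals_Mu.IH(2) obtain k where k: "\<And>xs y. sound N lt F (subprograms f (length (m # ms))) \<Longrightarrow>
         list_all2 (numeral_in N lt) (m # ms) xs \<Longrightarrow> y \<in> N \<Longrightarrow> F f xs y \<Longrightarrow> numeral_in N lt (Suc k) y" by blast
      have "numeral_in N lt (Suc k) z" by (rule k[OF s _ z(3,2)]) (use 1 evals_Mu.prems(2) in simp)
      then show ?thesis using z(1) numeral_in_inj[OF num, of 0 z "Suc k"] by simp
    next
      case (3 x)
      then have "x \<in> N" using numeral_in_mem by metis
      with sm 3 obtain w w' where w: "w' \<in> N" "succ_in N lt w w'" "F f (x # xs) w'" by blast
      have "numeral_in N lt 0 w'"
        by (rule evals_Mu.IH(1)[OF s _ w(1,3)]) (use 3 evals_Mu.prems(2) in simp)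
      then show ?thesis using zero_not_succ[OF num] w(2) by auto
    qed
  }
qed

section \<open>Programs computing codes of sentences\<close>

lemma evals_Comp1: "evals g xs a \<Longrightarrow> evals f [a] z \<Longrightarrow> evals (Comp f [g]) xs z"
  by (rule evals_Comp[of _ _ "[a]"]) auto

lemma evals_Comp2: "evals g xs a \<Longrightarrow> evals h xs b \<Longrightarrow> evals f [a, b] z \<Longrightarrow> evals (Comp f [g, h]) xs z"
  by (rule evals_Comp[of _ _ "[a, b]"]) auto

lemma evals_Proj_0: "evals (Proj 0) (x # xs) x"
  using evals_Proj[of 0 "x # xs"] by simp

lemma evals_Proj_1: "evals (Proj 1) (x # y # xs) y"
  using evals_Proj[of 1 "x # y # xs"] by simp

primrec r_const :: "nat \<Rightarrow> recf" where
  "r_const 0 = Zero"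
| "r_const (Suc c) = Comp Succ [r_const c]"

lemma evals_const: "evals (r_const c) xs c"
  by (induction c) (auto intro: evals_Zero evals_Comp1 evals_Succ)

primrec r_plus :: "nat \<Rightarrow> recf" where
  "r_plus 0 = Proj 0"
| "r_plus (Suc c) = Comp Succ [r_plus c]"

lemma evals_plus: "evals (r_plus c) (x # xs) (x + c)"
  by (induction c) (auto intro: evals_Proj_0 evals_Comp1 evals_Succ)

definition r_add :: recf where "r_add = PrimRec (Proj 0) (r_plus 1)"

lemma evals_add: "evals r_add [m, n] (m + n)"
  unfolding r_add_def
proof (induction m)
  case 0
  show ?case by (rule evals_PrimRec_0) (simp add: evals_Proj_0)
next
  case (Suc m)
  from evals_PrimRec_Suc[OF Suc evals_plus] show ?case by simp
qed

definition r_five :: recf where "r_five = PrimRec Zero (r_plus 5)"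

lemma evals_five: "evals r_five [n] (5 * n)"
  unfolding r_five_def
proof (induction n)
  case 0
  show ?case by (rule evals_PrimRec_0) (simp add: evals_Zero)
next
  case (Suc n)
  from evals_PrimRec_Suc[OF Suc evals_plus] show ?case by (simp add: add.commute)
qed

definition r_triangle :: recf where
  "r_triangle = PrimRec Zero (Comp r_add [Proj 0, Comp (r_plus 1) [Proj 1]])"

lemma evals_triangle: "evals r_triangle [n] (triangle n)"
  unfolding r_triangle_def
proof (induction n)
  case 0
  show ?case by (rule evals_PrimRec_0) (simp add: evals_Zero)
next
  case (Suc n)
  have "evals (Comp r_add [Proj 0, Comp (r_plus 1) [Proj 1]]) [triangle n, n] (triangle n + (n + 1))"
    by (rule evals_Comp2[OF evals_Proj_0 evals_Comp1[OF evals_Proj_1 evals_plus] evals_add])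
  from evals_PrimRec_Suc[OF Suc this] show ?case by simp
qed

text \<open>The pairing function followed by the tag \<open>t\<close> of a constructor: 3 for
  \<open>Conj\<close>, 4 for \<open>Ex\<close>.\<close>

definition r_node :: "nat \<Rightarrow> recf" where
  "r_node t = Comp (r_plus t) [Comp r_five [Comp r_add [Comp r_triangle [r_add], Proj 0]]]"

lemma evals_node: "evals (r_node t) [a, b] (5 * prod_encode (a, b) + t)"
  unfolding r_node_def prod_encode_def prod.case
  by (rule evals_Comp1[OF evals_Comp1[OF evals_Comp2[OF evals_Comp1[OF evals_add evals_triangle]
      evals_Proj_0 evals_add] evals_five] evals_plus])

text \<open>States that variable 0 is the n-th numeral, recycling variables 0 and 1. Without
  substitution or fresh variables, its code arises by iterating one fixed operation.\<close>

primrec numeral_fm :: "fm \<Rightarrow> fm \<Rightarrow> nat \<Rightarrow> fm" where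
  "numeral_fm z s 0 = z"
| "numeral_fm z s (Suc n) = Ex 1 (Conj s (Ex 0 (Conj (Eq 0 1) (numeral_fm z s n))))"

definition r_numeral :: "fm \<Rightarrow> fm \<Rightarrow> recf" where
  "r_numeral z s = PrimRec (r_const (fm_code z))
     (Comp (r_node 4) [r_const 1, Comp (r_node 3) [r_const (fm_code s),
        Comp (r_node 4) [r_const 0, Comp (r_node 3) [r_const (fm_code (Eq 0 1)), Proj 0]]]])"

lemma evals_numeral: "evals (r_numeral z s) [n] (fm_code (numeral_fm z s n))"
  unfolding r_numeral_def
proof (induction n)
  case 0
  show ?case by (rule evals_PrimRec_0) (simp add: evals_const)
next
  case (Suc n)
  show ?case unfolding numeral_fm.simps fm_code.simps(4,5)
    by (rule evals_PrimRec_Suc[OF Suc]) (rule evals_Comp2[OF evals_const evals_Comp2[OF evals_const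
        evals_Comp2[OF evals_const evals_Comp2[OF evals_const evals_Proj_0 evals_node] evals_node]
        evals_node] evals_node])
qed

primrec ex_closure :: "nat \<Rightarrow> fm \<Rightarrow> fm" where
  "ex_closure 0 p = p"
| "ex_closure (Suc i) p = Ex i (ex_closure i p)"

definition r_closure :: recf where
  "r_closure = PrimRec (Proj 0) (Comp (r_node 4) [Proj 1, Proj 0])"

lemma evals_closure: "evals r_closure [n, fm_code p] (fm_code (ex_closure n p))"
  unfolding r_closure_def
proof (induction n)
  case 0
  show ?case by (rule evals_PrimRec_0) (simp add: evals_Proj_0)
next
  case (Suc n)
  show ?case unfolding ex_closure.simps fm_code.simps(5)
    by (rule evals_PrimRec_Suc[OF Suc]) (rule evals_Comp2[OF evals_Proj_1 evals_Proj_0 evals_node])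
qed

text \<open>Variables of \<open>p\<close> are bounded by its code, so the code also tells how many quantifiers close the formula.\<close>

definition diagonal :: "fm \<Rightarrow> fm \<Rightarrow> nat \<Rightarrow> fm \<Rightarrow> fm" where
  "diagonal z s k p = Neg (ex_closure (fm_code p + k) (Conj (numeral_fm z s (fm_code p)) p))"

definition r_diagonal :: "fm \<Rightarrow> fm \<Rightarrow> nat \<Rightarrow> recf" where
  "r_diagonal z s k = Comp (r_plus 2) [Comp r_five [Comp r_closure
     [r_plus k, Comp (r_node 3) [r_numeral z s, Proj 0]]]]"

lemma evals_diagonal: "evals (r_diagonal z s k) [fm_code p] (fm_code (diagonal z s k p))"
proof -
  have "evals (Comp (r_node 3) [r_numeral z s, Proj 0]) [fm_code p]
      (fm_code (Conj (numeral_fm z s (fm_code p)) p))"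
    unfolding fm_code.simps by (rule evals_Comp2[OF evals_numeral evals_Proj_0 evals_node])
  then show ?thesis unfolding r_diagonal_def diagonal_def fm_code.simps(3)
    by (rule evals_Comp1[OF evals_Comp1[OF evals_Comp2[OF evals_plus _ evals_closure] evals_five] evals_plus])
qed

section \<open>Closing a formula by quantifiers\<close>

lemma free_vars_le_code: "i \<in> free_vars p \<Longrightarrow> i \<le> fm_code p"
proof (induction p)
  case (Conj p q)
  then show ?case
    using le_prod_encode_1[of "fm_code p" "fm_code q"] le_prod_encode_2[of "fm_code q" "fm_code p"] by auto
next
  case (Ex j p)
  then show ?case using le_prod_encode_2[of "fm_code p" j] by auto
next
  case (Le j k)
  then show ?case using le_prod_encode_1[of j k] le_prod_encode_2[of k j] by auto
next
  case (Eq j k)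
  then show ?case using le_prod_encode_1[of j k] le_prod_encode_2[of k j] by auto
qed auto

lemma free_vars_ex_closure: "free_vars (ex_closure n p) = free_vars p - {..<n}"
proof (induction n)
  case (Suc n)
  have "free_vars (ex_closure (Suc n) p) = (free_vars p - {..<n}) - {n}"
    by (simp only: ex_closure.simps free_vars.simps Suc)
  also have "\<dots> = free_vars p - {..<Suc n}"
    unfolding lessThan_Suc by blast
  finally show ?case .
qed simp

lemma free_vars_numeral_fm: "free_vars (numeral_fm z s n) \<subseteq> free_vars z \<union> free_vars s \<union> {0, 1}"
  by (induction n) auto

lemma sat_ex_closure:
  assumes "range v \<subseteq> M"
  shows "sat M le v (ex_closure n p) \<longleftrightarrow>
    (\<exists>w. range w \<subseteq> M \<and> (\<forall>i\<ge>n. w i = v i) \<and> sat M le w p)"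
  using assms
proof (induction n arbitrary: v)
  case 0
  then show ?case by (auto simp: fun_eq_iff[symmetric])
next
  case (Suc n)
  have "sat M le v (ex_closure (Suc n) p) \<longleftrightarrow> (\<exists>a\<in>M. sat M le (v(n := a)) (ex_closure n p))" by simp
  also have "\<dots> \<longleftrightarrow> (\<exists>a\<in>M. \<exists>w. range w \<subseteq> M \<and> (\<forall>i\<ge>n. w i = (v(n := a)) i) \<and> sat M le w p)"
    by (intro bex_cong refl Suc.IH) (use Suc.prems in auto)
  also have "\<dots> \<longleftrightarrow> (\<exists>w. range w \<subseteq> M \<and> (\<forall>i\<ge>Suc n. w i = v i) \<and> sat M le w p)"
    (is "?L \<longleftrightarrow> ?R")
  proof
    assume ?L
    then show ?R by (metis Suc_leD fun_upd_other not_less_eq_eq order_refl)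
  next
    assume ?R
    then obtain w where w: "range w \<subseteq> M" "\<forall>i\<ge>Suc n. w i = v i" "sat M le w p" by blast
    have "w n \<in> M" using w(1) by auto
    moreover have "\<forall>i\<ge>n. w i = (v(n := w n)) i" using w(2) by (auto simp: Suc_le_eq)
    ultimately show ?L using w by blast
  qed
  finally show ?case .
qed

lemma sentence_in_theory:
  assumes "free_vars p \<subseteq> {..<n}" "M \<noteq> {}"
  shows "Neg (ex_closure n p) \<in> fo_theory M le \<longleftrightarrow> \<not> (\<exists>w. range w \<subseteq> M \<and> sat M le w p)"
proof -
  have fv: "free_vars (Neg (ex_closure n p)) = {}" using assms by (auto simp: free_vars_ex_closure)
  have "sat M le v (ex_closure n p) \<longleftrightarrow> (\<exists>w. range w \<subseteq> M \<and> sat M le w p)" if v: "range v \<subseteq> M" for v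
  proof
    assume "\<exists>w. range w \<subseteq> M \<and> sat M le w p"
    then obtain w where w: "range w \<subseteq> M" "sat M le w p" by blast
    let ?w = "\<lambda>i. if i < n then w i else v i"
    have "sat M le ?w p \<longleftrightarrow> sat M le w p" by (rule sat_cong) (use assms in auto)
    moreover have "range ?w \<subseteq> M" using w v by auto
    ultimately show "sat M le v (ex_closure n p)" using w unfolding sat_ex_closure[OF v]
      by (intro exI[of _ ?w]) auto
  qed (auto simp: sat_ex_closure[OF v])
  moreover from assms obtain x where "x \<in> M" by blast
  then have "range (\<lambda>_::nat. x) \<subseteq> M" by auto
  ultimately show ?thesis unfolding fo_theory_def using fv by fastforce
qed

section \<open>Finite justified sets of true facts\<close>

definition justified_set :: "(recf \<times> nat list \<times> nat) set \<Rightarrow> bool" where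
  "justified_set S \<longleftrightarrow> (\<forall>(h, ms, n)\<in>S. justified UNIV (<) (\<lambda>h ms n. (h, ms, n) \<in> S) h ms n)"

text \<open>Facts occur only positively in a justification, so further facts never destroy one.
  Justified sets can therefore be united.\<close>

lemma justified_mono:
  assumes "justified N lt F h xs y" "\<And>h xs y. F h xs y \<Longrightarrow> F' h xs y"
  shows "justified N lt F' h xs y"
  using assms by (cases h) (simp_all, (blast | meson)+)

lemma justified_set_Union: "(\<And>i. i \<in> I \<Longrightarrow> justified_set (S i)) \<Longrightarrow> justified_set (\<Union>i\<in>I. S i)"
  unfolding justified_set_def
  by (clarsimp, rule justified_mono, fast, blast)

lemma justified_set_Un: "justified_set S \<Longrightarrow> justified_set T \<Longrightarrow> justified_set (S \<union> T)"
  using justified_set_Union[of UNIV "\<lambda>b. if b then S else T"] by (auto simp: UNIV_bool Un_commute)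

lemma justified_set_insert:
  assumes "justified_set S" "justified UNIV (<) (\<lambda>h ms n. (h, ms, n) \<in> S) h ms n"
  shows "justified_set (insert (h, ms, n) S)"
  using assms unfolding justified_set_def
  by (auto intro: justified_mono[of _ _ "\<lambda>h ms n. (h, ms, n) \<in> S"])

lemma zero_in_nat: "zero_in UNIV (<) (n::nat) \<longleftrightarrow> n = 0"
  by (auto simp: zero_in_def)

lemma succ_in_nat: "succ_in UNIV (<) (m::nat) n \<longleftrightarrow> n = Suc m"
proof
  assume "succ_in UNIV (<) m n"
  then have "m < n" "\<not> Suc m < n" by (auto simp: succ_in_def)
  then show "n = Suc m" by simp
qed (auto simp: succ_in_def)

text \<open>The facts behind one evaluation are finite in number because minimisation inspects no
  argument beyond its value.\<close>

lemma evals_justified: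
  "evals h ms n \<Longrightarrow> \<exists>S. finite S \<and> justified_set S \<and> (h, ms, n) \<in> S"
proof (induction h ms n rule: evals.induct)
  have ins: "\<exists>S. finite S \<and> justified_set S \<and> (h, ms, n) \<in> S"
    if "finite S" "justified_set S" "justified UNIV (<) (\<lambda>h ms n. (h, ms, n) \<in> S) h ms n" for S h ms n
    using justified_set_insert[OF that(2,3)] that(1) by (intro exI[of _ "insert (h, ms, n) S"]) auto
  have emp: "justified_set {}" by (simp add: justified_set_def)
  {
    case (evals_Zero xs)
    show ?case by (rule ins[OF finite.emptyI emp]) (simp add: zero_in_nat)
  next
    case (evals_Succ x)
    show ?case by (rule ins[OF finite.emptyI emp]) (simp add: succ_in_nat)
  next
    case (evals_Proj i xs)
    then show ?case by (intro ins[OF finite.emptyI emp]) simp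
  next
    case (evals_Comp xs gs ys f z)
    then obtain S where S: "finite S" "justified_set S" "(f, ys, z) \<in> S" by blast
    have len: "length ys = length gs" using evals_Comp.IH(1) by (simp add: list_all2_lengthD)
    have "\<forall>i<length gs. \<exists>S. finite S \<and> justified_set S \<and> (gs ! i, xs, ys ! i) \<in> S"
      using evals_Comp.IH(1) by (auto simp: list_all2_conv_all_nth)
    then obtain T where T: "\<And>i. i < length gs \<Longrightarrow> finite (T i) \<and> justified_set (T i) \<and> (gs ! i, xs, ys ! i) \<in> T i"
      by metis
    show ?case
    proof (rule ins)
      show "finite ((\<Union>i\<in>{..<length gs}. T i) \<union> S)" using S T by auto
      show "justified_set ((\<Union>i\<in>{..<length gs}. T i) \<union> S)"
        using S T by (intro justified_set_Un justified_set_Union) auto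
      show "justified UNIV (<) (\<lambda>h ms n. (h, ms, n) \<in> (\<Union>i\<in>{..<length gs}. T i) \<union> S) (Comp f gs) xs z"
        using S T len by (auto intro!: exI[of _ ys])
    qed
  next
    case (evals_PrimRec_0 f xs z g)
    then obtain S where "finite S" "justified_set S" "(f, xs, z) \<in> S" by blast
    then show ?case by (intro ins[of S]) (auto simp: zero_in_nat)
  next
    case (evals_PrimRec_Suc f g n xs y z)
    then obtain S T where S: "finite S" "justified_set S" "(PrimRec f g, n # xs, y) \<in> S"
      "finite T" "justified_set T" "(g, y # n # xs, z) \<in> T" by blast
    then show ?case by (intro ins[of "S \<union> T"]) (auto simp: succ_in_nat intro: justified_set_Un)
  next
    case (evals_Mu f n xs)
    then obtain S where S: "finite S" "justified_set S" "(f, n # xs, 0) \<in> S" by blast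
    from evals_Mu.IH(2) have "\<forall>m<n. \<exists>y S. finite S \<and> justified_set S \<and> (f, m # xs, Suc y) \<in> S" by blast
    then obtain y T where T: "\<And>m. m < n \<Longrightarrow> finite (T m) \<and> justified_set (T m) \<and> (f, m # xs, Suc (y m)) \<in> T m"
      by metis
    define U where "U = (\<Union>i\<in>{..<n}. T i) \<union> S"
    show ?case
    proof (rule ins)
      show "finite U" using S T by (auto simp: U_def)
      show "justified_set U"
        unfolding U_def using S T by (intro justified_set_Un justified_set_Union) auto
      have "(f, m # xs, Suc (y m)) \<in> U" if "m < n" for m using T that unfolding U_def by blast
      moreover have "(f, n # xs, 0) \<in> U" using S(3) by (simp add: U_def)
      ultimately show "justified UNIV (<) (\<lambda>h ms n. (h, ms, n) \<in> U) (Mu f) xs n"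
        by (auto simp: succ_in_nat zero_in_nat)
    qed
  }
qed

section \<open>Coding computations in a partial order\<close>

instance recf :: countable
  by countable_datatype

text \<open>Each program has a separate relation for each argument count; \<open>Suc\<close> keeps
  the number 0 free.\<close>

definition key :: "recf \<Rightarrow> nat \<Rightarrow> nat" where
  "key h l = Suc (to_nat (h, l))"

section \<open>Copies of initial segments of the natural numbers\<close>

context
  fixes N :: "'a set" and lt :: "'a \<Rightarrow> 'a \<Rightarrow> bool" and u :: "nat \<Rightarrow> 'a" and b :: nat
  assumes N: "N = u ` {..<b}" and lt: "\<And>i j. i < b \<Longrightarrow> j < b \<Longrightarrow> lt (u i) (u j) \<longleftrightarrow> i < j"
begin

lemma zero_in_initial: "i < b \<Longrightarrow> zero_in N lt (u i) \<longleftrightarrow> i = 0"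
  using lt by (auto simp: zero_in_def N)

lemma succ_in_initial: "i < b \<Longrightarrow> j < b \<Longrightarrow> succ_in N lt (u i) (u j) \<longleftrightarrow> j = Suc i"
proof
  assume ij: "i < b" "j < b" and s: "succ_in N lt (u i) (u j)"
  then have "i < j" using lt by (simp add: succ_in_def)
  then have "\<not> (i < Suc i \<and> Suc i < j)" using s ij lt by (auto simp: succ_in_def N)
  with \<open>i < j\<close> show "j = Suc i" by simp
qed (use lt in \<open>auto simp: succ_in_def N\<close>)

lemma numeral_in_initial: "n < b \<Longrightarrow> numeral_in N lt n (u n)"
proof (induction n)
  case (Suc n)
  then have "succ_in N lt (u n) (u (Suc n))" "u n \<in> N" "numeral_in N lt n (u n)"
    by (simp_all add: succ_in_initial) (simp add: N)
  then show ?case by auto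
qed (simp add: zero_in_initial)

lemma numbers_initial: "b > 0 \<Longrightarrow> numbers N lt"
  unfolding numbers_def
proof (intro conjI ballI impI)
  fix x y assume "x \<in> N" "y \<in> N" "lt x y"
  then obtain i j where "x = u i" "y = u j" "i < j" "j < b" using lt by (auto simp: N)
  then have "succ_in N lt x (u (Suc i))" "u (Suc i) \<in> N" by (simp_all add: succ_in_initial) (simp add: N)
  then show "\<exists>z\<in>N. succ_in N lt x z" by blast
next
  fix x y assume "x \<in> N" "y \<in> N"
  then obtain i j where "x = u i" "y = u j" "i < b" "j < b" by (auto simp: N)
  then show "lt x y \<or> x = y \<or> lt y x" using lt by (cases i j rule: linorder_cases) auto
next
  assume "b > 0"
  then have "zero_in N lt (u 0)" "u 0 \<in> N" by (simp_all add: zero_in_initial) (simp add: N)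
  then show "\<exists>x\<in>N. zero_in N lt x" by blast
qed (use lt in \<open>auto simp: N\<close>)

text \<open>All witnesses occur in \<open>S\<close> or are predecessors or smaller numbers, so they
  lie below \<open>b\<close>; there \<open>u\<close> preserves zero, successor and order.\<close>

lemma justified_transfer:
  assumes S: "\<And>h ms n. (h, ms, n) \<in> S \<Longrightarrow> set ms \<subseteq> {..<b} \<and> n < b"
    and F: "\<And>h ms n. (h, ms, n) \<in> S \<Longrightarrow> F h (map u ms) (u n)"
    and j: "justified UNIV (<) (\<lambda>h ms n. (h, ms, n) \<in> S) h ms n"
    and b: "set ms \<subseteq> {..<b}" "n < b"
  shows "justified N lt F h (map u ms) (u n)"
proof (cases h)
  case Zero
  with j b show ?thesis by (simp add: zero_in_nat zero_in_initial)
next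
  case Succ
  with j obtain m where "ms = [m]" "n = Suc m" by (auto simp: succ_in_nat length_Suc_conv)
  with Succ b show ?thesis by (simp add: succ_in_initial)
next
  case (Proj i)
  with j show ?thesis by simp
next
  case (Comp f gs)
  with j obtain ys where ys: "length ys = length gs" "\<And>i. i < length gs \<Longrightarrow> (gs ! i, ms, ys ! i) \<in> S"
    "(f, ys, n) \<in> S" by auto
  have "set (map u ys) \<subseteq> N" using S[OF ys(3)] by (auto simp: N)
  moreover have "F f (map u ys) (u n)" using ys by (intro F)
  moreover have "\<forall>i<length gs. F (gs ! i) (map u ms) (map u ys ! i)" using ys F by simp
  ultimately show ?thesis unfolding Comp justified.simps using ys(1)
    by (intro exI[of _ "map u ys"]) simp
next
  case (PrimRec f g)
  with j have "ms \<noteq> []" by simp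
  then obtain k ks where ms: "ms = k # ks" by (cases ms) auto
  from j[unfolded PrimRec ms] consider "k = 0" "(f, ks, n) \<in> S"
    | m w where "k = Suc m" "(PrimRec f g, m # ks, w) \<in> S" "(g, w # m # ks, n) \<in> S"
    by (auto simp: zero_in_nat succ_in_nat)
  then show ?thesis
  proof cases
    case 1
    then show ?thesis using F[OF 1(2)] b unfolding PrimRec ms by (simp add: zero_in_initial)
  next
    case (2 m w)
    have "w < b" using S[OF 2(2)] by simp
    moreover have "succ_in N lt (u m) (u k)" using 2(1) b ms by (simp add: succ_in_initial)
    ultimately have "\<exists>m'\<in>N. succ_in N lt m' (u k) \<and> (\<exists>w'\<in>N. F (PrimRec f g) (m' # map u ks) w' \<and>
        F g (w' # m' # map u ks) (u n))"
      using F[OF 2(2)] F[OF 2(3)] 2(1) b ms by (intro bexI[of _ "u m"] conjI bexI[of _ "u w"]) (auto simp: N)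
    then show ?thesis unfolding PrimRec ms by simp
  qed
next
  case (Mu f)
  from j have 0: "(f, n # ms, 0) \<in> S" and sm: "\<And>m. m < n \<Longrightarrow> \<exists>w. (f, m # ms, Suc w) \<in> S"
    unfolding Mu by (auto simp: zero_in_nat succ_in_nat)
  have "0 < b" using b by simp
  then have "\<exists>z\<in>N. zero_in N lt z \<and> F f (u n # map u ms) z"
    using F[OF 0] zero_in_initial[of 0] by (intro bexI[of _ "u 0"]) (simp_all add: N)
  moreover have "\<exists>w\<in>N. \<exists>w'\<in>N. succ_in N lt w w' \<and> F f (m' # map u ms) w'"
    if m': "m' \<in> N" "lt m' (u n)" for m'
  proof -
    from m' b lt obtain m where m: "m' = u m" "m < n" by (auto simp: N)
    from sm[OF m(2)] obtain w where w: "(f, m # ms, Suc w) \<in> S" by blast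
    have "Suc w < b" using S[OF w] by simp
    then have "succ_in N lt (u w) (u (Suc w))" "u w \<in> N" "u (Suc w) \<in> N"
      by (simp_all add: succ_in_initial) (simp_all add: N)
    moreover have "F f (m' # map u ms) (u (Suc w))" using F[OF w] m(1) by simp
    ultimately show ?thesis by blast
  qed
  ultimately show ?thesis unfolding Mu by simp
qed

end

section \<open>Orders that code all finite graphs\<close>

definition codes_graph :: "'a set \<Rightarrow> ('a \<Rightarrow> 'a \<Rightarrow> bool) \<Rightarrow> nat \<Rightarrow> 'a \<Rightarrow> (nat \<Rightarrow> 'a) \<Rightarrow> (nat \<times> nat) list \<Rightarrow> 'a \<Rightarrow> bool" where
  "codes_graph M le n q u ps d \<longleftrightarrow>
     (\<forall>i<n. \<forall>j<n. linked M le q d (u i) (u j) \<longleftrightarrow> (\<exists>(k, l)\<in>set ps. {i, j} \<subseteq> {k, l}))"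

definition codes_graphs :: "'a set \<Rightarrow> ('a \<Rightarrow> 'a \<Rightarrow> bool) \<Rightarrow> nat \<Rightarrow> 'a \<Rightarrow> 'a \<Rightarrow> (nat \<Rightarrow> 'a) \<Rightarrow> bool" where
  "codes_graphs M le n q a u \<longleftrightarrow> inj_on u {..<n} \<and> {x \<in> M. node_like M le q a x} = u ` {..<n} \<and>
     (\<forall>ps. set ps \<subseteq> {..<n} \<times> {..<n} \<longrightarrow> (\<exists>d\<in>M. codes_graph M le n q u ps d))"

text \<open>The parameters q and a may vary with n, since the diagonal sentence quantifies over them
  together with the codes of graphs.\<close>

definition rich :: "'a set \<Rightarrow> ('a \<Rightarrow> 'a \<Rightarrow> bool) \<Rightarrow> bool" where
  "rich M le \<longleftrightarrow> (\<forall>n>0. \<exists>q\<in>M. \<exists>a\<in>M. \<exists>u. codes_graphs M le n q a u)"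

context
  fixes M :: "'a set" and le :: "'a \<Rightarrow> 'a \<Rightarrow> bool"
begin

text \<open>Layout of an assignment: \<open>0\<close> and \<open>1\<close> are object variables, \<open>2\<close> is \<open>core\<close>, \<open>3\<close> the forest of all vertices, \<open>4\<close>
  marks the vertices that are numbers, \<open>5 + 2 * i\<close> is the graph joining a tuple to its \<open>i\<close>-th entry, and
  \<open>6 + 2 * k\<close> marks the tuples in relation \<open>k\<close>. Relation \<open>0\<close> is the order of the numbers; the result
  of a fact comes before its arguments.\<close>

definition Num :: "(nat \<Rightarrow> 'a) \<Rightarrow> 'a set" where
  "Num v = {x \<in> M. node_like M le (v 2) (v 3) x \<and> linked M le (v 2) (v 4) x x}"

text \<open>Only the first \<open>length ys\<close> entries of a tuple are inspected, so each
  relation has to be used with one fixed arity.\<close>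

definition Rel :: "(nat \<Rightarrow> 'a) \<Rightarrow> nat \<Rightarrow> 'a list \<Rightarrow> bool" where
  "Rel v k ys \<longleftrightarrow> (\<exists>t\<in>M. node_like M le (v 2) (v 3) t \<and> linked M le (v 2) (v (6 + 2 * k)) t t \<and>
     (\<forall>i<length ys. linked M le (v 2) (v (5 + 2 * i)) t (ys ! i)))"

definition Less :: "(nat \<Rightarrow> 'a) \<Rightarrow> 'a \<Rightarrow> 'a \<Rightarrow> bool" where
  "Less v x y \<longleftrightarrow> Rel v 0 [x, y]"

definition Fact :: "(nat \<Rightarrow> 'a) \<Rightarrow> recf \<Rightarrow> 'a list \<Rightarrow> 'a \<Rightarrow> bool" where
  "Fact v h xs y \<longleftrightarrow> Rel v (key h (length xs)) (y # xs)"

abbreviation "dfn \<equiv> definable M le"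

section \<open>Definability of the coded relations\<close>

lemma dfn_mem: "dfn (\<lambda>v. v i \<in> M)"
  unfolding definable_def by (intro exI[of _ "Eq i i"]) auto

lemmas dfn_intros = definable_conj definable_disj definable_imp definable_not definable_ex
  definable_all definable_le definable_eq

lemma dfn_tree_like: "dfn (\<lambda>v. tree_like M le (v a) (v b))"
  unfolding tree_like_def by (intro dfn_intros)

lemma dfn_node_like: "dfn (\<lambda>v. node_like M le (v a) (v b) (v c))"
  unfolding node_like_def by (intro dfn_intros dfn_tree_like)

lemma dfn_linked: "dfn (\<lambda>v. linked M le (v a) (v b) (v c) (v d))"
  unfolding linked_def by (intro dfn_intros dfn_tree_like)

text \<open>Each quantifier crossed shifts the parameters; the arbitrary reindexing \<open>r\<close>
  covers all such shifts at once.\<close>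

lemma dfn_Num: "dfn (\<lambda>v. v a \<in> Num (\<lambda>i. v (r i)))"
  unfolding Num_def mem_Collect_eq by (intro dfn_intros dfn_mem dfn_node_like dfn_linked)

lemma dfn_all_Num:
  assumes "dfn (\<lambda>v. Q (v 0) (\<lambda>i. v (Suc i)))"
  shows "dfn (\<lambda>v. \<forall>x\<in>Num (\<lambda>i. v (r i)). Q x v)"
proof -
  have "dfn (\<lambda>v. \<forall>x\<in>M. x \<in> Num (\<lambda>i. v (r i)) \<longrightarrow> Q x v)"
    by (intro definable_all definable_imp dfn_Num assms)
  moreover have "(\<forall>x\<in>M. x \<in> Num (\<lambda>i. v (r i)) \<longrightarrow> Q x v) \<longleftrightarrow> (\<forall>x\<in>Num (\<lambda>i. v (r i)). Q x v)" for v
    by (auto simp: Num_def)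
  ultimately show ?thesis by simp
qed

lemma dfn_ex_Num:
  assumes "dfn (\<lambda>v. Q (v 0) (\<lambda>i. v (Suc i)))"
  shows "dfn (\<lambda>v. \<exists>x\<in>Num (\<lambda>i. v (r i)). Q x v)"
proof -
  have "dfn (\<lambda>v. \<exists>x\<in>M. x \<in> Num (\<lambda>i. v (r i)) \<and> Q x v)"
    by (intro definable_ex definable_conj dfn_Num assms)
  moreover have "(\<exists>x\<in>M. x \<in> Num (\<lambda>i. v (r i)) \<and> Q x v) \<longleftrightarrow> (\<exists>x\<in>Num (\<lambda>i. v (r i)). Q x v)" for v
    by (auto simp: Num_def)
  ultimately show ?thesis by simp
qed

lemma dfn_Rel: "dfn (\<lambda>v. Rel (\<lambda>i. v (r i)) k (map v js))"
proof -
  have "dfn (\<lambda>v. \<exists>t\<in>M. node_like M le (v (r 2)) (v (r 3)) t \<and>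
      linked M le (v (r 2)) (v (r (6 + 2 * k))) t t \<and>
      (\<forall>i<length js. linked M le (v (r 2)) (v (r (5 + 2 * i))) t (v (js ! i))))"
    by (intro definable_ex definable_conj dfn_node_like dfn_linked definable_all_less)
  moreover have "Rel (\<lambda>i. v (r i)) k (map v js) \<longleftrightarrow> (\<exists>t\<in>M. node_like M le (v (r 2)) (v (r 3)) t \<and>
      linked M le (v (r 2)) (v (r (6 + 2 * k))) t t \<and>
      (\<forall>i<length js. linked M le (v (r 2)) (v (r (5 + 2 * i))) t (v (js ! i))))" for v
    unfolding Rel_def by (intro bex_cong refl conj_cong) simp
  ultimately show ?thesis by simp
qed

lemma dfn_Less: "dfn (\<lambda>v. Less (\<lambda>i. v (r i)) (v a) (v b))"
  using dfn_Rel[of r 0 "[a, b]"] by (simp add: Less_def)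

lemma dfn_Fact:
  assumes "\<And>v. xs v = map v js"
  shows "dfn (\<lambda>v. Fact (\<lambda>i. v (r i)) h (xs v) (v b))"
  using dfn_Rel[of r "key h (length js)" "b # js"] by (simp add: Fact_def assms)

lemma dfn_zero_in: "dfn (\<lambda>v. zero_in (Num (\<lambda>i. v (r i))) (Less (\<lambda>i. v (r i))) (v a))"
  unfolding zero_in_def by (intro definable_conj dfn_all_Num definable_not dfn_Num dfn_Less)

lemma dfn_succ_in: "dfn (\<lambda>v. succ_in (Num (\<lambda>i. v (r i))) (Less (\<lambda>i. v (r i))) (v a) (v b))"
  unfolding succ_in_def by (intro definable_conj dfn_all_Num definable_not dfn_Num dfn_Less)

lemma dfn_numbers: "dfn (\<lambda>v. numbers (Num (\<lambda>i. v (r i))) (Less (\<lambda>i. v (r i))))"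
  unfolding numbers_def
  by (intro dfn_all_Num dfn_ex_Num definable_conj definable_disj definable_imp definable_not
      definable_eq dfn_Less dfn_zero_in dfn_succ_in)

text \<open>Program and argument count are fixed outside the logic, so each case is one concrete
  formula. The list of intermediate values in \<open>Comp\<close> has known length and becomes a
  block of quantifiers.\<close>

lemma dfn_justified:
  "dfn (\<lambda>v. justified (Num (\<lambda>i. v (r i))) (Less (\<lambda>i. v (r i))) (Fact (\<lambda>i. v (r i))) h (map v js) (v b))"
proof (cases h)
  case Zero
  then show ?thesis by (simp add: dfn_zero_in)
next
  case Succ
  show ?thesis
  proof (cases "\<exists>j. js = [j]")
    case True
    then show ?thesis using Succ dfn_succ_in by auto
  next
    case False
    then have "length js \<noteq> 1" by (auto simp: length_Suc_conv)
    then show ?thesis using definable_const[of M le False] Succ by simp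
  qed
next
  case (Proj i)
  show ?thesis
  proof (cases "i < length js")
    case True
    then show ?thesis using Proj definable_eq[of M le b "js ! i"] by simp
  next
    case False
    then show ?thesis using definable_const[of M le False] Proj by simp
  qed
next
  case (Comp f gs)
  let ?n = "length gs"
  have 1: "dfn (\<lambda>v. map v [0..<?n] ! i \<in> Num (\<lambda>j. v (r j + ?n)) \<and>
      Fact (\<lambda>j. v (r j + ?n)) (gs ! i) (map (\<lambda>j. v (j + ?n)) js) (map v [0..<?n] ! i))" if "i < ?n" for i
  proof -
    have "dfn (\<lambda>v. v i \<in> Num (\<lambda>j. v (r j + ?n)) \<and>
        Fact (\<lambda>j. v (r j + ?n)) (gs ! i) (map (\<lambda>j. v (j + ?n)) js) (v i))"
      by (intro definable_conj dfn_Num dfn_Fact[where js = "map (\<lambda>j. j + ?n) js"]) simp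
    then show ?thesis using that by simp
  qed
  have "dfn (\<lambda>v. \<exists>ys. length ys = ?n \<and> set ys \<subseteq> M \<and> ((\<forall>i<?n. ys ! i \<in> Num (\<lambda>j. v (r j)) \<and>
      Fact (\<lambda>j. v (r j)) (gs ! i) (map v js) (ys ! i)) \<and> Fact (\<lambda>j. v (r j)) f ys (v b)))"
    by (intro definable_ex_list definable_conj definable_all_less 1 dfn_Fact[where js = "[0..<?n]"]) auto
  moreover have "(\<exists>ys. length ys = ?n \<and> set ys \<subseteq> M \<and> ((\<forall>i<?n. ys ! i \<in> Num (\<lambda>j. v (r j)) \<and>
      Fact (\<lambda>j. v (r j)) (gs ! i) (map v js) (ys ! i)) \<and> Fact (\<lambda>j. v (r j)) f ys (v b))) \<longleftrightarrow>
    justified (Num (\<lambda>i. v (r i))) (Less (\<lambda>i. v (r i))) (Fact (\<lambda>i. v (r i))) h (map v js) (v b)" for v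
    unfolding Comp justified.simps
    by (intro ex_cong1) (auto simp: Num_def in_set_conv_nth subset_iff; blast?)
  ultimately show ?thesis by simp
next
  case (PrimRec f g)
  show ?thesis
  proof (cases js)
    case Nil
    then show ?thesis using definable_const[of M le False] PrimRec by simp
  next
    case (Cons j js')
    have "dfn (\<lambda>v. zero_in (Num (\<lambda>i. v (r i))) (Less (\<lambda>i. v (r i))) (v j) \<and> Fact (\<lambda>i. v (r i)) f (map v js') (v b) \<or>
      (\<exists>m\<in>Num (\<lambda>i. v (r i)). succ_in (Num (\<lambda>i. v (r i))) (Less (\<lambda>i. v (r i))) m (v j) \<and>
        (\<exists>w\<in>Num (\<lambda>i. v (r i)). Fact (\<lambda>i. v (r i)) (PrimRec f g) (m # map v js') w \<and>
           Fact (\<lambda>i. v (r i)) g (w # m # map v js') (v b))))"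
      by (intro definable_conj definable_disj dfn_ex_Num dfn_zero_in dfn_succ_in
          dfn_Fact[where js = js'] dfn_Fact[where js = "1 # map (\<lambda>i. Suc (Suc i)) js'"]
          dfn_Fact[where js = "0 # 1 # map (\<lambda>i. Suc (Suc i)) js'"]) simp_all
    then show ?thesis using PrimRec Cons by simp
  qed
next
  case (Mu f)
  have "dfn (\<lambda>v. (\<exists>z\<in>Num (\<lambda>i. v (r i)). zero_in (Num (\<lambda>i. v (r i))) (Less (\<lambda>i. v (r i))) z \<and>
        Fact (\<lambda>i. v (r i)) f (v b # map v js) z) \<and>
      (\<forall>m\<in>Num (\<lambda>i. v (r i)). Less (\<lambda>i. v (r i)) m (v b) \<longrightarrow>
        (\<exists>w\<in>Num (\<lambda>i. v (r i)). \<exists>w'\<in>Num (\<lambda>i. v (r i)).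
           succ_in (Num (\<lambda>i. v (r i))) (Less (\<lambda>i. v (r i))) w w' \<and> Fact (\<lambda>i. v (r i)) f (m # map v js) w')))"
    \<comment> \<open>The index lists count the quantifiers crossed: one for \<open>z\<close>, three
      for \<open>m\<close>, \<open>w\<close> and \<open>w'\<close>, so that \<open>m\<close> then
      has index 2.\<close>
    by (intro definable_conj definable_imp dfn_ex_Num dfn_all_Num dfn_zero_in dfn_succ_in dfn_Less
        dfn_Fact[where js = "Suc b # map Suc js"]
        dfn_Fact[where js = "2 # map (\<lambda>i. Suc (Suc (Suc i))) js"]) (simp_all add: numeral_2_eq_2)
  then show ?thesis using Mu by simp
qed

lemma dfn_sound:
  assumes "finite H"
  shows "dfn (\<lambda>v. sound (Num v) (Less v) (Fact v) H)"
proof -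
  have 1: "dfn (\<lambda>v. \<forall>xs. length xs = l \<longrightarrow> set xs \<subseteq> M \<longrightarrow> (\<forall>i<l. xs ! i \<in> Num v) \<longrightarrow>
      (\<forall>y\<in>Num v. Fact v h xs y \<longrightarrow> justified (Num v) (Less v) (Fact v) h xs y))" for h l
  proof (rule definable_all_list, intro definable_imp definable_all_less)
    fix i assume "i < l"
    then show "dfn (\<lambda>v. map v [0..<l] ! i \<in> Num (\<lambda>i. v (i + l)))" using dfn_Num by simp
  next
    have eq: "map (\<lambda>i. v (Suc i)) [0..<l] = map v (map Suc [0..<l])" for v :: "nat \<Rightarrow> 'a" by simp
    show "dfn (\<lambda>v. \<forall>y\<in>Num (\<lambda>i. v (i + l)). Fact (\<lambda>i. v (i + l)) h (map v [0..<l]) y \<longrightarrow>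
      justified (Num (\<lambda>i. v (i + l))) (Less (\<lambda>i. v (i + l))) (Fact (\<lambda>i. v (i + l))) h (map v [0..<l]) y)"
      by (intro dfn_all_Num definable_imp dfn_Fact[where js = "map Suc [0..<l]"]) (simp_all only: eq dfn_justified)
  qed
  have "dfn (\<lambda>v. \<forall>p\<in>H. \<forall>xs. length xs = snd p \<longrightarrow> set xs \<subseteq> M \<longrightarrow> (\<forall>i<snd p. xs ! i \<in> Num v) \<longrightarrow>
      (\<forall>y\<in>Num v. Fact v (fst p) xs y \<longrightarrow> justified (Num v) (Less v) (Fact v) (fst p) xs y))"
    by (intro definable_Ball assms 1)
  moreover have "(\<forall>p\<in>H. \<forall>xs. length xs = snd p \<longrightarrow> set xs \<subseteq> M \<longrightarrow> (\<forall>i<snd p. xs ! i \<in> Num v) \<longrightarrow>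
      (\<forall>y\<in>Num v. Fact v (fst p) xs y \<longrightarrow> justified (Num v) (Less v) (Fact v) (fst p) xs y)) \<longleftrightarrow>
    sound (Num v) (Less v) (Fact v) H" for v
  proof -
    have "(set xs \<subseteq> M \<and> (\<forall>i<length xs. xs ! i \<in> Num v)) \<longleftrightarrow> set xs \<subseteq> Num v" for xs
      by (auto simp: Num_def in_set_conv_nth subset_iff)
    then show ?thesis unfolding sound_def case_prod_unfold
      by (intro ball_cong refl all_cong1) metis
  qed
  ultimately show ?thesis by simp
qed

text \<open>The parameters read by \<open>Num\<close> and \<open>Less\<close> start at index 2, so
  the recycled variables 0 and 1 can be overwritten freely.\<close>

lemma numeral_fm_sat:
  assumes z: "\<And>v. range v \<subseteq> M \<Longrightarrow> sat M le v z \<longleftrightarrow> zero_in (Num v) (Less v) (v 0)"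
    and s: "\<And>v. range v \<subseteq> M \<Longrightarrow> sat M le v s \<longleftrightarrow> succ_in (Num v) (Less v) (v 1) (v 0)"
  shows "range v \<subseteq> M \<Longrightarrow> sat M le v (numeral_fm z s n) \<longleftrightarrow> numeral_in (Num v) (Less v) n (v 0)"
proof (induction n arbitrary: v)
  case 0
  then show ?case by (simp add: z)
next
  case (Suc n)
  have N: "Num (v(1 := a, 0 := b)) = Num v" "Num (v(1 := a)) = Num v" for a b
    by (simp_all add: Num_def)
  have L: "Less (v(1 := a, 0 := b)) = Less v" "Less (v(1 := a)) = Less v" for a b
    by (simp_all add: Less_def Rel_def fun_eq_iff)
  have r: "range (v(1 := a)) \<subseteq> M" "range (v(1 := a, 0 := b)) \<subseteq> M" if "a \<in> M" "b \<in> M" for a b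
    using Suc.prems that by auto
  have "sat M le v (numeral_fm z s (Suc n)) \<longleftrightarrow>
     (\<exists>a\<in>M. succ_in (Num v) (Less v) a (v 0) \<and> (\<exists>b\<in>M. b = a \<and> numeral_in (Num v) (Less v) n b))"
    unfolding numeral_fm.simps sat.simps
  proof (intro bex_cong refl conj_cong)
    fix a assume a: "a \<in> M"
    show "sat M le (v(1 := a)) s \<longleftrightarrow> succ_in (Num v) (Less v) a (v 0)"
      using s[OF r(1)[OF a a]] unfolding N L by simp
    fix b assume b: "b \<in> M"
    show "(v(1 := a, 0 := b)) 0 = (v(1 := a, 0 := b)) 1 \<longleftrightarrow> b = a" by simp
    show "sat M le (v(1 := a, 0 := b)) (numeral_fm z s n) \<longleftrightarrow> numeral_in (Num v) (Less v) n b"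
      using Suc.IH[OF r(2)[OF a b]] unfolding N L fun_upd_same .
  qed
  also have "\<dots> \<longleftrightarrow> numeral_in (Num v) (Less v) (Suc n) (v 0)"
    by (auto simp: succ_in_def Num_def)
  finally show ?case .
qed

section \<open>Realising a finite set of facts by parameters\<close>

lemma realize_relations:
  fixes b m :: nat
  assumes rich: "rich M le" and b: "b > 0" "m < b" and T: "finite T"
    "\<And>k ys. (k, ys) \<in> T \<Longrightarrow> set ys \<subseteq> {..<b} \<and> length ys = ar k"
  shows "\<exists>v u. range v \<subseteq> M \<and> v 0 = u m \<and> inj_on u {..<b} \<and> Num v = u ` {..<b} \<and>
    (\<forall>k ms. set ms \<subseteq> {..<b} \<longrightarrow> length ms = ar k \<longrightarrow> (Rel v k (map u ms) \<longleftrightarrow> (k, ms) \<in> T))"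
proof -
  obtain ts where ts: "set ts = T" using finite_list[OF T(1)] by blast
  define n where "n = b + length ts"
  have "n > 0" using b by (simp add: n_def)
  with rich obtain q a u where qa: "q \<in> M" "a \<in> M" and c: "codes_graphs M le n q a u"
    unfolding rich_def by blast
  have u: "inj_on u {..<n}" "{x \<in> M. node_like M le q a x} = u ` {..<n}"
    using c unfolding codes_graphs_def by simp_all
  have "\<forall>ps. \<exists>d. set ps \<subseteq> {..<n} \<times> {..<n} \<longrightarrow> d \<in> M \<and> codes_graph M le n q u ps d"
    using c unfolding codes_graphs_def by metis
  from choice[OF this] obtain d where d': "\<And>ps. set ps \<subseteq> {..<n} \<times> {..<n} \<Longrightarrow>
      d ps \<in> M \<and> codes_graph M le n q u ps (d ps)" by metis
  have d: "set ps \<subseteq> {..<n} \<times> {..<n} \<Longrightarrow> d ps \<in> M"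
    "set ps \<subseteq> {..<n} \<times> {..<n} \<Longrightarrow> i < n \<Longrightarrow> j < n \<Longrightarrow>
        linked M le q (d ps) (u i) (u j) \<longleftrightarrow> (\<exists>(k, l)\<in>set ps. {i, j} \<subseteq> {k, l})" for ps i j
    using d'[of ps] unfolding codes_graph_def by simp_all
  \<comment> \<open>Vertices below \<open>b\<close> are the numbers, and vertex \<open>b + t\<close>
    stands for the tuple \<open>ts ! t\<close>. Loops express marks on single vertices; the edges of
    \<open>PC i\<close> always join a tuple to a number.\<close>
  define P0 where "P0 = map (\<lambda>i. (i, i)) [0..<b]"
  define PC where "PC i = map (\<lambda>t. (b + t, snd (ts ! t) ! i)) (filter (\<lambda>t. i < length (snd (ts ! t))) [0..<length ts])" for i
  define PT where "PT k = map (\<lambda>t. (b + t, b + t)) (filter (\<lambda>t. fst (ts ! t) = k) [0..<length ts])" for k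
  have P0: "set P0 \<subseteq> {..<n} \<times> {..<n}" by (auto simp: P0_def n_def)
  have sub: "set (snd (ts ! t)) \<subseteq> {..<b}" "length (snd (ts ! t)) = ar (fst (ts ! t))" if "t < length ts" for t
    using T(2)[of "fst (ts ! t)" "snd (ts ! t)"] nth_mem[OF that] ts by auto
  have PC1: "b \<le> k \<and> k < n \<and> l < b" if "(k, l) \<in> set (PC i)" for i k l
  proof -
    from that obtain t where t: "t < length ts" "i < length (snd (ts ! t))" "k = b + t" "l = snd (ts ! t) ! i"
      by (auto simp: PC_def)
    have "l \<in> {..<b}" unfolding t(4) by (rule subsetD[OF sub(1)[OF t(1)] nth_mem[OF t(2)]])
    with t show ?thesis by (simp add: n_def)
  qed
  have PC: "set (PC i) \<subseteq> {..<n} \<times> {..<n}" for i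
    using PC1[of _ _ i] by (force simp: n_def)
  have PT: "set (PT i) \<subseteq> {..<n} \<times> {..<n}" for i by (auto simp: PT_def n_def)
  have uM: "u i \<in> M" "node_like M le q a (u i)" if "i < n" for i using u(2) that by blast+
  define v where "v i = (if i = 0 then u m else if i = 1 then u 0 else if i = 2 then q
     else if i = 3 then a else if i = 4 then d P0
     else if odd i then d (PC ((i - 5) div 2)) else d (PT ((i - 6) div 2)))" for i
  have v: "v 0 = u m" "v 2 = q" "v 3 = a" "v 4 = d P0" "v (5 + 2 * i) = d (PC i)" "v (6 + 2 * i) = d (PT i)" for i
    by (simp_all add: v_def)
  have "range v \<subseteq> M" using qa d(1)[OF P0] d(1)[OF PC] d(1)[OF PT] uM(1) b
    by (auto simp: v_def n_def)
  moreover have "Num v = u ` {..<b}"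
  proof -
    have "x \<in> Num v \<longleftrightarrow> (\<exists>i<n. x = u i \<and> linked M le q (d P0) x x)" for x
      unfolding Num_def v using u(2) by blast
    moreover have "linked M le q (d P0) (u i) (u i) \<longleftrightarrow> i < b" if "i < n" for i
      using d(2)[OF P0 that that] by (auto simp: P0_def)
    moreover have "b \<le> n" by (simp add: n_def)
    ultimately show ?thesis by (auto intro: less_le_trans) 
  qed
  moreover have "Rel v k (map u ms) \<longleftrightarrow> (k, ms) \<in> T" if ms: "set ms \<subseteq> {..<b}" "length ms = ar k" for k ms
  proof -
    have PT': "linked M le q (d (PT k)) (u i) (u i) \<longleftrightarrow> (\<exists>t<length ts. i = b + t \<and> fst (ts ! t) = k)"
      if "i < n" for i using d(2)[OF PT that that] by (auto simp: PT_def)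
    have PC': "linked M le q (d (PC i)) (u (b + t)) (u x) \<longleftrightarrow> i < length (snd (ts ! t)) \<and> snd (ts ! t) ! i = x"
      if t: "t < length ts" and x: "x < b" for t x i
    proof -
      have "b + t < n" "x < n" using t x by (auto simp: n_def)
      then have "linked M le q (d (PC i)) (u (b + t)) (u x) \<longleftrightarrow> (\<exists>(k, l)\<in>set (PC i). {b + t, x} \<subseteq> {k, l})"
        by (rule d(2)[OF PC])
      \<comment> \<open>Tuples have indices at least \<open>b\<close> and entries below
        \<open>b\<close>, so an edge determines which of its ends is the tuple, although linking is
        symmetric.\<close>
      also have "\<dots> \<longleftrightarrow> (b + t, x) \<in> set (PC i)"
      proof
        assume "\<exists>(k, l)\<in>set (PC i). {b + t, x} \<subseteq> {k, l}"
        then obtain k l where kl: "(k, l) \<in> set (PC i)" "{b + t, x} \<subseteq> {k, l}" by blast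
        from PC1[OF kl(1)] have "k \<ge> b" "l < b" by simp_all
        with kl(2) x have "k = b + t" "l = x" by auto
        with kl(1) show "(b + t, x) \<in> set (PC i)" by simp
      qed auto
      also have "\<dots> \<longleftrightarrow> i < length (snd (ts ! t)) \<and> snd (ts ! t) ! i = x"
        using t by (auto simp: PC_def)
      finally show ?thesis .
    qed
    have "Rel v k (map u ms) \<longleftrightarrow> (\<exists>j<n. linked M le q (d (PT k)) (u j) (u j) \<and>
        (\<forall>i<length ms. linked M le q (d (PC i)) (u j) (u (ms ! i))))"
    proof -
      have "(\<exists>t\<in>M. node_like M le q a t \<and> X t) \<longleftrightarrow> (\<exists>t\<in>{x \<in> M. node_like M le q a x}. X t)" for X by blast
      then have "(\<exists>t\<in>M. node_like M le q a t \<and> X t) \<longleftrightarrow> (\<exists>j<n. X (u j))" for X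
        unfolding u(2) by auto
      then show ?thesis unfolding Rel_def v by simp
    qed
    also have "\<dots> \<longleftrightarrow> (\<exists>t<length ts. fst (ts ! t) = k \<and>
        (\<forall>i<length ms. linked M le q (d (PC i)) (u (b + t)) (u (ms ! i))))"
    proof
      assume "\<exists>j<n. linked M le q (d (PT k)) (u j) (u j) \<and>
        (\<forall>i<length ms. linked M le q (d (PC i)) (u j) (u (ms ! i)))"
      then show "\<exists>t<length ts. fst (ts ! t) = k \<and>
        (\<forall>i<length ms. linked M le q (d (PC i)) (u (b + t)) (u (ms ! i)))" using PT' by blast
    next
      assume "\<exists>t<length ts. fst (ts ! t) = k \<and>
        (\<forall>i<length ms. linked M le q (d (PC i)) (u (b + t)) (u (ms ! i)))"
      then obtain t where t: "t < length ts" "fst (ts ! t) = k"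
        "\<forall>i<length ms. linked M le q (d (PC i)) (u (b + t)) (u (ms ! i))" by blast
      moreover have "b + t < n" using t(1) by (simp add: n_def)
      ultimately show "\<exists>j<n. linked M le q (d (PT k)) (u j) (u j) \<and>
        (\<forall>i<length ms. linked M le q (d (PC i)) (u j) (u (ms ! i)))"
        using PT' by (intro exI[of _ "b + t"]) blast
    qed
    also have "\<dots> \<longleftrightarrow> (\<exists>t<length ts. fst (ts ! t) = k \<and> snd (ts ! t) = ms)"
    proof (intro ex_cong1 conj_cong refl)
      fix t assume t: "t < length ts" "fst (ts ! t) = k"
      have "ms ! i < b" if "i < length ms" for i using ms(1) that nth_mem by blast
      then have "(\<forall>i<length ms. linked M le q (d (PC i)) (u (b + t)) (u (ms ! i))) \<longleftrightarrow>
         (\<forall>i<length ms. i < length (snd (ts ! t)) \<and> snd (ts ! t) ! i = ms ! i)"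
        using PC'[OF t(1)] by simp
      \<comment> \<open>Both tuples have length \<open>ar k\<close>, so agreement in the inspected
        columns is equality.\<close>
      also have "\<dots> \<longleftrightarrow> snd (ts ! t) = ms" using sub(2)[OF t(1)] t(2) ms(2) by (auto simp: list_eq_iff_nth_eq)
      finally show "(\<forall>i<length ms. linked M le q (d (PC i)) (u (b + t)) (u (ms ! i))) \<longleftrightarrow> snd (ts ! t) = ms" .
    qed
    also have "\<dots> \<longleftrightarrow> (k, ms) \<in> T" unfolding ts[symmetric] in_set_conv_nth by (auto simp: prod_eq_iff)
    finally show ?thesis .
  qed
  moreover have "inj_on u {..<b}" using u(1) by (rule inj_on_subset) (simp add: n_def)
  ultimately show ?thesis using v(1) by blast
qed

lemma realize_facts:
  assumes rich: "rich M le" and S: "finite S" "justified_set S" "(h, [m], 1) \<in> S"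
  shows "\<exists>v. range v \<subseteq> M \<and> numeral_in (Num v) (Less v) m (v 0) \<and> numbers (Num v) (Less v) \<and>
    sound (Num v) (Less v) (Fact v) H \<and> (\<exists>y\<in>Num v. numeral_in (Num v) (Less v) 1 y \<and> Fact v h [v 0] y)"
proof -
  have "finite (\<Union>(h, ms, n)\<in>S. set (n # ms))" using S(1) by auto
  then obtain b where b: "\<forall>i\<in>(\<Union>(h, ms, n)\<in>S. set (n # ms)). i < b"
    using finite_nat_set_iff_bounded by blast
  have Sb: "set ms \<subseteq> {..<b} \<and> n < b" if "(h, ms, n) \<in> S" for h ms n using b that by fastforce
  have mb: "m < b" "1 < b" using Sb[OF S(3)] by auto
  define T where "T = (\<lambda>(i, j). (0, [i, j])) ` {(i, j). i < j \<and> j < b} \<union>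
    (\<lambda>(h, ms, n). (key h (length ms), n # ms)) ` S"
  \<comment> \<open>A fact is stored with its result in front, hence one entry more than the program
    has arguments; the order is binary.\<close>
  define ar where "ar k = (if k = 0 then 2 else Suc (snd (from_nat (k - 1) :: recf \<times> nat)))" for k
  have ark: "ar (key h l) = Suc l" for h l by (simp add: ar_def key_def)
  have "{(i, j). i < j \<and> j < b} \<subseteq> {..<b} \<times> {..<b}" by auto
  then have "finite {(i, j). i < j \<and> j < b}" by (rule finite_subset) simp
  then have "finite T" using S(1) by (simp add: T_def)
  moreover have "set ys \<subseteq> {..<b} \<and> length ys = ar k" if "(k, ys) \<in> T" for k ys
  proof -
    from that consider i j where "k = 0" "ys = [i, j]" "i < j" "j < b"
      | h ms n where "(h, ms, n) \<in> S" "k = key h (length ms)" "ys = n # ms"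
      unfolding T_def by auto
    then show ?thesis
    proof cases
      case 1
      then show ?thesis by (simp add: ar_def)
    next
      case 2
      then show ?thesis using Sb[OF 2(1)] by (simp add: ark)
    qed
  qed
  ultimately obtain v u where v: "range v \<subseteq> M" "v 0 = u m" "inj_on u {..<b}" "Num v = u ` {..<b}"
    "\<And>k ms. set ms \<subseteq> {..<b} \<Longrightarrow> length ms = ar k \<Longrightarrow> Rel v k (map u ms) \<longleftrightarrow> (k, ms) \<in> T"
    using realize_relations[OF rich _ mb(1), of T ar] mb by auto
  have lt: "Less v (u i) (u j) \<longleftrightarrow> i < j" if "i < b" "j < b" for i j
  proof -
    have "Less v (u i) (u j) \<longleftrightarrow> (0, [i, j]) \<in> T"
      using v(5)[of "[i, j]" 0] that by (simp add: Less_def ar_def)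
    also have "\<dots> \<longleftrightarrow> i < j" using that by (auto simp: T_def image_iff key_def)
    finally show ?thesis .
  qed
  have F: "Fact v h (map u ms) (u n) \<longleftrightarrow> (h, ms, n) \<in> S" if "set ms \<subseteq> {..<b}" "n < b" for h ms n
  proof -
    have "Fact v h (map u ms) (u n) \<longleftrightarrow> (key h (length ms), n # ms) \<in> T"
      using v(5)[of "n # ms" "key h (length ms)"] that by (simp add: Fact_def ark)
    also have "\<dots> \<longleftrightarrow> (h, ms, n) \<in> S" by (force simp: T_def image_iff key_def)
    finally show ?thesis .
  qed
  have "sound (Num v) (Less v) (Fact v) H" unfolding sound_def
  proof (clarify)
    fix h xs y assume xs: "set xs \<subseteq> Num v" and y: "y \<in> Num v" and f: "Fact v h xs y"
    have "xs \<in> lists (u ` {..<b})" using xs unfolding v(4) by auto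
    then obtain ms where ms: "xs = map u ms" "set ms \<subseteq> {..<b}" unfolding lists_image by auto
    from y obtain n where n: "y = u n" "n < b" unfolding v(4) by auto
    have "(h, ms, n) \<in> S" using f F ms n by simp
    then have "justified UNIV (<) (\<lambda>h ms n. (h, ms, n) \<in> S) h ms n" using S(2) unfolding justified_set_def by blast
    then show "justified (Num v) (Less v) (Fact v) h xs y" unfolding ms(1) n(1)
      using ms(2) n(2) Sb F by (intro justified_transfer[OF v(4) lt]) auto
  qed
  moreover have "numbers (Num v) (Less v)" by (rule numbers_initial[OF v(4) lt]) (use mb in auto)
  moreover have "numeral_in (Num v) (Less v) m (v 0)"
    unfolding v(2) by (rule numeral_in_initial[OF v(4) lt mb(1)])
  moreover have "numeral_in (Num v) (Less v) 1 (u 1)" by (rule numeral_in_initial[OF v(4) lt mb(2)])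
  moreover have "u 1 \<in> Num v" using mb(2) v(4) by auto
  moreover have "Fact v h [v 0] (u 1)" using F[of "[m]" 1 h] S(3) mb v(2) by simp
  ultimately show ?thesis using v(1) by blast
qed

section \<open>Diagonalisation against a decision procedure\<close>

theorem rich_undecidable:
  assumes rich: "rich M le"
  shows "\<not> decidable_theory (fo_theory M le)"
proof
  assume "decidable_theory (fo_theory M le)"
  then obtain e where e: "\<And>n. evals e [n] (if n \<in> fm_code ` fo_theory M le then 1 else 0)"
    unfolding decidable_theory_def decidable_set_def by blast
  have ne: "M \<noteq> {}" using rich unfolding rich_def by blast
  obtain z where z: "\<And>v. range v \<subseteq> M \<Longrightarrow> sat M le v z \<longleftrightarrow> zero_in (Num v) (Less v) (v 0)"
    using dfn_zero_in[of "\<lambda>i. i" 0] unfolding definable_def by blast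
  obtain s where s: "\<And>v. range v \<subseteq> M \<Longrightarrow> sat M le v s \<longleftrightarrow> succ_in (Num v) (Less v) (v 1) (v 0)"
    using dfn_succ_in[of "\<lambda>i. i" 1 0] unfolding definable_def by blast
  obtain k where k: "\<forall>i\<in>free_vars z \<union> free_vars s \<union> {0, 1}. i < k"
    using finite_nat_set_iff_bounded[of "free_vars z \<union> free_vars s \<union> {0, 1}"] by auto
  \<comment> \<open>\<open>h\<close> rebuilds the diagonal sentence from the code of any formula and
    asks \<open>e\<close> about it. It is fixed before \<open>p\<close>, so \<open>p\<close> can
    speak about \<open>h\<close> and its code can then be given to \<open>h\<close>.\<close>
  define h where "h = Comp e [r_diagonal z s k]"
  have "dfn (\<lambda>v. numbers (Num v) (Less v) \<and> sound (Num v) (Less v) (Fact v) (subprograms h 1) \<and>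
      (\<exists>y\<in>Num v. (\<exists>x\<in>Num v. succ_in (Num v) (Less v) x y \<and> zero_in (Num v) (Less v) x) \<and> Fact v h [v 0] y))"
    by (intro definable_conj dfn_numbers dfn_sound finite_subprograms dfn_ex_Num dfn_succ_in dfn_zero_in
        dfn_Fact[where js = "[1]"]) simp
  then obtain p where p: "\<And>v. range v \<subseteq> M \<Longrightarrow> sat M le v p \<longleftrightarrow>
      numbers (Num v) (Less v) \<and> sound (Num v) (Less v) (Fact v) (subprograms h 1) \<and>
      (\<exists>y\<in>Num v. numeral_in (Num v) (Less v) 1 y \<and> Fact v h [v 0] y)"
    unfolding definable_def One_nat_def numeral_in.simps by blast
  define m where "m = fm_code p"
  let ?d = "diagonal z s k p"
  have fv: "free_vars (Conj (numeral_fm z s m) p) \<subseteq> {..<m + k}"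
  proof -
    \<comment> \<open>Variables of \<open>p\<close> are bounded by its code \<open>m\<close> only
      weakly; k > 0 makes the bound m + k strict.\<close>
    have k0: "0 < k" using k by simp
    have "free_vars z \<union> free_vars s \<union> {0, 1} \<subseteq> {..<k}" using k unfolding lessThan_def by blast
    then have "free_vars (numeral_fm z s m) \<subseteq> {..<k}" using free_vars_numeral_fm by (rule subset_trans[rotated])
    also have "\<dots> \<subseteq> {..<m + k}" by simp
    finally have "free_vars (numeral_fm z s m) \<subseteq> {..<m + k}" .
    moreover have "free_vars p \<subseteq> {..<m + k}"
    proof
      fix i assume "i \<in> free_vars p"
      then have "i \<le> m" unfolding m_def by (rule free_vars_le_code)
      with k0 show "i \<in> {..<m + k}" by simp
    qed
    ultimately show ?thesis by simp
  qed
  have d: "?d \<in> fo_theory M le \<longleftrightarrow> \<not> (\<exists>w. range w \<subseteq> M \<and> sat M le w (Conj (numeral_fm z s m) p))"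
    unfolding diagonal_def m_def[symmetric] by (rule sentence_in_theory[OF fv ne])
  have sd: "sat M le w (Conj (numeral_fm z s m) p) \<longleftrightarrow> numeral_in (Num w) (Less w) m (w 0) \<and> sat M le w p"
    if "range w \<subseteq> M" for w using numeral_fm_sat[OF z s that] by simp
  have "evals h [m] (if fm_code ?d \<in> fm_code ` fo_theory M le then 1 else 0)"
    unfolding h_def m_def by (rule evals_Comp1[OF evals_diagonal e])
  then have h: "evals h [m] (if ?d \<in> fo_theory M le then 1 else 0)"
    by (simp add: inj_image_mem_iff[OF inj_fm_code])
  show False
  proof (cases "?d \<in> fo_theory M le")
    case True
    with h have "evals h [m] 1" by simp
    then obtain S where S: "finite S" "justified_set S" "(h, [m], 1) \<in> S" using evals_justified by blast
    from realize_facts[OF rich S, of "subprograms h 1"] obtain v where v: "range v \<subseteq> M"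
      "numeral_in (Num v) (Less v) m (v 0) \<and> numbers (Num v) (Less v) \<and>
       sound (Num v) (Less v) (Fact v) (subprograms h 1) \<and>
       (\<exists>y\<in>Num v. numeral_in (Num v) (Less v) 1 y \<and> Fact v h [v 0] y)" by blast
    then have "sat M le v (Conj (numeral_fm z s m) p)" unfolding sd[OF v(1)] p[OF v(1)] by simp
    with v(1) have "\<exists>w. range w \<subseteq> M \<and> sat M le w (Conj (numeral_fm z s m) p)" by (intro exI conjI)
    with True d show False by blast
  next
    case False
    with h have h0: "evals h [m] 0" by simp
    from False obtain w where w: "range w \<subseteq> M" "sat M le w (Conj (numeral_fm z s m) p)" unfolding d by blast
    from w(2) obtain y where y: "numeral_in (Num w) (Less w) m (w 0)" "numbers (Num w) (Less w)"
      "sound (Num w) (Less w) (Fact w) (subprograms h 1)" "y \<in> Num w"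
      "numeral_in (Num w) (Less w) 1 y" "Fact w h [w 0] y"
      unfolding sd[OF w(1)] p[OF w(1)] by blast
    have 1: "sound (Num w) (Less w) (Fact w) (subprograms h (length [m]))" using y(3) by simp
    have 2: "list_all2 (numeral_in (Num w) (Less w)) [m] [w 0]" using y(1) by simp
    have "numeral_in (Num w) (Less w) 0 y" using evals_sound[OF y(2) h0 1 2 y(4,6)] .
    from numeral_in_inj[OF y(2) this y(5)] show False by simp
  qed
qed

end

section \<open>The quotient order codes all finite graphs\<close>

lemma equiv_preorder_equiv:
  assumes "\<And>x. x \<in> A \<Longrightarrow> le x x" "\<And>x y z. le x y \<Longrightarrow> le y z \<Longrightarrow> le x z"
  shows "equiv A (preorder_equiv A le)"
proof (rule equivI)
  show "preorder_equiv A le \<subseteq> A \<times> A" by (auto simp: preorder_equiv_def)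
  show "refl_on A (preorder_equiv A le)" by (auto simp: refl_on_def preorder_equiv_def assms(1))
  show "sym (preorder_equiv A le)" by (auto simp: sym_def preorder_equiv_def)
  show "trans (preorder_equiv A le)"
    unfolding trans_def preorder_equiv_def using assms(2) by fast
qed

section \<open>Passing from a preorder to its quotient\<close>

locale preordered =
  fixes A :: "'a set" and le :: "'a \<Rightarrow> 'a \<Rightarrow> bool"
  assumes le_refl: "x \<in> A \<Longrightarrow> le x x" and le_trans: "le x y \<Longrightarrow> le y z \<Longrightarrow> le x z"
begin

definition cls :: "'a \<Rightarrow> 'a set" where "cls x = preorder_equiv A le `` {x}"

abbreviation "Q \<equiv> quotient_carrier A le"

lemma carrier_eq: "Q = cls ` A"
  by (auto simp: quotient_carrier_def quotient_def cls_def)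

lemma le_cls: "x \<in> A \<Longrightarrow> y \<in> A \<Longrightarrow> quotient_le le (cls x) (cls y) \<longleftrightarrow> le x y"
proof
  assume xy: "x \<in> A" "y \<in> A"
  have mem: "z \<in> cls w \<longleftrightarrow> w \<in> A \<and> z \<in> A \<and> le w z \<and> le z w" for w z
    by (auto simp: cls_def preorder_equiv_def)
  {
    assume "quotient_le le (cls x) (cls y)"
    then obtain x' y' where "x' \<in> cls x" "y' \<in> cls y" "le x' y'" unfolding quotient_le_def by blast
    then have "le x x'" "le x' y'" "le y' y" unfolding mem by simp_all
    then show "le x y" using le_trans by blast
  }
  assume "le x y"
  moreover have "x \<in> cls x" "y \<in> cls y" using xy le_refl unfolding mem by simp_all
  ultimately show "quotient_le le (cls x) (cls y)" unfolding quotient_le_def by blast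
qed

lemma cls_eq_iff: "x \<in> A \<Longrightarrow> y \<in> A \<Longrightarrow> cls x = cls y \<longleftrightarrow> le x y \<and> le y x"
  unfolding cls_def by (subst eq_equiv_class_iff[OF equiv_preorder_equiv])
    (auto simp: preorder_equiv_def intro: le_refl le_trans)

lemma tree_like_cls: "q \<in> A \<Longrightarrow> z \<in> A \<Longrightarrow>
    tree_like Q (quotient_le le) (cls q) (cls z) \<longleftrightarrow> tree_like A le q z"
  unfolding tree_like_def carrier_eq ball_simps bex_simps by (simp add: le_cls cong: ball_cong bex_cong)

lemma node_like_cls: "q \<in> A \<Longrightarrow> a \<in> A \<Longrightarrow> x \<in> A \<Longrightarrow>
    node_like Q (quotient_le le) (cls q) (cls a) (cls x) \<longleftrightarrow> node_like A le q a x"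
  unfolding node_like_def using tree_like_cls by (simp add: carrier_eq le_cls)

lemma linked_cls: "q \<in> A \<Longrightarrow> d \<in> A \<Longrightarrow> x \<in> A \<Longrightarrow> y \<in> A \<Longrightarrow>
    linked Q (quotient_le le) (cls q) (cls d) (cls x) (cls y) \<longleftrightarrow> linked A le q d x y"
  unfolding linked_def using tree_like_cls by (simp add: carrier_eq le_cls)

end

context er_family
begin

lemma preordered: "preordered A (\<le>\<^sub>c)"
  by unfold_locales (auto intro: cont_reducible_refl cont_reducible_trans)

interpretation preordered A "(\<le>\<^sub>c)"
  by (rule preordered)

lemma rich_quotient: "rich (quotient_carrier A (\<le>\<^sub>c)) (quotient_le (\<le>\<^sub>c))"
  unfolding rich_def
proof (intro allI impI)
  fix n :: nat assume n: "n > 0"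
  let ?q = "eqc (lab core)" and ?a = "eqc (forest_lab (map (vertex n) [0..<n]))"
  define U where "U i = eqc (lab (vertex n i))" for i
  have U: "U i \<in> A" for i unfolding U_def by (rule rigid_in[OF rigid_vertex])
  have q: "?q \<in> A" by (rule rigid_in) (simp add: rigid_vert)
  have a: "?a \<in> A" by (rule forest_in) (use n in \<open>auto simp: rigid_vertex\<close>)
  have inj: "inj_on (\<lambda>i. cls (U i)) {..<n}"
  proof (rule inj_onI)
    fix i j assume ij: "i \<in> {..<n}" "j \<in> {..<n}" "cls (U i) = cls (U j)"
    then have "U i \<le>\<^sub>c U j" using cls_eq_iff[OF U U] by blast
    then show "i = j" using ij hle_vertex by (simp add: U_def rigid_reduce_iff rigid_vertex)
  qed
  have nodes: "{x \<in> Q. node_like Q (quotient_le (\<le>\<^sub>c)) (cls ?q) (cls ?a) x} = (\<lambda>i. cls (U i)) ` {..<n}"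
  proof (intro equalityI subsetI)
    fix X assume X: "X \<in> {x \<in> Q. node_like Q (quotient_le (\<le>\<^sub>c)) (cls ?q) (cls ?a) x}"
    then obtain x where x: "x \<in> A" "X = cls x" unfolding carrier_eq by blast
    with X have "node_like A (\<le>\<^sub>c) ?q ?a x" using node_like_cls[OF q a x(1)] by simp
    from node_like_is_vertex[OF n x(1) this] obtain i where "i < n" "x \<le>\<^sub>c U i" "U i \<le>\<^sub>c x"
      unfolding U_def by blast
    then show "X \<in> (\<lambda>i. cls (U i)) ` {..<n}" using cls_eq_iff[OF x(1) U] x(2) by blast
  next
    fix X assume "X \<in> (\<lambda>i. cls (U i)) ` {..<n}"
    then obtain i where i: "i < n" "X = cls (U i)" by auto
    have "node_like A (\<le>\<^sub>c) ?q ?a (U i)" unfolding U_def by (rule node_like_vertex[OF i(1)])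
    then show "X \<in> {x \<in> Q. node_like Q (quotient_le (\<le>\<^sub>c)) (cls ?q) (cls ?a) x}"
      using node_like_cls[OF q a U] i(2) U by (auto simp: carrier_eq)
  qed
  have graph: "\<exists>d\<in>Q. codes_graph Q (quotient_le (\<le>\<^sub>c)) n (cls ?q) (\<lambda>i. cls (U i)) ps d"
    if ps: "set ps \<subseteq> {..<n} \<times> {..<n}" for ps
  proof (intro bexI)
    let ?d = "eqc (forest_lab (map (edge_tree n) ((n, n) # ps)))"
    have d: "?d \<in> A" by (rule forest_in) (auto simp: rigid_edge_tree)
    then show "cls ?d \<in> Q" by (simp add: carrier_eq)
    have ps': "\<forall>(k, l)\<in>set ps. k < n \<and> l < n" using ps by auto
    show "codes_graph Q (quotient_le (\<le>\<^sub>c)) n (cls ?q) (\<lambda>i. cls (U i)) ps (cls ?d)"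
      unfolding codes_graph_def
    proof (intro allI impI)
      fix i j assume "i < n" "j < n"
      from linked_cls[OF q d U[of i] U[of j]] linked_iff[OF ps' this]
      show "linked Q (quotient_le (\<le>\<^sub>c)) (cls ?q) (cls ?d) (cls (U i)) (cls (U j)) \<longleftrightarrow>
        (\<exists>(k, l)\<in>set ps. {i, j} \<subseteq> {k, l})"
        by (simp only: U_def)
    qed
  qed
  have "codes_graphs Q (quotient_le (\<le>\<^sub>c)) n (cls ?q) (cls ?a) (\<lambda>i. cls (U i))"
    unfolding codes_graphs_def using inj nodes graph by blast
  then show "\<exists>q\<in>Q. \<exists>a\<in>Q. \<exists>u. codes_graphs Q (quotient_le (\<le>\<^sub>c)) n q a u"
    using q a unfolding carrier_eq by blast
qed

end

theorem theorem11p2: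
  fixes k :: nat and A :: "baire rel set"
  assumes "k \<ge> 3"
    and "A \<subseteq> ER"
    and "\<And>E F. F \<in> A \<Longrightarrow> E \<in> ER \<Longrightarrow> E \<le>\<^sub>c F \<Longrightarrow> E \<in> A"
    and "\<And>E. E \<in> ER \<Longrightarrow> at_most_classes k E \<Longrightarrow> E \<in> BC_open \<Longrightarrow> E \<in> A"
  shows "\<not> decidable_theory
           (fo_theory (quotient_carrier A (\<le>\<^sub>c)) (quotient_le (\<le>\<^sub>c)))"
proof -
  interpret er_family A
  proof
    fix t assume t: "labels t \<subseteq> {0, 1, 2}"
    \<comment> \<open>Here k \<ge> 3 enters: a tree on three labels induces at most three
      classes.\<close>
    have "card (labels t) \<le> card {0, 1, 2 :: nat}" by (rule card_mono[OF _ t]) simp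
    then have "card (labels t) \<le> k" using assms(1) by simp
    then have "at_most_classes k (eqc (lab t))" using eqc_lab_classes[of t] by (auto simp: at_most_classes_def)
    then show "eqc (lab t) \<in> A" by (intro assms(4) eqc_ER eqc_lab_BC)
  qed (use assms in auto)
  show ?thesis by (rule rich_undecidable[OF rich_quotient])
qed

end
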